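(* If $M = \mathbb{H}^3/\Gamma$ is a finite-volume, complete hyperbolic 3-manifold, then the real length spectrum of $M$ is of unbounded multiplicity; that is, for every positive integer $n$ there is a real number $\ell > 0$ such that at least $n$ distinct (unoriented) closed geodesics of $M$ have length $\ell$.
   Context: Hyperbolic 3-manifolds are written $M = \mathbb{H}^3/\Gamma$, where $\Gamma \subset PSL_2(\mathbb{C})$ is a Kleinian group, i.e. a discrete subgroup of $PSL_2(\mathbb{C})$ acting on $\mathbb{H}^3$ by orientation-preserving isometries. The real length spectrum of $M$ is the set of lengths of closed geodesics of $M$, counted with multiplicity. Closed geodesics correspond to conjugacy classes of loxodromic elements $\gamma \in \Gamma$ (those with $\mathrm{tr}^2\gamma \notin [0,4]$), where the classes of $\gamma$ and $\gamma^{-1}$ are regarded as equivalent; the length of the geodesic corresponding to $\gamma$ is the distance by which $\gamma$ translates along its invariant axis in $\mathbb{H}^3$. *)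

theory Defs
  imports "HOL-Analysis.Analysis" "HOL-Algebra.Coset"
begin

section \<open>The group PSL(2,C)\<close>

definition SL2C :: "(complex^2^2) monoid" where
  "SL2C = \<lparr>carrier = {A. det A = 1}, mult = (**), one = mat 1\<rparr>"

text \<open>The elements of \<open>PSL2C\<close> are the cosets \<open>{A, -A}\<close>.\<close>

definition PSL2C :: "(complex^2^2) set monoid" where
  "PSL2C = SL2C Mod {mat 1, - mat 1}"

text \<open>The quotient topology: a set of cosets is open iff its preimage in \<open>SL2C\<close>, which is the union
  of the cosets, is open for the topology inherited from the space of matrices.\<close>

definition PSL2C_topology :: "(complex^2^2) set topology" where
  "PSL2C_topology = topology (\<lambda>U. U \<subseteq> carrier PSL2C \<and>
     openin (top_of_set (carrier SL2C)) (\<Union>U))"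

definition Kleinian_group :: "(complex^2^2) set set \<Rightarrow> bool" where
  "Kleinian_group \<Gamma> \<longleftrightarrow> subgroup \<Gamma> PSL2C \<and>
     subtopology PSL2C_topology \<Gamma> = discrete_topology \<Gamma>"

section \<open>The upper half-space model of hyperbolic 3-space\<close>

definition H3 :: "(complex \<times> real) set" where
  "H3 = {(z, t). t > 0}"

definition hdist :: "complex \<times> real \<Rightarrow> complex \<times> real \<Rightarrow> real" where
  "hdist p q = arcosh (1 + ((cmod (fst p - fst q))\<^sup>2 + (snd p - snd q)\<^sup>2) / (2 * snd p * snd q))"

text \<open>The Riemannian volume of the metric \<open>(\<bar>dz\<bar>\<^sup>2 + dt\<^sup>2) / t\<^sup>2\<close>.\<close>

definition hvolume :: "(complex \<times> real) measure" where
  "hvolume = density (restrict_space lborel H3) (\<lambda>p. ennreal (1 / snd p ^ 3))"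

text \<open>The Poincare extension of the Moebius transformation \<open>z \<mapsto> (a z + b) / (c z + d)\<close>.\<close>

definition SL2C_act :: "complex^2^2 \<Rightarrow> complex \<times> real \<Rightarrow> complex \<times> real" where
  "SL2C_act A p = (let a = A$1$1; b = A$1$2; c = A$2$1; d = A$2$2; z = fst p; t = snd p;
       r = (cmod (c * z + d))\<^sup>2 + (cmod c)\<^sup>2 * t\<^sup>2
     in (((a * z + b) * cnj (c * z + d) + a * cnj c * of_real (t\<^sup>2)) / of_real r, t / r))"

text \<open>The action and the squared trace do not depend on the representative, so the images below
  are singletons; see the lemmas \<open>act_rcoset\<close> and \<open>tr_sq_rcoset\<close>.\<close>

definition act :: "(complex^2^2) set \<Rightarrow> complex \<times> real \<Rightarrow> complex \<times> real" where
  "act \<gamma> p = the_elem ((\<lambda>A. SL2C_act A p) ` \<gamma>)"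

definition tr_sq :: "(complex^2^2) set \<Rightarrow> complex" where
  "tr_sq \<gamma> = the_elem ((\<lambda>A. (trace A)\<^sup>2) ` \<gamma>)"

definition loxodromic :: "(complex^2^2) set \<Rightarrow> bool" where
  "loxodromic \<gamma> \<longleftrightarrow> \<gamma> \<in> carrier PSL2C \<and> tr_sq \<gamma> \<notin> complex_of_real ` {0..4}"

section \<open>The quotient manifold\<close>

text \<open>The quotient of \<open>H3\<close> by a Kleinian group is a manifold (and not merely an orbifold), with
  projection a covering map, when the action is free. It is then a complete hyperbolic 3-manifold.\<close>

definition acts_freely :: "(complex^2^2) set set \<Rightarrow> bool" where
  "acts_freely \<Gamma> \<longleftrightarrow> (\<forall>\<gamma>\<in>\<Gamma>. \<forall>p\<in>H3. act \<gamma> p = p \<longrightarrow> \<gamma> = \<one>\<^bsub>PSL2C\<^esub>)"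

text \<open>The volume of the quotient is the volume of any measurable set that contains exactly one
  point of every orbit; for discrete groups such sets exist and all have the same volume.\<close>

definition fundamental_set :: "(complex^2^2) set set \<Rightarrow> (complex \<times> real) set \<Rightarrow> bool" where
  "fundamental_set \<Gamma> F \<longleftrightarrow> F \<in> sets hvolume \<and> (\<forall>p\<in>H3. \<exists>!q. q \<in> F \<and> (\<exists>\<gamma>\<in>\<Gamma>. q = act \<gamma> p))"

definition finite_covolume :: "(complex^2^2) set set \<Rightarrow> bool" where
  "finite_covolume \<Gamma> \<longleftrightarrow> (\<exists>F. fundamental_set \<Gamma> F \<and> emeasure hvolume F < \<infinity>)"

section \<open>Closed geodesics and their lengths\<close>

definition geodesic_line :: "(complex \<times> real) set \<Rightarrow> bool" where
  "geodesic_line L \<longleftrightarrow> (\<exists>c::real \<Rightarrow> complex \<times> real.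
     (\<forall>s. c s \<in> H3) \<and> (\<forall>s t. hdist (c s) (c t) = \<bar>s - t\<bar>) \<and> L = range c)"

text \<open>A loxodromic element leaves exactly one geodesic line invariant and moves all points of this
  line by the same distance; \<open>axis\<close> and \<open>translation_length\<close> are only used for such elements.\<close>

definition axis :: "(complex^2^2) set \<Rightarrow> (complex \<times> real) set" where
  "axis \<gamma> = (THE L. geodesic_line L \<and> act \<gamma> ` L = L)"

definition translation_length :: "(complex^2^2) set \<Rightarrow> real" where
  "translation_length \<gamma> = (THE l. \<forall>p\<in>axis \<gamma>. hdist p (act \<gamma> p) = l)"

definition loxodromics :: "(complex^2^2) set set \<Rightarrow> (complex^2^2) set set" where
  "loxodromics \<Gamma> = {\<gamma>\<in>\<Gamma>. loxodromic \<gamma>}"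

text \<open>Conjugacy in \<open>\<Gamma>\<close>, up to inversion (which reverses the orientation of the geodesic).\<close>

definition geodesic_rel :: "(complex^2^2) set set \<Rightarrow> ((complex^2^2) set \<times> (complex^2^2) set) set" where
  "geodesic_rel \<Gamma> = {(\<gamma>, \<delta>). \<gamma> \<in> loxodromics \<Gamma> \<and> \<delta> \<in> loxodromics \<Gamma> \<and>
     (\<exists>h\<in>\<Gamma>. \<delta> = h \<otimes>\<^bsub>PSL2C\<^esub> \<gamma> \<otimes>\<^bsub>PSL2C\<^esub> inv\<^bsub>PSL2C\<^esub> h \<or>
             \<delta> = h \<otimes>\<^bsub>PSL2C\<^esub> inv\<^bsub>PSL2C\<^esub> \<gamma> \<otimes>\<^bsub>PSL2C\<^esub> inv\<^bsub>PSL2C\<^esub> h)}"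

definition closed_geodesics :: "(complex^2^2) set set \<Rightarrow> (complex^2^2) set set set" where
  "closed_geodesics \<Gamma> = loxodromics \<Gamma> // geodesic_rel \<Gamma>"

text \<open>Translation length is constant on the classes, being invariant under conjugation and
  inversion.\<close>

definition geodesic_length :: "(complex^2^2) set set \<Rightarrow> real" where
  "geodesic_length C = the_elem (translation_length ` C)"

section \<open>Well-definedness\<close>

lemma group_SL2C: "group SL2C"
proof (rule groupI)
  fix A assume "A \<in> carrier SL2C"
  then have d: "det A = 1" by (simp add: SL2C_def)
  then obtain B where B: "A ** B = mat 1" "B ** A = mat 1"
    by (metis invertible_def invertible_det_nz zero_neq_one)
  then have "det B = 1"
    by (metis d det_I det_mul mult_1)
  with B show "\<exists>B\<in>carrier SL2C. B \<otimes>\<^bsub>SL2C\<^esub> A = \<one>\<^bsub>SL2C\<^esub>"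
    by (auto simp: SL2C_def)
qed (auto simp: SL2C_def det_mul matrix_mul_assoc)

lemma matrix_mul_uminus:
  fixes A B :: "complex^2^2"
  shows "(- A) ** B = - (A ** B)" "A ** (- B) = - (A ** B)"
  by (simp_all add: matrix_matrix_mult_def vec_eq_iff sum_negf)

lemma det_uminus_2: "det (- A :: complex^2^2) = det A"
  by (simp add: det_2)

lemma normal_pm1: "{mat 1, - mat 1} \<lhd> SL2C"
proof -
  interpret group SL2C by (rule group_SL2C)
  have "subgroup {mat 1, - mat 1} SL2C"
    by (rule subgroupI)
      (auto simp: SL2C_def det_uminus_2 matrix_mul_uminus
        intro!: inv_equality[unfolded SL2C_def, simplified])
  then show ?thesis
    by (rule normalI) (auto simp: SL2C_def r_coset_def l_coset_def matrix_mul_uminus)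
qed

lemma group_PSL2C: "group PSL2C"
  unfolding PSL2C_def by (rule normal.factorgroup_is_group[OF normal_pm1])

lemma rcoset_pm1: "{mat 1, - mat 1} #>\<^bsub>SL2C\<^esub> A = {A, - A}"
  by (auto simp: SL2C_def r_coset_def matrix_mul_uminus)

lemma carrier_PSL2C: "carrier PSL2C = (\<lambda>A. {A, - A}) ` {A. det A = 1}"
  unfolding PSL2C_def carrier_FactGroup rcoset_pm1 by (simp add: SL2C_def)

lemma SL2C_act_uminus: "SL2C_act (- A) p = SL2C_act A p"
proof -
  have *: "- x * y + - z = - (x * y + z)" for x y z :: complex by simp
  show ?thesis
    by (simp only: SL2C_act_def Let_def vector_uminus_component * norm_minus_cancel
        complex_cnj_minus minus_mult_minus)
qed

lemma act_rcoset: "act {A, - A} p = SL2C_act A p"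
  by (simp add: act_def SL2C_act_uminus)

lemma tr_sq_rcoset: "tr_sq {A, - A} = (trace A)\<^sup>2"
proof -
  have "trace (- A) = - trace A" by (simp add: trace_def sum_negf)
  then show ?thesis by (simp add: tr_sq_def)
qed

lemma openin_PSL2C_topology:
  "openin PSL2C_topology U \<longleftrightarrow>
     U \<subseteq> carrier PSL2C \<and> openin (top_of_set (carrier SL2C)) (\<Union>U)"
proof -
  have *: "\<Union>(U \<inter> V) = \<Union>U \<inter> \<Union>V" if "U \<subseteq> carrier PSL2C" "V \<subseteq> carrier PSL2C" for U V
  proof
    show "\<Union>U \<inter> \<Union>V \<subseteq> \<Union>(U \<inter> V)"
    proof
      fix A assume "A \<in> \<Union>U \<inter> \<Union>V"
      then obtain X Y where XY: "X \<in> U" "Y \<in> V" "A \<in> X" "A \<in> Y" by blast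
      then have "X = {A, - A}" "Y = {A, - A}"
        using that by (auto simp: carrier_PSL2C)
      with XY show "A \<in> \<Union>(U \<inter> V)" by auto
    qed
  qed auto
  have "istopology (\<lambda>U. U \<subseteq> carrier PSL2C \<and> openin (top_of_set (carrier SL2C)) (\<Union>U))"
    unfolding istopology_def
  proof (intro conjI allI impI)
    fix \<K> assume K: "\<forall>K\<in>\<K>. K \<subseteq> carrier PSL2C \<and> openin (top_of_set (carrier SL2C)) (\<Union>K)"
    show "\<Union>\<K> \<subseteq> carrier PSL2C" using K by blast
    have "\<Union>(\<Union>\<K>) = \<Union>((\<lambda>K. \<Union>K) ` \<K>)" by blast
    also have "openin (top_of_set (carrier SL2C)) \<dots>" using K by (intro openin_Union) auto
    finally show "openin (top_of_set (carrier SL2C)) (\<Union>(\<Union>\<K>))" .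
  qed (auto simp: * openin_Int)
  then show ?thesis by (simp add: PSL2C_topology_def)
qed

end

theory Submission
  imports Defs
begin

text \<open>
  Let \<open>G\<close> be the group of matrices lying over \<open>\<Gamma>\<close>. The translation length of a loxodromic element is
  determined by its trace (\<open>translation_length_eq\<close>), and a closed geodesic accounts for at most two
  conjugacy classes of \<open>\<Gamma>\<close>, that of \<open>\<gamma>\<close> and that of \<open>\<gamma>\<inverse>\<close>. So it suffices to find arbitrarily many
  elements of \<open>G\<close> with the same large trace, no two of them conjugate in \<open>G\<close>
  (\<open>many_nonconjugate_equal_trace\<close>).

  After a conjugation in \<open>SL(2,C)\<close>, \<open>G\<close> contains a loxodromic diagonal matrix \<open>b = diag(l, 1/l)\<close>. The trace
  of \<open>b\<^sup>n u\<close> is \<open>x l\<^sup>n + w / l\<^sup>n\<close> if \<open>u\<close> has the diagonal entries \<open>x\<close> and \<open>w\<close>. Hence matrices of \<open>G\<close> with the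
  same diagonal give, for every \<open>n\<close>, words \<open>b\<^sup>n u\<close> of the same trace. If the off-diagonal entries do not
  vanish, two matrices with equal diagonal and determinant 1 differ by conjugation with a diagonal
  matrix \<open>D\<close>: the upper right entry is multiplied by some \<open>t\<close>, called a multiplier here, and the lower
  left entry is divided by \<open>t\<close>.

  Such words are seldom conjugate (\<open>long_words_not_conjugate\<close>). An element \<open>g\<close> of \<open>G\<close> that conjugates
  \<open>b\<^sup>n u\<close> to \<open>b\<^sup>n u' = D b\<^sup>n u D\<inverse>\<close> is \<open>D C\<close> with \<open>C\<close> in the centralizer of \<open>b\<^sup>n u\<close>. The powers of \<open>b\<^sup>n u\<close> and
  the inverse of \<open>g\<close> are at our disposal, so the eigenvalue of \<open>C\<close> can be assumed to be at least 1 and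
  at most the square root of that of \<open>b\<^sup>n u\<close> in absolute value. Then \<open>g\<close> is a power of \<open>b\<close> times a
  matrix that is bounded independently of \<open>n\<close> and whose lower left entry tends to 0 as \<open>n\<close> grows. By
  discreteness this entry vanishes for large \<open>n\<close>. In a discrete group that contains \<open>b\<close>, triangular matrices are diagonal, so \<open>C\<close>
  is scalar and \<open>g = \<plusminus>D\<close>. In other words, the two words are conjugate in \<open>G\<close> only if \<open>D\<close> is in \<open>G\<close>.

  Many multipliers come from reversing words (\<open>multiplier_family\<close>). The word
  \<open>u b\<^sup>m u b\<^sup>m b u\<close> and its reverse \<open>u b b\<^sup>m u b\<^sup>m u\<close> have the same diagonal, because a diagonal conjugation
  makes \<open>u\<close> symmetric and then transposition reverses words in \<open>u\<close> and \<open>b\<close>. Their multiplier is not 1 but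
  tends to 1 as \<open>m\<close> grows. Replacing \<open>u\<close> by such a word keeps all multipliers found before, so
  every step doubles their number, and all of them can be kept as close to 1 as desired. Discreteness
  prevents two distinct numbers close to 1 from differing by a factor \<open>d\<^sup>2\<close> with \<open>diag(d, 1/d)\<close> in \<open>G\<close>.

  Finite volume provides \<open>b\<close> and a first matrix \<open>u\<close> with nonzero upper left and off-diagonal
  entries (\<open>loxodromic_and_generic_element\<close>). If there were no such pair, then after a conjugation \<open>G\<close> would,
  up to signs, consist of translations or of diagonal matrices. In both cases the region over a small disc of the
  boundary plane, of infinite volume towards the boundary, embeds into the quotient
  (\<open>elementary_infinite_covolume\<close>). This uses that \<open>SL(2,C)\<close> preserves the volume (\<open>volume_act\<close>).
\<close>

section \<open>Complex matrices of size two\<close>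

definition mat2 :: "complex \<Rightarrow> complex \<Rightarrow> complex \<Rightarrow> complex \<Rightarrow> complex^2^2" where
  "mat2 a b c d = vector [vector [a, b], vector [c, d]]"

lemma mat2_entries [simp]:
  "mat2 a b c d $ 1 $ 1 = a" "mat2 a b c d $ 1 $ 2 = b"
  "mat2 a b c d $ 2 $ 1 = c" "mat2 a b c d $ 2 $ 2 = d"
  by (simp_all add: mat2_def)

lemma mat2_eta: "A = mat2 (A$1$1) (A$1$2) (A$2$1) (A$2$2)"
  by (simp add: vec_eq_iff forall_2)

lemma mat2_cases: obtains a b c d where "A = mat2 a b c d"
  using mat2_eta by blast

lemma mat2_eq_iff [simp]: "mat2 a b c d = mat2 a' b' c' d' \<longleftrightarrow> a = a' \<and> b = b' \<and> c = c' \<and> d = d'"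
  by (auto simp: vec_eq_iff forall_2)

lemma mat2_mult [simp]:
  "mat2 a b c d ** mat2 a' b' c' d' = mat2 (a*a' + b*c') (a*b' + b*d') (c*a' + d*c') (c*b' + d*d')"
  by (simp add: vec_eq_iff forall_2 matrix_matrix_mult_def sum_2)

lemma mat2_one: "mat 1 = mat2 1 0 0 1"
  by (simp add: vec_eq_iff forall_2 mat_def)

lemma mat2_uminus [simp]: "- mat2 a b c d = mat2 (-a) (-b) (-c) (-d)"
  by (simp add: vec_eq_iff forall_2)

lemma det_mat2 [simp]: "det (mat2 a b c d) = a*d - b*c"
  by (simp add: det_2)

lemma trace_mat2 [simp]: "trace (mat2 a b c d) = a + d"
  by (simp add: trace_def sum_2)

text \<open>The adjugate matrix. It serves as the inverse, and it is linear and defined for all matrices.\<close>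
definition adj2 :: "complex^2^2 \<Rightarrow> complex^2^2" where
  "adj2 A = mat2 (A$2$2) (- A$1$2) (- A$2$1) (A$1$1)"

lemma adj2_mat2 [simp]: "adj2 (mat2 a b c d) = mat2 d (-b) (-c) a"
  by (simp add: adj2_def)

lemma adj2_inverse: "det A = 1 \<Longrightarrow> A ** adj2 A = mat 1" "det A = 1 \<Longrightarrow> adj2 A ** A = mat 1"
  by (cases A rule: mat2_cases; simp add: mat2_one algebra_simps)+

lemma det_adj2 [simp]: "det (adj2 A) = det A"
  by (cases A rule: mat2_cases) (simp add: algebra_simps)

lemma trace_adj2 [simp]: "trace (adj2 A) = trace A"
  by (cases A rule: mat2_cases) (simp add: algebra_simps)

lemma adj2_adj2 [simp]: "adj2 (adj2 A) = A"
  by (cases A rule: mat2_cases) simp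

lemma adj2_mult: "adj2 (A ** B) = adj2 B ** adj2 A"
  by (cases A rule: mat2_cases; cases B rule: mat2_cases) (simp add: algebra_simps)

lemma trace_mult_commute: "trace (A ** B) = trace (B ** (A::complex^2^2))"
  by (cases A rule: mat2_cases; cases B rule: mat2_cases) (simp add: algebra_simps)

lemma trace_conj:
  assumes "det P = (1::complex)" shows "trace (P ** A ** adj2 P) = trace A"
proof -
  have "trace (P ** A ** adj2 P) = trace (adj2 P ** (P ** A))"
    by (rule trace_mult_commute)
  also have "\<dots> = trace A" using assms by (simp add: matrix_mul_assoc adj2_inverse)
  finally show ?thesis .
qed

section \<open>The action on hyperbolic space\<close>

definition ctrans :: "complex^2^2 \<Rightarrow> complex^2^2" where
  "ctrans A = mat2 (cnj (A$1$1)) (cnj (A$2$1)) (cnj (A$1$2)) (cnj (A$2$2))"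

lemma ctrans_mat2 [simp]: "ctrans (mat2 a b c d) = mat2 (cnj a) (cnj c) (cnj b) (cnj d)"
  by (simp add: ctrans_def)

lemma ctrans_mult: "ctrans (A ** B) = ctrans B ** ctrans A"
  by (cases A rule: mat2_cases; cases B rule: mat2_cases) (simp add: algebra_simps)

lemma det_ctrans: "det (ctrans A) = cnj (det A)"
  by (cases A rule: mat2_cases) (simp add: algebra_simps)

text \<open>A point of the upper half-space is a positive definite Hermitian matrix of determinant 1, on which
  \<open>SL(2,C)\<close> acts by \<open>X \<mapsto> A X A\<^sup>*\<close>. In this form the action laws are associativity and the distance is
  given by the invariant bilinear form that polarizes the determinant.\<close>
definition herm :: "complex \<times> real \<Rightarrow> complex^2^2" where
  "herm p = mat2 (of_real (((cmod (fst p))\<^sup>2 + (snd p)\<^sup>2) / snd p)) (fst p / of_real (snd p))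
     (cnj (fst p) / of_real (snd p)) (of_real (1 / snd p))"

lemma herm_inj:
  assumes "p \<in> H3" "q \<in> H3" "herm p = herm q" shows "p = q"
  using assms by (cases p; cases q) (auto simp: herm_def H3_def)

lemma act_denominator_pos:
  assumes "a * d - b * c = (1::complex)" "t > 0"
  shows "(cmod (c * z + d))\<^sup>2 + (cmod c)\<^sup>2 * t\<^sup>2 > 0"
proof (cases "c = 0")
  case True
  then show ?thesis using assms by auto
next
  case False
  then show ?thesis using assms by (intro add_nonneg_pos) auto
qed

lemma SL2C_act_mat2:
  "SL2C_act (mat2 a b c d) (z, t) = (let r = (cmod (c * z + d))\<^sup>2 + (cmod c)\<^sup>2 * t\<^sup>2
     in (((a * z + b) * cnj (c * z + d) + a * cnj c * of_real (t\<^sup>2)) / of_real r, t / r))"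
  by (simp add: SL2C_act_def Let_def)

lemma SL2C_act_H3:
  assumes "det A = 1" "p \<in> H3" shows "SL2C_act A p \<in> H3"
proof -
  obtain a b c d where A: "A = mat2 a b c d" by (rule mat2_cases)
  obtain z t where p: "p = (z,t)" by (cases p)
  show ?thesis using assms act_denominator_pos[of a d b c t z]
    by (simp add: A p SL2C_act_mat2 Let_def H3_def)
qed

text \<open>Up to the common factor \<open>1 / t\<close>, the lower right entry of \<open>A X A\<^sup>*\<close> is the denominator in the formula
  for the Poincare extension and the upper right entry is the numerator; the upper left one then follows, since determinants are preserved.\<close>
lemma herm_act:
  assumes "det A = 1" "p \<in> H3"
  shows "herm (SL2C_act A p) = A ** herm p ** ctrans A"
proof -
  obtain a b c d where A: "A = mat2 a b c d" by (rule mat2_cases)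
  obtain z t where p: "p = (z,t)" by (cases p)
  have t: "t > 0" using assms p by (simp add: H3_def)
  have dt: "a * d - b * c = 1" using assms A by simp
  define r where "r = (cmod (c * z + d))\<^sup>2 + (cmod c)\<^sup>2 * t\<^sup>2"
  have r: "r > 0" unfolding r_def using act_denominator_pos[OF dt t] .
  define T where "T = complex_of_real t"
  have T0: "T \<noteq> 0" using t by (simp add: T_def)
  have cT: "cnj T = T" by (simp add: T_def)
  define R where "R = complex_of_real r"
  have R: "R = (c * z + d) * cnj (c * z + d) + c * cnj c * T\<^sup>2"
    unfolding R_def r_def T_def of_real_add of_real_mult complex_norm_square by simp
  have R0: "R \<noteq> 0" using r by (simp add: R_def)
  have cR: "cnj R = R" by (simp add: R_def)
  define N where "N = (a * z + b) * cnj (c * z + d) + a * cnj c * T\<^sup>2"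
  define M where "M = (a * z + b) * cnj (a * z + b) + a * cnj a * T\<^sup>2"
  have act: "SL2C_act A p = (N / R, t / r)"
    by (simp add: A p SL2C_act_mat2 Let_def r_def N_def R_def T_def)
  have detc: "cnj a * cnj d - cnj b * cnj c = 1"
    using arg_cong[OF dt, of cnj] by simp
  have NM: "N * cnj N + T\<^sup>2 = M * R"
  proof -
    have "N * cnj N + T\<^sup>2 * ((a*d - b*c) * (cnj a * cnj d - cnj b * cnj c)) = M * R"
      unfolding N_def M_def R by (simp add: cT) algebra
    then show ?thesis unfolding dt detc by simp
  qed
  have 1: "of_real (((cmod (N/R))\<^sup>2 + (t/r)\<^sup>2) / (t/r)) = M / T"
  proof -
    have "complex_of_real (((cmod (N/R))\<^sup>2 + (t/r)\<^sup>2) / (t/r)) = ((N/R) * cnj (N/R) + (T/R)\<^sup>2) / (T/R)"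
      unfolding of_real_divide of_real_add complex_norm_square by (simp add: T_def R_def)
    also have "\<dots> = (N * cnj N + T\<^sup>2) / (R * T)"
      using R0 T0 by (simp add: cR field_simps power2_eq_square)
    also have "\<dots> = M / T" using R0 by (simp add: NM)
    finally show ?thesis .
  qed
  have "herm (SL2C_act A p) = mat2 (M / T) (N / T) (cnj N / T) (R / T)"
    unfolding act herm_def using R0 T0 t r 1
    by (simp add: cR T_def[symmetric] R_def[symmetric])
  also have "\<dots> = A ** mat2 ((z * cnj z + T\<^sup>2) / T) (z / T) (cnj z / T) (1 / T) ** ctrans A"
    using T0 by (simp add: A M_def N_def R cT field_simps power2_eq_square)
  also have "mat2 ((z * cnj z + T\<^sup>2) / T) (z / T) (cnj z / T) (1 / T) = herm p"
    unfolding herm_def p fst_conv snd_conv of_real_divide of_real_add complex_norm_square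
    by (simp add: T_def)
  finally show ?thesis .
qed

lemma SL2C_act_mult:
  assumes "det A = 1" "det B = 1" "p \<in> H3"
  shows "SL2C_act (A ** B) p = SL2C_act A (SL2C_act B p)"
proof (rule herm_inj)
  show "herm (SL2C_act (A ** B) p) = herm (SL2C_act A (SL2C_act B p))"
    using assms by (simp add: herm_act SL2C_act_H3 det_mul ctrans_mult matrix_mul_assoc)
qed (use assms in \<open>simp_all add: SL2C_act_H3 det_mul\<close>)

lemma SL2C_act_one: "SL2C_act (mat 1) p = p"
  by (cases p) (simp add: mat2_one SL2C_act_mat2)

lemma SL2C_act_adj2:
  assumes "det A = 1" "p \<in> H3"
  shows "SL2C_act A (SL2C_act (adj2 A) p) = p" "SL2C_act (adj2 A) (SL2C_act A p) = p"
  using assms by (simp_all flip: SL2C_act_mult add: adj2_inverse SL2C_act_one)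

text \<open>The trace of \<open>X adj(Y)\<close> is the polarization of the determinant.\<close>
lemma hdist_herm:
  assumes "p \<in> H3" "q \<in> H3"
  shows "hdist p q = arcosh (Re (trace (herm p ** adj2 (herm q))) / 2)"
proof -
  obtain z t where p: "p = (z,t)" by (cases p)
  obtain w s where q: "q = (w,s)" by (cases q)
  have ts: "t > 0" "s > 0" using assms by (auto simp: p q H3_def)
  have "Re (trace (herm p ** adj2 (herm q))) / 2
     = 1 + ((cmod (z - w))\<^sup>2 + (t - s)\<^sup>2) / (2 * t * s)"
  proof -
    have "Re (trace (herm p ** adj2 (herm q))) = ((cmod z)\<^sup>2 + t\<^sup>2) / (t * s) + ((cmod w)\<^sup>2 + s\<^sup>2) / (t * s)
       - 2 * (Re z * Re w + Im z * Im w) / (t * s)"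
      using ts unfolding p q by (simp add: herm_def field_simps)
    also have "\<dots> / 2 = 1 + ((cmod (z - w))\<^sup>2 + (t - s)\<^sup>2) / (2 * t * s)"
      using ts unfolding cmod_power2 by (simp add: field_simps power2_eq_square)
    finally show ?thesis .
  qed
  then show ?thesis by (simp only: hdist_def p q fst_conv snd_conv)
qed

lemma hdist_act:
  assumes "det A = 1" "p \<in> H3" "q \<in> H3"
  shows "hdist (SL2C_act A p) (SL2C_act A q) = hdist p q"
proof -
  have d: "det (ctrans A) = 1" using assms by (simp add: det_ctrans)
  let ?P = "herm p" and ?Q = "herm q"
  have "trace (A ** ?P ** ctrans A ** adj2 (A ** ?Q ** ctrans A))
     = trace (A ** ?P ** (ctrans A ** adj2 (ctrans A)) ** adj2 ?Q ** adj2 A)"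
    by (simp add: adj2_mult matrix_mul_assoc)
  also have "\<dots> = trace (?P ** adj2 ?Q)"
    using trace_conj[OF assms(1), of "?P ** adj2 ?Q"] d
    by (simp add: adj2_inverse matrix_mul_assoc)
  finally show ?thesis
    using assms by (simp add: hdist_herm SL2C_act_H3 herm_act)
qed


section \<open>Cosets and matrices\<close>

abbreviation pm :: "complex^2^2 \<Rightarrow> (complex^2^2) set" where
  "pm A \<equiv> {A, - A}"

lemma pm_in_PSL2C: "det A = 1 \<Longrightarrow> pm A \<in> carrier PSL2C"
  by (auto simp: carrier_PSL2C)

lemma pm_mult: "pm A \<otimes>\<^bsub>PSL2C\<^esub> pm B = pm (A ** B)"
  by (auto simp: PSL2C_def FactGroup_def set_mult_def SL2C_def matrix_mul_uminus)

lemma one_PSL2C: "\<one>\<^bsub>PSL2C\<^esub> = pm (mat 1)"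
  by (simp add: PSL2C_def FactGroup_def)

lemma inv_pm:
  assumes "det A = 1" shows "inv\<^bsub>PSL2C\<^esub> (pm A) = pm (adj2 A)"
  using assms by (intro group.inv_equality[OF group_PSL2C])
    (simp_all only: pm_in_PSL2C pm_mult one_PSL2C adj2_inverse det_adj2)

lemma pm_eq_iff: "pm A = pm B \<longleftrightarrow> A = B \<or> A = - B"
  by (auto simp: doubleton_eq_iff)

section \<open>Conjugation to triangular form\<close>

lemma conj_eq_iff:
  assumes "det P = 1"
  shows "adj2 P ** A ** P = B \<longleftrightarrow> A = P ** B ** adj2 P"
proof
  assume "adj2 P ** A ** P = B"
  then have "P ** B ** adj2 P = (P ** adj2 P) ** A ** (P ** adj2 P)"
    by (auto simp: matrix_mul_assoc)
  then show "A = P ** B ** adj2 P" using assms by (simp add: adj2_inverse)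
next
  assume "A = P ** B ** adj2 P"
  then have "adj2 P ** A ** P = (adj2 P ** P) ** B ** (adj2 P ** P)"
    by (auto simp: matrix_mul_assoc)
  then show "adj2 P ** A ** P = B" using assms by (simp add: adj2_inverse)
qed

text \<open>An eigenvector is completed to a basis of determinant 1; the trace determines the remaining diagonal entry.\<close>
lemma triangularize:
  assumes "det A = 1" "trace A = l + 1 / l" "l \<noteq> 0"
  obtains P e where "det P = 1" "A = P ** mat2 l e 0 (1/l) ** adj2 P"
proof -
  obtain a b c d where A: "A = mat2 a b c d" by (rule mat2_cases)
  have dt: "a*d - b*c = 1" and tr: "a + d = l + 1/l" using assms by (auto simp: A)
  have char: "l * l = (a + d) * l - 1" using tr assms(3) by (simp add: field_simps)
  have "\<exists>v w. (v \<noteq> 0 \<or> w \<noteq> 0) \<and> a * v + b*w = l * v \<and> c * v + d*w = l*w"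
  proof (cases "b = 0")
    case False
    have "c*b + d*(l-a) = l*(l-a)" using char dt by algebra
    with False show ?thesis by (intro exI[of _ b] exI[of _ "l-a"]) (simp add: algebra_simps)
  next
    case b: True
    show ?thesis
    proof (cases "c = 0")
      case False
      have "a*(l-d) + b*c = l*(l-d)" using char dt by algebra
      with False show ?thesis by (intro exI[of _ "l-d"] exI[of _ c]) (simp add: algebra_simps)
    next
      case True
      have "(l-a)*(l-d) = 0" using char dt b by algebra
      then have "l = a \<or> l = d" by simp
      with True b show ?thesis
        by (elim disjE; intro exI[of _ "if l = a then 1 else 0"] exI[of _ "if l = a then 0 else 1"]) auto
    qed
  qed
  then obtain v w where vw: "v \<noteq> 0 \<or> w \<noteq> 0" "a * v + b*w = l * v" "c * v + d*w = l*w" by blast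
  obtain p s where ps: "v * s - p * w = 1"
  proof (cases "v = 0")
    case True
    then show ?thesis using that[of 0 "-1/w"] vw(1) by simp
  next
    case False
    then show ?thesis using that[of "1/v" 0] by simp
  qed
  define P where "P = mat2 v p w s"
  define B where "B = adj2 P ** A ** P"
  have dP: "det P = 1" using ps by (simp add: P_def)
  have AB: "A = P ** B ** adj2 P" using conj_eq_iff[OF dP] B_def by blast
  have "s * (a * v+b*w) - p * (c * v+d*w) = l" "- w * (a * v+b*w) + v * (c * v+d*w) = 0"
    unfolding vw using ps by algebra (simp add: algebra_simps)
  then have B1: "B$1$1 = l" "B$2$1 = 0"
    by (simp_all add: B_def P_def A algebra_simps)
  have "trace B = trace A" unfolding AB using trace_conj[OF dP] by simp
  then have "B$2$2 = 1/l" using B1 assms(2) by (simp add: trace_def sum_2)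
  with B1 have "B = mat2 l (B$1$2) 0 (1/l)" using mat2_eta[of B] by simp
  with AB dP that show ?thesis by metis
qed

lemma diagonalize:
  assumes "det A = 1" "trace A = l + 1 / l" "l \<noteq> 0" "l * l \<noteq> 1"
  obtains P where "det P = 1" "A = P ** mat2 l 0 0 (1/l) ** adj2 P"
proof -
  obtain P e where P: "det P = 1" "A = P ** mat2 l e 0 (1/l) ** adj2 P"
    using triangularize assms(1-3) by blast
  define s where "s = e / (1/l - l)"
  have nz: "1/l - l \<noteq> 0" using assms(3,4) by (auto simp: field_simps)
  have "s / l - s * l = s * (1/l - l)" by (simp add: algebra_simps)
  also have "\<dots> = e" unfolding s_def using nz by simp
  finally have "s / l - s * l = e" .
  then have "mat2 l e 0 (1/l) = mat2 1 s 0 1 ** mat2 l 0 0 (1/l) ** adj2 (mat2 1 s 0 1)"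
    by (simp add: algebra_simps)
  then have "A = (P ** mat2 1 s 0 1) ** mat2 l 0 0 (1/l) ** adj2 (P ** mat2 1 s 0 1)"
    unfolding P(2) by (simp only: adj2_mult matrix_mul_assoc)
  then show ?thesis using that[of "P ** mat2 1 s 0 1"] P(1) by (simp add: det_mul)
qed

lemma trace_eigenvalue:
  obtains l where "t = l + 1/l" "l \<noteq> (0::complex)" "cmod l \<ge> 1"
proof -
  define s where "s = csqrt (t\<^sup>2 - 4)"
  define l where "l = (t + s) / 2"
  have "s\<^sup>2 = t\<^sup>2 - 4" by (simp add: s_def)
  then have lm: "l * ((t - s)/2) = 1" by (simp add: l_def power2_eq_square algebra_simps)
  then have l0: "l \<noteq> 0" by auto
  have "1 / l = (t - s)/2" using lm l0 by (simp add: field_simps)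
  then have t: "t = l + 1/l" unfolding l_def by (simp add: field_simps)
  show ?thesis
  proof (cases "cmod l \<ge> 1")
    case True then show ?thesis using that t l0 by blast
  next
    case False
    then have "cmod (1/l) \<ge> 1" using l0 by (simp add: norm_divide divide_simps)
    then show ?thesis using that[of "1/l"] t l0 by (simp add: add.commute)
  qed
qed

text \<open>If \<open>\<bar>l\<bar> = 1\<close>, then \<open>1/l\<close> is the conjugate of \<open>l\<close> and the trace is \<open>2 Re l\<close>.\<close>
lemma unimodular_eigenvalue_trace:
  assumes "cmod l = 1"
  shows "(l + 1/l)\<^sup>2 \<in> complex_of_real ` {0..4}"
proof -
  have "1/l = cnj l" using assms by (simp add: divide_conv_cnj)
  then have "l + 1/l = complex_of_real (2 * Re l)" by (simp add: complex_eq_iff)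
  moreover have "(2 * Re l)\<^sup>2 \<le> 4"
    using assms abs_Re_le_cmod[of l] by (simp add: power_mult_distrib abs_square_le_1)
  ultimately show ?thesis by (intro image_eqI[of _ _ "(2 * Re l)\<^sup>2"]) auto
qed

lemma loxodromic_eigenvalue:
  assumes "loxodromic (pm A)"
  obtains l where "cmod l > 1" "trace A = l + 1/l"
proof -
  have "(trace A)\<^sup>2 \<notin> complex_of_real ` {0..4}"
    using assms unfolding loxodromic_def tr_sq_rcoset by simp
  moreover obtain l where l: "trace A = l + 1/l" "l \<noteq> 0" "cmod l \<ge> 1" by (rule trace_eigenvalue)
  ultimately have "cmod l \<noteq> 1" using unimodular_eigenvalue_trace[of l] by auto
  then show ?thesis using that l by force
qed

section \<open>Axes and translation lengths\<close>

definition vertical_line :: "(complex \<times> real) set" where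
  "vertical_line = {p \<in> H3. fst p = 0}"

lemma cosh_hdist:
  assumes "p \<in> H3" "q \<in> H3"
  shows "cosh (hdist p q) = 1 + ((cmod (fst p - fst q))\<^sup>2 + (snd p - snd q)\<^sup>2) / (2 * snd p * snd q)"
  using assms unfolding hdist_def by (intro cosh_arcosh_real) (auto simp: H3_def)

lemma hdist_vertical:
  assumes "t > 0" "s > 0"
  shows "hdist (0, t) (0, s) = \<bar>ln t - ln s\<bar>"
proof -
  have "1 + (t - s)\<^sup>2 / (2 * t * s) = cosh (ln (t / s))"
    using assms by (subst cosh_ln_real) (auto simp: field_simps power2_eq_square)
  also have "\<dots> = cosh \<bar>ln t - ln s\<bar>" using assms by (simp add: ln_div)
  finally have e: "1 + (t - s)\<^sup>2 / (2 * t * s) = cosh \<bar>ln t - ln s\<bar>" .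
  have "hdist (0, t) (0, s) = arcosh (1 + (t - s)\<^sup>2 / (2 * t * s))" by (simp add: hdist_def)
  also have "\<dots> = \<bar>ln t - ln s\<bar>" unfolding e by (rule arcosh_cosh_real) simp
  finally show ?thesis .
qed

lemma act_upper:
  assumes "a \<noteq> 0"
  shows "SL2C_act (mat2 a b 0 (1/a)) (z, t) = (a\<^sup>2 * z + a * b, (cmod a)\<^sup>2 * t)"
proof -
  have "(a * z + b) * cnj (1/a) / complex_of_real ((cmod (1/a))\<^sup>2) = a\<^sup>2 * z + a * b"
    unfolding complex_norm_square using assms by (simp add: field_simps power2_eq_square)
  then show ?thesis using assms by (simp add: SL2C_act_mat2 norm_divide power_divide)
qed

lemma act_diag:
  assumes "l \<noteq> 0"
  shows "SL2C_act (mat2 l 0 0 (1/l)) (z, t) = (l\<^sup>2 * z, (cmod l)\<^sup>2 * t)"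
  using act_upper[OF assms, of 0] by simp

lemma geodesic_line_vertical: "geodesic_line vertical_line"
proof -
  have "vertical_line = range (\<lambda>s. (0, exp s))"
    by (auto simp: vertical_line_def H3_def image_iff) (metis exp_ln)
  then show ?thesis unfolding geodesic_line_def
    by (intro exI[of _ "\<lambda>s. (0, exp s)"]) (auto simp: H3_def hdist_vertical)
qed

lemma geodesic_line_in_H3: "geodesic_line L \<Longrightarrow> L \<subseteq> H3"
  by (auto simp: geodesic_line_def)

lemma geodesic_line_act:
  assumes "det A = 1" "geodesic_line L"
  shows "geodesic_line (SL2C_act A ` L)"
proof -
  obtain c :: "real \<Rightarrow> complex \<times> real"
    where c: "\<And>s. c s \<in> H3" "\<And>s t. hdist (c s) (c t) = \<bar>s - t\<bar>" "L = range c"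
    using assms unfolding geodesic_line_def by blast
  show ?thesis unfolding geodesic_line_def
    by (intro exI[of _ "SL2C_act A \<circ> c"])
      (use assms c in \<open>auto simp: hdist_act SL2C_act_H3 image_comp\<close>)
qed

text \<open>In logarithmic height, the parametrization of the line is an isometric map of the reals into
  themselves, and such a map is onto.\<close>
lemma geodesic_line_subset_vertical:
  assumes "geodesic_line L" "L \<subseteq> vertical_line"
  shows "L = vertical_line"
proof -
  obtain c :: "real \<Rightarrow> complex \<times> real"
    where c: "\<And>s. c s \<in> H3" "\<And>s t. hdist (c s) (c t) = \<bar>s - t\<bar>" "L = range c"
    using assms unfolding geodesic_line_def by blast
  have v: "c s = (0, snd (c s))" "snd (c s) > 0" for s
    using assms(2) c(1)[of s] c(3) by (auto simp: vertical_line_def H3_def prod_eq_iff)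
  define f where "f s = ln (snd (c s))" for s
  have f: "\<bar>f s - f t\<bar> = \<bar>s - t\<bar>" for s t
    using c(2)[of s t] v(1)[of s] v(1)[of t] hdist_vertical[OF v(2)[of s] v(2)[of t]] by (simp add: f_def)
  have "\<exists>s. c s = (0, t)" if "t > 0" for t
  proof -
    define d where "d = ln t - f 0"
    have "f d - f 0 = d \<or> f (-d) - f 0 = d" using f[of d 0] f[of "-d" 0] f[of d "-d"] by arith
    then obtain s where "f s = ln t" unfolding d_def by (metis diff_add_cancel)
    then have "snd (c s) = t" using v(2)[of s] that by (simp add: f_def)
    then show ?thesis using v(1)[of s] by auto
  qed
  have "p \<in> L" if "p \<in> vertical_line" for p
  proof -
    from that have "p = (0, snd p)" "snd p > 0" by (auto simp: vertical_line_def H3_def prod_eq_iff)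
    with \<open>\<And>t. t > 0 \<Longrightarrow> \<exists>s. c s = (0, t)\<close> obtain s where "c s = p" by metis
    then show ?thesis using c(3) by auto
  qed
  then have "vertical_line \<subseteq> L" by blast
  then show ?thesis using assms by blast
qed

text \<open>Let \<open>p\<close> be a point of an invariant line. The images \<open>q\<close> and \<open>r\<close> of \<open>p\<close> under one and two applications
  of the map are on the line, with \<open>d(q, r) = d(p, q)\<close> and \<open>r \<noteq> p\<close>, so \<open>d(p, r) = 2 d(p, q)\<close>. Written out by
  the double-angle formula for \<open>cosh\<close>, this forces \<open>p\<close> to lie above 0.\<close>
lemma invariant_line_diag:
  assumes l: "cmod l > 1" and L: "geodesic_line L"
    and inv: "SL2C_act (mat2 l 0 0 (1/l)) ` L = L"
  shows "L = vertical_line"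
proof (rule geodesic_line_subset_vertical[OF L], rule subsetI)
  let ?D = "mat2 l 0 0 (1/l)"
  fix p assume p: "p \<in> L"
  obtain z t where pz: "p = (z, t)" by (cases p)
  have pH: "p \<in> H3" using p geodesic_line_in_H3[OF L] by auto
  then have t: "t > 0" by (auto simp: pz H3_def)
  have l0: "l \<noteq> 0" using l by auto
  have dD: "det ?D = 1" using l0 by simp
  define q where "q = SL2C_act ?D p"
  define r where "r = SL2C_act ?D q"
  define m where "m = l\<^sup>2"
  define k where "k = cmod m"
  have k: "k > 1" unfolding k_def m_def using l by (simp add: norm_power one_less_power)
  have q: "q = (m * z, k * t)" using act_diag[OF l0] by (simp add: q_def pz m_def k_def norm_power)
  have r: "r = (m\<^sup>2 * z, k\<^sup>2 * t)" using act_diag[OF l0]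
    by (simp add: r_def q m_def k_def norm_power norm_mult power2_eq_square algebra_simps)
  have qr: "q \<in> L" "r \<in> L" using p inv by (auto simp: q_def r_def)
  then have qrH: "q \<in> H3" "r \<in> H3" using geodesic_line_in_H3[OF L] by auto
  obtain c :: "real \<Rightarrow> complex \<times> real"
    where c: "\<And>s t. hdist (c s) (c t) = \<bar>s - t\<bar>" "L = range c"
    using L unfolding geodesic_line_def by blast
  obtain s0 s1 s2 where s: "p = c s0" "q = c s1" "r = c s2" using p qr c(2) by blast
  have "hdist q r = hdist p q" unfolding r_def using hdist_act[OF dD pH qrH(1)] q_def by simp
  then have e: "\<bar>s1 - s2\<bar> = \<bar>s0 - s1\<bar>" using s c by simp
  have "s0 \<noteq> s2"
  proof
    assume "s0 = s2"
    then have "r = p" using s by simp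
    then have "k\<^sup>2 * t = t" using r pz by auto
    then show False using t k by (auto simp: power2_eq_1_iff)
  qed
  then have "\<bar>s0 - s2\<bar> = 2 * \<bar>s0 - s1\<bar>" using e by (auto simp: abs_if split: if_splits)
  then have "hdist p r = 2 * hdist p q" using s c by simp
  then have C: "cosh (hdist p r) = 2 * (cosh (hdist p q))\<^sup>2 - 1" by (simp add: cosh_double_cosh)
  define S where "S = (cmod z)\<^sup>2 / t\<^sup>2"
  define M where "M = (cmod (m - 1))\<^sup>2"
  \<comment> \<open>The parallelogram law\<close>
  have par: "(cmod (m + 1))\<^sup>2 = 2 * k\<^sup>2 + 2 - M"
    unfolding M_def k_def cmod_power2 by (simp add: power2_eq_square algebra_simps)
  have m1: "M > 0" using k unfolding M_def k_def by auto
  have zm: "(cmod (z - m * z))\<^sup>2 = (cmod z)\<^sup>2 * M"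
  proof -
    have "z - m * z = - (z * (m - 1))" by (simp add: algebra_simps)
    then show ?thesis unfolding M_def by (simp only: norm_mult norm_minus_cancel power_mult_distrib)
  qed
  have "z - m\<^sup>2 * z = z * (m - 1) * (- (m + 1))" by (simp add: power2_eq_square algebra_simps)
  then have zm2: "(cmod (z - m\<^sup>2 * z))\<^sup>2 = (cmod z)\<^sup>2 * M * (2 * k\<^sup>2 + 2 - M)"
    using par unfolding M_def by (simp only: norm_mult norm_minus_cancel power_mult_distrib)
  have 1: "cosh (hdist p q) = 1 + (S * M + (k - 1)\<^sup>2) / (2 * k)"
    using t k unfolding cosh_hdist[OF pH qrH(1)] unfolding pz q S_def fst_conv snd_conv zm
    by (simp add: field_simps power2_eq_square)
  have 2: "cosh (hdist p r) = 1 + (S * M * (2 * k\<^sup>2 + 2 - M) + (k\<^sup>2 - 1)\<^sup>2) / (2 * k\<^sup>2)"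
    using t k unfolding cosh_hdist[OF pH qrH(2)] unfolding pz r S_def fst_conv snd_conv zm2
    by (simp add: field_simps power2_eq_square)
  have "S * M * M * (1 + S) = 0"
  proof -
    have "2 * k\<^sup>2 * cosh (hdist p r) = 2 * k\<^sup>2 + S * M * (2 * k\<^sup>2 + 2 - M) + (k\<^sup>2 - 1)\<^sup>2"
      unfolding 2 using k by (simp add: field_simps)
    moreover have "2 * k * cosh (hdist p q) = 2 * k + S * M + (k - 1)\<^sup>2"
      unfolding 1 using k by (simp add: field_simps)
    then have "(2 * k * cosh (hdist p q))\<^sup>2 = (2 * k + S * M + (k - 1)\<^sup>2)\<^sup>2" by simp
    ultimately show ?thesis using C by algebra
  qed
  moreover have "S \<ge> 0" by (simp add: S_def)
  ultimately have "S = 0" using m1 by auto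
  then have "z = 0" using t by (simp add: S_def)
  then show "p \<in> vertical_line" using pH by (simp add: vertical_line_def pz)
qed

text \<open>Diagonalization carries the axis to the vertical line, whose points are moved from height \<open>t\<close> to
  height \<open>\<bar>l\<bar>\<^sup>2 t\<close>.\<close>
lemma translation_length_eq:
  assumes A: "det A = 1" "trace A = l + 1/l" and l: "cmod l > 1"
  shows "translation_length (pm A) = 2 * ln (cmod l)"
proof -
  have l0: "l \<noteq> 0" using l by auto
  have "cmod (l * l) \<noteq> 1" using l by (simp add: norm_mult less_1_mult order_less_imp_not_eq2)
  then have "l * l \<noteq> 1" by auto
  then obtain P where P: "det P = 1" "A = P ** mat2 l 0 0 (1/l) ** adj2 P"
    using diagonalize A l0 by blast
  let ?D = "mat2 l 0 0 (1/l)"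
  have dD: "det ?D = 1" using l0 by simp
  have actA: "SL2C_act A (SL2C_act P p) = SL2C_act P (SL2C_act ?D p)" if "p \<in> H3" for p
    using that P dD by (simp add: SL2C_act_mult SL2C_act_H3 SL2C_act_adj2 det_mul del: det_mat2)
  have vH: "vertical_line \<subseteq> H3" by (auto simp: vertical_line_def)
  have vD: "SL2C_act ?D ` vertical_line = vertical_line"
  proof -
    have "(0, t) \<in> SL2C_act ?D ` vertical_line" if "t > 0" for t
      using that l0 by (intro image_eqI[of _ _ "(0, t / (cmod l)\<^sup>2)"])
         (auto simp: act_diag vertical_line_def H3_def)
    moreover have "SL2C_act ?D ` vertical_line \<subseteq> vertical_line"
      using l0 by (auto simp: act_diag vertical_line_def H3_def)
    ultimately show ?thesis by (fastforce simp: vertical_line_def H3_def)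
  qed
  have ax: "axis (pm A) = SL2C_act P ` vertical_line"
    unfolding axis_def act_rcoset
  proof (rule the_equality)
    have "SL2C_act A ` SL2C_act P ` vertical_line = SL2C_act P ` SL2C_act ?D ` vertical_line"
      using actA vH by (force simp: image_image)
    then show "geodesic_line (SL2C_act P ` vertical_line) \<and>
        SL2C_act A ` SL2C_act P ` vertical_line = SL2C_act P ` vertical_line"
      using geodesic_line_act[OF P(1) geodesic_line_vertical] vD by simp
  next
    fix L assume L: "geodesic_line L \<and> SL2C_act A ` L = L"
    then have LH: "L \<subseteq> H3" using geodesic_line_in_H3 by blast
    define K where "K = SL2C_act (adj2 P) ` L"
    have K: "geodesic_line K" unfolding K_def using geodesic_line_act P(1) L by simp
    have LK: "L = SL2C_act P ` K"
      unfolding K_def using LH P(1) by (force simp: SL2C_act_adj2 image_image)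
    have KH: "K \<subseteq> H3" using K geodesic_line_in_H3 by blast
    have "SL2C_act P ` SL2C_act ?D ` K = SL2C_act A ` SL2C_act P ` K"
      using actA KH by (force simp: image_image)
    also have "\<dots> = SL2C_act P ` K" using L LK by simp
    finally have "SL2C_act (adj2 P) ` SL2C_act P ` SL2C_act ?D ` K = SL2C_act (adj2 P) ` SL2C_act P ` K"
      by simp
    moreover have "SL2C_act (adj2 P) ` SL2C_act P ` X = X" if "X \<subseteq> H3" for X
      using that P(1) by (force simp: SL2C_act_adj2 image_image)
    moreover have "SL2C_act ?D ` K \<subseteq> H3" using KH SL2C_act_H3[OF dD] by blast
    ultimately have "SL2C_act ?D ` K = K" using KH by simp
    then show "L = SL2C_act P ` vertical_line" using invariant_line_diag[OF l K] LK by simp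
  qed
  have const: "hdist p (act (pm A) p) = 2 * ln (cmod l)" if pax: "p \<in> axis (pm A)" for p
  proof -
    from pax ax obtain v where v: "v \<in> vertical_line" "p = SL2C_act P v" by blast
    define t where "t = snd v"
    have "v = (0, t)" and t0: "t > 0" using v(1) by (auto simp: t_def vertical_line_def H3_def prod_eq_iff)
    with v have t: "t > 0" "p = SL2C_act P (0, t)" by auto
    have tH: "(0, t) \<in> H3" using t by (simp add: H3_def)
    have "hdist p (act (pm A) p) = hdist (0, t) (SL2C_act ?D (0, t))"
      unfolding act_rcoset t actA[OF tH] using P(1) tH dD by (simp add: hdist_act SL2C_act_H3 del: det_mat2)
    also have "\<dots> = 2 * ln (cmod l)"
      using l l0 t(1) by (simp add: act_diag hdist_vertical ln_mult ln_realpow)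
    finally show ?thesis .
  qed
  have "SL2C_act P (0, 1) \<in> axis (pm A)"
    unfolding ax by (auto simp: vertical_line_def H3_def)
  then show ?thesis unfolding translation_length_def
    using const by (intro the_equality) auto
qed


section \<open>Discrete matrix groups\<close>

text \<open>Discreteness is stated as finiteness of bounded parts, which is the form in which it is applied and
  which is visibly invariant under conjugation.\<close>
locale discrete_SL2 =
  fixes G :: "(complex^2^2) set"
  assumes det_1: "A \<in> G \<Longrightarrow> det A = 1"
    and one_mem: "mat 1 \<in> G"
    and mult_mem: "A \<in> G \<Longrightarrow> B \<in> G \<Longrightarrow> A ** B \<in> G"
    and adj2_mem: "A \<in> G \<Longrightarrow> adj2 A \<in> G"
    and uminus_mem: "A \<in> G \<Longrightarrow> - A \<in> G"
    and finite_bounded: "finite {A \<in> G. \<forall>i j. cmod (A$i$j) \<le> R}"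
begin

lemma diag_power_mem:
  assumes "mat2 l 0 0 (1/l) \<in> G"
  shows "mat2 (l^n) 0 0 (1/l^n) \<in> G"
proof (induction n)
  case 0
  then show ?case using one_mem by (simp add: mat2_one)
next
  case (Suc n)
  then show ?case using mult_mem[OF assms Suc] by simp
qed

lemma bounded_sequence_not_inj:
  assumes "\<And>n::nat. f n \<in> G" "\<And>n i j. cmod (f n $ i $ j) \<le> R" shows "\<not> inj f"
proof
  assume "inj f"
  moreover have "finite (range f)"
    by (rule finite_subset[OF _ finite_bounded[of R]]) (use assms in auto)
  ultimately show False using finite_imageD by blast
qed

text \<open>Conjugation of a triangular matrix with powers of \<open>diag(l, 1/l)\<close>, in the contracting direction,
  yields a bounded sequence in which only the off-diagonal entry varies, by a geometric progression.\<close>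
lemma triangular_imp_diagonal:
  assumes l: "cmod l > 1" "mat2 l 0 0 (1/l) \<in> G"
  shows "mat2 p r 0 s \<in> G \<Longrightarrow> r = 0" "mat2 p 0 r s \<in> G \<Longrightarrow> r = 0"
proof -
  have l0: "l \<noteq> 0" using l by auto
  have inj: "inj (\<lambda>n. r / l^(2*n))" if "r \<noteq> 0"
  proof (rule injI)
    fix m n :: nat assume "r / l^(2*m) = r / l^(2*n)"
    then have "l^(2*m) = l^(2*n)" using that l0 by (simp add: field_simps)
    then have "cmod l^(2*m) = cmod l^(2*n)" by (metis norm_power)
    then show "m = n" using power_inject_exp[OF l(1)] by simp
  qed
  have le: "cmod (r / l^(2*n)) \<le> cmod r" for n
    using l(1) by (simp add: norm_divide norm_power divide_le_eq mult_le_cancel_left1 l0)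
  have B: "mat2 (l^n) 0 0 (1/l^n) \<in> G" "mat2 (1/l^n) 0 0 (l^n) \<in> G" for n
    using diag_power_mem[OF l(2), of n] adj2_mem[OF diag_power_mem[OF l(2), of n]] by auto
  define R where "R = max (cmod p) (max (cmod r) (cmod s))"
  have R: "cmod p \<le> R" "cmod r \<le> R" "cmod s \<le> R" "0 \<le> R" by (auto simp: R_def le_max_iff_disj)
  show "r = 0" if h: "mat2 p r 0 s \<in> G"
  proof (rule ccontr)
    assume r: "r \<noteq> 0"
    have "mat2 p (r / l^(2*n)) 0 s \<in> G" for n
      using mult_mem[OF mult_mem[OF B(2)[of n] h] B(1)[of n]] l0 by (simp add: power_mult power2_eq_square power_mult_distrib mult.commute)
    moreover have "cmod (mat2 p (r / l^(2*n)) 0 s $ i $ j) \<le> R" for n i j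
      using R order_trans[OF le[of n] R(2)] exhaust_2[of i] exhaust_2[of j] by auto
    ultimately have "\<not> inj (\<lambda>n. mat2 p (r / l^(2*n)) 0 s)" by (rule bounded_sequence_not_inj)
    then show False using inj[OF r] unfolding inj_def mat2_eq_iff by blast
  qed
  show "r = 0" if h: "mat2 p 0 r s \<in> G"
  proof (rule ccontr)
    assume r: "r \<noteq> 0"
    have "mat2 p 0 (r / l^(2*n)) s \<in> G" for n
      using mult_mem[OF mult_mem[OF B(1)[of n] h] B(2)[of n]] l0 by (simp add: power_mult power2_eq_square power_mult_distrib mult.commute)
    moreover have "cmod (mat2 p 0 (r / l^(2*n)) s $ i $ j) \<le> R" for n i j
      using R order_trans[OF le[of n] R(2)] exhaust_2[of i] exhaust_2[of j] by auto
    ultimately have "\<not> inj (\<lambda>n. mat2 p 0 (r / l^(2*n)) s)" by (rule bounded_sequence_not_inj)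
    then show False using inj[OF r] unfolding inj_def mat2_eq_iff by blast
  qed
qed

text \<open>A finite set of nonzero numbers stays away from 0.\<close>
lemma lower_left_gap:
  obtains m where "m > 0" "\<And>A. A \<in> G \<Longrightarrow> (\<And>i j. cmod (A$i$j) \<le> R) \<Longrightarrow> cmod (A$2$1) < m \<Longrightarrow> A$2$1 = 0"
proof -
  define S where "S = insert 1 ((\<lambda>A. cmod (A$2$1)) ` {A \<in> G. \<forall>i j. cmod (A$i$j) \<le> R} - {0})"
  have S: "finite S" "S \<noteq> {}" unfolding S_def using finite_bounded by auto
  have "Min S \<in> S" using S by (rule Min_in)
  then have pos: "Min S > 0" unfolding S_def by auto
  moreover have "A$2$1 = 0" if A: "A \<in> G" "\<And>i j. cmod (A$i$j) \<le> R" "cmod (A$2$1) < Min S" for A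
  proof (rule ccontr)
    assume "A$2$1 \<noteq> 0"
    then have "cmod (A$2$1) \<in> S" using A by (auto simp: S_def)
    then show False using Min_le[OF S(1)] A(3) by fastforce
  qed
  ultimately show ?thesis using that by blast
qed

end

section \<open>Long words are rarely conjugate\<close>

lemma norm_power_bracket:
  assumes "b > 1" "r \<ge> (1::real)"
  obtains k :: nat where "b^k \<le> r" "r < b^(k+1)"
proof -
  define P where "P n = (r < b^n)" for n
  obtain n where n: "P n" using real_arch_pow[OF assms(1)] unfolding P_def by blast
  define m where "m = (LEAST n. P n)"
  have m: "P m" unfolding m_def by (rule LeastI[of P, OF n])
  have "m \<noteq> 0" using m assms(2) unfolding P_def by (intro notI) simp
  then obtain k where k: "m = Suc k" by (cases m) auto
  have "\<not> P k" using not_less_Least[of k P] k m_def by auto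
  then show ?thesis using that[of k] m k by (auto simp: P_def)
qed

text \<open>Powers of \<open>up\<close> and \<open>down\<close> change \<open>f g\<close> by all integral powers of \<open>R\<close>, so \<open>f g\<close> can be brought within a
  factor \<open>\<surd>R\<close> of 1.\<close>
lemma normalise_by_scaling:
  fixes f :: "'a \<Rightarrow> real"
  assumes R: "R > 1" and g: "g \<in> S" "f g > 0"
    and up: "\<And>g. g \<in> S \<Longrightarrow> up g \<in> S \<and> f (up g) = R * f g"
    and down: "\<And>g. g \<in> S \<Longrightarrow> down g \<in> S \<and> f (down g) = f g / R"
  obtains h where "h \<in> S" "1 / R \<le> (f h)\<^sup>2" "(f h)\<^sup>2 \<le> R"
proof -
  have ups: "(up^^n) g \<in> S \<and> f ((up^^n) g) = R^n * f g" for n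
    using up g by (induction n) (auto simp: algebra_simps)
  obtain n where "1 / f g < R^n" using real_arch_pow[OF R] by blast
  then have ge: "f ((up^^n) g) \<ge> 1" using ups g by (simp add: field_simps)
  define g1 where "g1 = (up^^n) g"
  have g1: "g1 \<in> S" "f g1 \<ge> 1" using ups ge by (auto simp: g1_def)
  obtain k :: nat where k: "R^k \<le> f g1" "f g1 < R^(k+1)" using norm_power_bracket[OF R g1(2)] by blast
  have downs: "(down^^m) g1 \<in> S \<and> f ((down^^m) g1) = f g1 / R^m" for m
    using down g1 by (induction m) (auto simp: field_simps)
  define h where "h = (down^^k) g1"
  have h: "h \<in> S" "1 \<le> f h" "f h < R"
    using downs[of k] k R by (auto simp: h_def pos_le_divide_eq pos_divide_less_eq)
  have h1: "1 \<le> (f h)\<^sup>2" using h(2) by (simp add: one_le_power)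
  show ?thesis
  proof (cases "(f h)\<^sup>2 \<le> R")
    case True
    have "1 / R \<le> 1" using R by simp
    then show ?thesis using that[of h] h h1 True by linarith
  next
    case False
    have "(f h)\<^sup>2 < R\<^sup>2" using h by (intro power_strict_mono) auto
    then have up: "(f h)\<^sup>2 / R\<^sup>2 \<le> R" using R by (simp add: divide_le_eq) (smt (verit) mult_le_cancel_right1 zero_le_power2)
    have "1 / R = R / R\<^sup>2" using R by (simp add: power2_eq_square)
    also have "\<dots> \<le> (f h)\<^sup>2 / R\<^sup>2" using False by (intro divide_right_mono) auto
    finally have low: "1 / R \<le> (f h)\<^sup>2 / R\<^sup>2" .
    have "(f (down h))\<^sup>2 = (f h)\<^sup>2 / R\<^sup>2" using down[OF h(1)] by (simp add: power_divide)
    then have "(f (down h))\<^sup>2 \<le> R" "1 / R \<le> (f (down h))\<^sup>2" using up low by auto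
    then show ?thesis using that[of "down h"] down[OF h(1)] by blast
  qed
qed

text \<open>The matrix \<open>a + b M\<close> is an element of the centralizer of \<open>M = diag(l, 1/l)\<^sup>n u\<close>. Its eigenvalue \<open>m\<close>
  belongs to the eigenvector of \<open>M\<close> with the large eigenvalue \<open>E\<close>, which has the order of magnitude of
  \<open>l\<^sup>n\<close>. From \<open>b (E - 1/E) = m - 1/m\<close> one reads off that \<open>b\<close> is at most of order \<open>m / E\<close>. Since
  \<open>\<bar>m\<bar>\<^sup>2 \<le> \<bar>E\<bar>\<close>, the diagonal entries of \<open>a + b M\<close> have orders \<open>m\<close> and \<open>1/m\<close>, the upper right entry has order
  \<open>m\<close>, and the lower left entry has order \<open>(m / l\<^sup>n) / l\<^sup>n\<close>. Dividing the first row by \<open>l\<^sup>k\<close> with \<open>\<bar>l\<bar>\<^sup>k\<close> close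
  to \<open>\<bar>m\<bar>\<close>, and multiplying the second row by it, bounds all entries, and the lower left one becomes
  at most of order \<open>1 / l\<^sup>n\<close>.\<close>
lemma centralizer_estimate:
  fixes x y z w l d :: complex
  assumes l: "cmod l > 1" and x: "x \<noteq> 0" and d: "d \<noteq> 0"
  obtains N K where "\<And>n E m a b. \<lbrakk>n \<ge> N; cmod E > 1; E + 1/E = x * l^n + w / l^n; m = a + b * E;
      1/m = a + b / E; 1 \<le> cmod m; (cmod m)\<^sup>2 \<le> cmod E\<rbrakk> \<Longrightarrow>
      \<exists>k. cmod (d * (a + b * (x * l^n)) / l^k) \<le> K \<and> cmod (d * (b * (y * l^n)) / l^k) \<le> K \<and>
          cmod (b * (z / l^n) / d * l^k) \<le> K / cmod l^n \<and> cmod ((a + b * (w / l^n)) / d * l^k) \<le> K"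
proof -
  define K1 where "K1 = 5 + 4 * cmod w"
  define K where "K = max (cmod d * cmod l * K1) (max (cmod d * cmod l * (8 * cmod y / cmod x))
     (max (8 * cmod z * (cmod x + cmod w + 1) / (cmod x * cmod d)) (K1 / cmod d)))"
  have xp: "cmod x > 0" and dp: "cmod d > 0" using x d by auto
  obtain N where N: "max 1 ((2 * cmod w + 4) / cmod x) < cmod l^N" using real_arch_pow[OF l] by blast
  show ?thesis
  proof (rule that[of N K])
    fix n E m a b
    assume n: "N \<le> n" and E: "cmod E > 1" "E + 1/E = x * l^n + w / l^n"
      and m: "m = a + b * E" "1/m = a + b / E" "1 \<le> cmod m" "(cmod m)\<^sup>2 \<le> cmod E"
    define L where "L = cmod l^n"
    have "cmod l^N \<le> L" unfolding L_def using n l by (intro power_increasing) auto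
    then have L: "L > 1" "(2 * cmod w + 4) / cmod x < L" using N by auto
    then have Lx: "cmod x * L > 2 * cmod w + 4" using xp by (simp add: field_simps)
    have nl: "cmod (l^n) = L" by (simp add: L_def norm_power)
    have l0: "l \<noteq> 0" using l by auto
    have E0: "E \<noteq> 0" using E by auto
    have mp: "cmod m > 0" and m0: "m \<noteq> 0" using m by auto
    have Ep: "cmod E > 0" using E by auto
    have nE: "cmod (1/E) < 1" using E(1) by (simp add: norm_divide divide_less_eq)
    have nW: "cmod (w / l^n) \<le> cmod w"
      using L by (simp add: norm_divide nl divide_le_eq mult_le_cancel_left1)
    have "cmod (x * l^n) \<le> cmod E + cmod (1/E) + cmod (w / l^n)"
      using norm_triangle_ineq4[of "E + 1/E" "w / l^n"] norm_triangle_ineq[of E "1/E"] E(2) by simp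
    then have "cmod x * L \<le> cmod E + 1 + cmod w" using nE nW by (simp add: norm_mult nl)
    then have Elow: "cmod E \<ge> cmod x * L / 2" "cmod E \<ge> 2" using Lx by (simp_all, smt (verit) norm_ge_zero)
    have "E = x * l^n + w / l^n - 1/E" using E(2) by (simp add: algebra_simps)
    then have "cmod E \<le> cmod (x * l^n) + cmod (w / l^n) + cmod (1/E)"
      by (metis (no_types, lifting) add_right_mono norm_triangle_ineq norm_triangle_ineq4 order_trans)
    then have "cmod E \<le> cmod x * L + cmod w + 1" using nE nW by (simp add: norm_mult nl)
    also have "\<dots> \<le> cmod x * L + cmod w * L + 1 * L" using L by (intro add_mono mult_right_mono) (auto simp: mult_le_cancel_left1)
    finally have Eup: "cmod E \<le> (cmod x + cmod w + 1) * L" by (simp add: algebra_simps)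
    have bE: "b * (E - 1/E) = m - 1/m" using m(1,2) by (simp add: algebra_simps)
    have "cmod (m - 1/m) \<le> 2 * cmod m"
    proof -
      have "cmod (1/m) \<le> cmod m" using m(3) mp by (simp add: norm_divide divide_le_eq mult_le_cancel_left1)
         (smt (verit) mult_le_cancel_left1)
      then show ?thesis using norm_triangle_ineq4[of m "1/m"] by linarith
    qed
    moreover have "cmod (E - 1/E) \<ge> cmod E / 2"
      using norm_triangle_ineq2[of E "1/E"] nE Elow(2) by linarith
    then have "cmod b * (cmod E / 2) \<le> cmod b * cmod (E - 1/E)" by (intro mult_left_mono) auto
    moreover have "cmod b * cmod (E - 1/E) = cmod (m - 1/m)" using bE by (metis norm_mult)
    ultimately have "cmod b * (cmod E / 2) \<le> 2 * cmod m" by linarith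
    then have bb: "cmod b \<le> 4 * cmod m / cmod E" using Ep by (simp add: field_simps)
    also have "\<dots> \<le> 4 * cmod m / (cmod x * L / 2)" using Elow mp xp L Ep by (intro divide_left_mono mult_pos_pos) auto
    finally have bL: "cmod b \<le> 8 * cmod m / (cmod x * L)" by simp
    have WE: "cmod (w / l^n - 1/E) \<le> cmod w + 1" using nE nW norm_triangle_ineq4[of "w / l^n" "1/E"] by linarith
    have bWE: "cmod (b * (w / l^n - 1/E)) \<le> 4 * cmod m / cmod E * (cmod w + 1)"
      unfolding norm_mult using bb WE by (intro mult_mono) auto
    have "a + b * (x * l^n) = m - b * (w / l^n - 1/E)"
    proof -
      have "a + b * (x * l^n) = a + b * (E + 1/E - w / l^n)" using E(2) by simp
      then show ?thesis using m(1) by (simp add: algebra_simps)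
    qed
    then have c11: "cmod (a + b * (x * l^n)) \<le> cmod m + 4 * cmod m / cmod E * (cmod w + 1)"
      using norm_triangle_ineq4[of m "b * (w / l^n - 1/E)"] bWE by simp
    also have "\<dots> \<le> cmod m + 4 * cmod m / 1 * (cmod w + 1)" using E mp by (intro add_left_mono mult_right_mono divide_left_mono) auto
    finally have c11: "cmod (a + b * (x * l^n)) \<le> K1 * cmod m" by (simp add: K1_def algebra_simps)
    have "a + b * (w / l^n) = 1/m + b * (w / l^n - 1/E)" using m(2) by (simp add: algebra_simps)
    then have "cmod (a + b * (w / l^n)) \<le> cmod (1/m) + 4 * cmod m / cmod E * (cmod w + 1)"
      using norm_triangle_ineq[of "1/m" "b * (w / l^n - 1/E)"] bWE by simp
    also have "\<dots> \<le> 1 / cmod m + 4 * (1 / cmod m) * (cmod w + 1)"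
    proof -
      have "cmod m / cmod E \<le> 1 / cmod m" using m(4) mp Ep by (simp add: field_simps power2_eq_square)
      then have "4 * cmod m / cmod E \<le> 4 * (1 / cmod m)" by linarith
      then show ?thesis by (intro add_mono mult_right_mono) (auto simp: norm_divide)
    qed
    also have "\<dots> = K1 / cmod m" by (simp add: K1_def add_divide_distrib algebra_simps)
    finally have c22: "cmod (a + b * (w / l^n)) \<le> K1 / cmod m" .
    have c12: "cmod (b * (y * l^n)) \<le> 8 * cmod y / cmod x * cmod m"
    proof -
      have "cmod (b * (y * l^n)) = cmod b * (cmod y * L)" by (simp add: norm_mult nl)
      also have "\<dots> \<le> 8 * cmod m / (cmod x * L) * (cmod y * L)" using bL L by (intro mult_right_mono) auto
      finally show ?thesis using L by (simp add: field_simps)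
    qed
    have c21: "cmod (b * (z / l^n)) \<le> 8 * cmod z * cmod m / (cmod x * L\<^sup>2)"
    proof -
      have "cmod (b * (z / l^n)) = cmod b * (cmod z / L)" by (simp add: norm_mult norm_divide nl)
      also have "\<dots> \<le> 8 * cmod m / (cmod x * L) * (cmod z / L)" using bL L by (intro mult_right_mono) auto
      finally show ?thesis by (simp add: field_simps power2_eq_square)
    qed
    obtain k where k: "cmod l^k \<le> cmod m" "cmod m < cmod l^(k+1)" using norm_power_bracket[OF l m(3)] by blast
    define J where "J = cmod l^k"
    have J: "J > 0" "J \<le> cmod m" using k l0 by (auto simp: J_def)
    have "cmod m \<le> cmod l * J" using k(2) by (simp add: J_def)
    then have J: "J > 0" "J \<le> cmod m" "cmod m / J \<le> cmod l" using J by (auto simp: divide_le_eq)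
    have nJ: "cmod (l^k) = J" by (simp add: J_def norm_power)
    have K1: "K1 > 0" by (simp add: K1_def add_pos_nonneg)
    show "\<exists>k. cmod (d * (a + b * (x * l^n)) / l^k) \<le> K \<and> cmod (d * (b * (y * l^n)) / l^k) \<le> K \<and>
          cmod (b * (z / l^n) / d * l^k) \<le> K / cmod l^n \<and> cmod ((a + b * (w / l^n)) / d * l^k) \<le> K"
    proof (intro exI[of _ k] conjI)
      have "cmod (d * (a + b * (x * l^n)) / l^k) \<le> cmod d * (K1 * cmod m) / J"
        unfolding norm_mult[of d] norm_divide nJ using c11 J by (intro divide_right_mono mult_left_mono) auto
      also have "\<dots> = cmod d * K1 * (cmod m / J)" by simp
      also have "\<dots> \<le> cmod d * K1 * cmod l" using J K1 by (intro mult_left_mono) auto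
      also have "\<dots> \<le> K" by (simp add: K_def mult_ac)
      finally show "cmod (d * (a + b * (x * l^n)) / l^k) \<le> K" .
      have "cmod (d * (b * (y * l^n)) / l^k) \<le> cmod d * (8 * cmod y / cmod x * cmod m) / J"
        unfolding norm_mult[of d] norm_divide nJ using c12 J by (intro divide_right_mono mult_left_mono) auto
      also have "\<dots> = cmod d * (8 * cmod y / cmod x) * (cmod m / J)" by simp
      also have "\<dots> \<le> cmod d * (8 * cmod y / cmod x) * cmod l" using J by (intro mult_left_mono) auto
      also have "\<dots> \<le> K" by (simp add: K_def mult_ac)
      finally show "cmod (d * (b * (y * l^n)) / l^k) \<le> K" .
      have "cmod ((a + b * (w / l^n)) / d * l^k) \<le> K1 / cmod m / cmod d * J"
        unfolding norm_mult norm_divide[of "a + b * (w / l^n)"] nJ using c22 J by (intro mult_right_mono divide_right_mono) auto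
      also have "\<dots> = K1 / cmod d * (J / cmod m)" by simp
      also have "\<dots> \<le> K1 / cmod d * 1" using J K1 mp by (intro mult_left_mono) (auto simp: field_simps)
      also have "\<dots> \<le> K" by (simp add: K_def)
      finally show "cmod ((a + b * (w / l^n)) / d * l^k) \<le> K" .
      have "cmod (b * (z / l^n) / d * l^k) \<le> 8 * cmod z * cmod m / (cmod x * L\<^sup>2) / cmod d * cmod m"
        unfolding norm_mult[of "b * (z / l^n) / d"] norm_divide[of "b * (z / l^n)"] nJ
        using c21 J by (intro mult_mono divide_right_mono) auto
      also have "\<dots> = 8 * cmod z / (cmod x * cmod d * L\<^sup>2) * (cmod m)\<^sup>2" by (simp add: power2_eq_square mult_ac)
      also have "\<dots> \<le> 8 * cmod z / (cmod x * cmod d * L\<^sup>2) * ((cmod x + cmod w + 1) * L)"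
        using m(4) Eup by (intro mult_left_mono) auto
      also have "\<dots> = (8 * cmod z * (cmod x + cmod w + 1) / (cmod x * cmod d)) / L"
        using L xp dp by (simp add: field_simps power2_eq_square)
      also have "\<dots> \<le> K / L" using L by (intro divide_right_mono) (auto simp: K_def)
      finally show "cmod (b * (z / l^n) / d * l^k) \<le> K / cmod l^n" by (simp add: L_def)
    qed
  qed
qed

context discrete_SL2
begin

text \<open>The matrix in \<open>G\<close> is \<open>g = D (a + b M)\<close> with \<open>D = diag(d, 1/d)\<close> and \<open>M = diag(l, 1/l)\<^sup>n u\<close>. By
  \<open>centralizer_estimate\<close> and discreteness, \<open>g\<close> is a power of \<open>diag(l, 1/l)\<close> times an upper triangular
  matrix for large \<open>n\<close>. The latter is then diagonal, so the coefficient \<open>b\<close> is 0, and \<open>g\<close> is \<open>D\<close> up to sign.\<close>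
lemma long_conjugator_one_sided:
  assumes l: "cmod l > 1" "mat2 l 0 0 (1/l) \<in> G" and nz: "x \<noteq> 0" "y \<noteq> 0" "d \<noteq> 0"
    and dt: "x * w - y * z = 1"
  obtains N where "\<And>n E m a b. \<lbrakk>n \<ge> N; cmod E > 1; E + 1/E = x * l^n + w / l^n; m = a + b * E;
      1/m = a + b / E; 1 \<le> cmod m; (cmod m)\<^sup>2 \<le> cmod E;
      mat2 (d * (a + b * (x * l^n))) (d * (b * (y * l^n))) (b * (z / l^n) / d) ((a + b * (w / l^n)) / d) \<in> G\<rbrakk>
      \<Longrightarrow> \<exists>e. e\<^sup>2 = d\<^sup>2 \<and> mat2 e 0 0 (1/e) \<in> G"
proof -
  have l0: "l \<noteq> 0" using l by auto
  obtain N1 K where est: "\<And>n E m a b. \<lbrakk>n \<ge> N1; cmod E > 1; E + 1/E = x * l^n + w / l^n; m = a + b * E;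
      1/m = a + b / E; 1 \<le> cmod m; (cmod m)\<^sup>2 \<le> cmod E\<rbrakk> \<Longrightarrow>
      \<exists>k. cmod (d * (a + b * (x * l^n)) / l^k) \<le> K \<and> cmod (d * (b * (y * l^n)) / l^k) \<le> K \<and>
          cmod (b * (z / l^n) / d * l^k) \<le> K / cmod l^n \<and> cmod ((a + b * (w / l^n)) / d * l^k) \<le> K"
    using centralizer_estimate[OF l(1) nz(1,3), where y=y and z=z and w=w] by blast
  obtain \<epsilon> where eps: "\<epsilon> > 0" "\<And>A. A \<in> G \<Longrightarrow> (\<And>i j. cmod (A$i$j) \<le> K) \<Longrightarrow> cmod (A$2$1) < \<epsilon> \<Longrightarrow> A$2$1 = 0"
    using lower_left_gap[of K] by blast
  obtain N2 where N2: "K / \<epsilon> < cmod l^N2" using real_arch_pow[OF l(1)] by blast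
  show ?thesis
  proof (rule that[of "max N1 N2"])
    fix n E m a b
    assume n: "max N1 N2 \<le> n" and E: "cmod E > 1" "E + 1/E = x * l^n + w / l^n"
      and m: "m = a + b * E" "1/m = a + b / E" "1 \<le> cmod m" "(cmod m)\<^sup>2 \<le> cmod E"
      and g: "mat2 (d * (a + b * (x * l^n))) (d * (b * (y * l^n))) (b * (z / l^n) / d) ((a + b * (w / l^n)) / d) \<in> G"
    obtain k where k: "cmod (d * (a + b * (x * l^n)) / l^k) \<le> K" "cmod (d * (b * (y * l^n)) / l^k) \<le> K"
          "cmod (b * (z / l^n) / d * l^k) \<le> K / cmod l^n" "cmod ((a + b * (w / l^n)) / d * l^k) \<le> K"
      using est[OF _ E m] n by auto
    have "mat2 (1/l^k) 0 0 (l^k) \<in> G" using adj2_mem[OF diag_power_mem[OF l(2), of k]] by simp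
    from mult_mem[OF this g]
    have h: "mat2 (d * (a + b * (x * l^n)) / l^k) (d * (b * (y * l^n)) / l^k)
        (b * (z / l^n) / d * l^k) ((a + b * (w / l^n)) / d * l^k) \<in> G" (is "?h \<in> G")
      by (simp add: mult.commute)
    have "K \<ge> 0" using k(1) norm_ge_zero order_trans by blast
    have Ln: "cmod l^N2 \<le> cmod l^n" using n l(1) by (intro power_increasing) auto
    have "K / cmod l^n \<le> K"
      using \<open>K \<ge> 0\<close> l(1) by (simp add: divide_le_eq mult_le_cancel_left1)
    then have bd: "cmod (?h $ i $ j) \<le> K" for i j
      using k order_trans[OF k(3)] exhaust_2[of i] exhaust_2[of j] by auto
    have "K < \<epsilon> * cmod l^n" using N2 Ln eps(1) by (smt (verit) pos_divide_less_eq mult.commute mult_left_mono)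
    then have "K / cmod l^n < \<epsilon>" using l0 by (simp add: divide_less_eq)
    then have "cmod (?h $ 2 $ 1) < \<epsilon>" using k(3) by simp
    then have h21: "?h $ 2 $ 1 = 0" by (rule eps(2)[OF h bd])
    then have "mat2 (d * (a + b * (x * l^n)) / l^k) (d * (b * (y * l^n)) / l^k) 0 ((a + b * (w / l^n)) / d * l^k) \<in> G"
      using h unfolding mat2_entries by metis
    from triangular_imp_diagonal(1)[OF l this] have b0: "b = 0" using nz l0 by simp
    then have a0: "a \<noteq> 0" and "1 / a = a" using m(1,2,3) by auto
    then have aa: "a * a = 1" by (metis nonzero_eq_divide_eq)
    have "(a * d)\<^sup>2 = (a * a) * d\<^sup>2" "1 / (a * d) = (1 / a) / d" by (simp_all add: power2_eq_square)
    then have "(a * d)\<^sup>2 = d\<^sup>2" "1 / (a * d) = a / d" using aa \<open>1 / a = a\<close> by simp_all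
    moreover have "mat2 (a * d) 0 0 (a / d) \<in> G" using g b0 by (simp add: mult.commute)
    ultimately show "\<exists>e. e\<^sup>2 = d\<^sup>2 \<and> mat2 e 0 0 (1/e) \<in> G" by metis
  qed
qed

text \<open>A conjugator \<open>g\<close> may be multiplied by powers of the word \<open>M\<close>, whose large eigenvalue is \<open>E\<close>. This
  brings the absolute value of the eigenvalue \<open>mu\<close> of \<open>D\<inverse> g\<close> between \<open>1 / \<surd>\<bar>E\<bar>\<close> and \<open>\<surd>\<bar>E\<bar>\<close>. If it is less
  than 1, the inverse of \<open>g\<close> conjugates the second word to the first, with the inverse eigenvalue. So
  \<open>long_conjugator_one_sided\<close> applies to one of the two.\<close>
lemma long_words_not_conjugate:
  assumes l: "cmod l > 1" "mat2 l 0 0 (1/l) \<in> G" and nz: "x \<noteq> 0" "y \<noteq> 0" "t \<noteq> 0"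
    and u: "mat2 x y z w \<in> G" and u': "mat2 x (t * y) (z / t) w \<in> G"
    and no: "\<not> (\<exists>e. e\<^sup>2 = t \<and> mat2 e 0 0 (1/e) \<in> G)"
  obtains N where "\<And>n g. n \<ge> N \<Longrightarrow> g \<in> G \<Longrightarrow>
     g ** (mat2 (l^n) 0 0 (1/l^n) ** mat2 x y z w) \<noteq> mat2 (l^n) 0 0 (1/l^n) ** mat2 x (t * y) (z / t) w ** g"
proof -
  \<comment> \<open>\<open>D = diag(d, 1/d)\<close> conjugates the first word to the second.\<close>
  define d where "d = csqrt t"
  have dd: "d * d = t" unfolding d_def using power2_csqrt[of t] by (simp add: power2_eq_square)
  have d0: "d \<noteq> 0" using nz dd by auto
  have l0: "l \<noteq> 0" using l by auto
  have dt: "x * w - y * z = 1" using det_1[OF u] by simp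
  have dt': "x * w - (t * y) * (z / t) = 1" using dt nz(3) by simp
  obtain N1 where N1: "\<And>n E m a b. \<lbrakk>n \<ge> N1; cmod E > 1; E + 1/E = x * l^n + w / l^n; m = a + b * E;
      1/m = a + b / E; 1 \<le> cmod m; (cmod m)\<^sup>2 \<le> cmod E;
      mat2 (d * (a + b * (x * l^n))) (d * (b * (y * l^n))) (b * (z / l^n) / d) ((a + b * (w / l^n)) / d) \<in> G\<rbrakk>
      \<Longrightarrow> \<exists>e. e\<^sup>2 = d\<^sup>2 \<and> mat2 e 0 0 (1/e) \<in> G"
    using long_conjugator_one_sided[OF l nz(1,2) d0 dt] by blast
  have ty0: "t * y \<noteq> 0" and id0: "1/d \<noteq> 0" using nz d0 by auto
  obtain N2 where N2: "\<And>n E m a b. \<lbrakk>n \<ge> N2; cmod E > 1; E + 1/E = x * l^n + w / l^n; m = a + b * E;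
      1/m = a + b / E; 1 \<le> cmod m; (cmod m)\<^sup>2 \<le> cmod E;
      mat2 (1/d * (a + b * (x * l^n))) (1/d * (b * (t * y * l^n))) (b * (z / t / l^n) / (1/d)) ((a + b * (w / l^n)) / (1/d)) \<in> G\<rbrakk>
      \<Longrightarrow> \<exists>e. e\<^sup>2 = (1/d)\<^sup>2 \<and> mat2 e 0 0 (1/e) \<in> G"
    using long_conjugator_one_sided[OF l nz(1) ty0 id0 dt'] by blast
  have no': "\<not> (\<exists>e. e\<^sup>2 = d\<^sup>2 \<and> mat2 e 0 0 (1/e) \<in> G)" using no dd by (simp add: power2_eq_square)
  have no'': "\<not> (\<exists>e. e\<^sup>2 = (1/d)\<^sup>2 \<and> mat2 e 0 0 (1/e) \<in> G)"
  proof
    assume "\<exists>e. e\<^sup>2 = (1/d)\<^sup>2 \<and> mat2 e 0 0 (1/e) \<in> G"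
    then obtain e where e: "e\<^sup>2 = (1/d)\<^sup>2" "mat2 e 0 0 (1/e) \<in> G" by blast
    have "mat2 (1/e) 0 0 (1/(1/e)) \<in> G" using adj2_mem[OF e(2)] by simp
    moreover have "(1/e)\<^sup>2 = d\<^sup>2" using e(1) by (simp add: power_divide)
    ultimately show False using no' by blast
  qed
  obtain N3 where N3: "(cmod w + 2) / cmod x < cmod l^N3" using real_arch_pow[OF l(1)] by blast
  show ?thesis
  proof (rule that[of "max N1 (max N2 N3)"], rule notI)
    fix n g
    assume n: "max N1 (max N2 N3) \<le> n" and gG: "g \<in> G"
      and eq: "g ** (mat2 (l^n) 0 0 (1/l^n) ** mat2 x y z w) = mat2 (l^n) 0 0 (1/l^n) ** mat2 x (t * y) (z / t) w ** g"
    define X Y Z W where "X = x * l^n" "Y = y * l^n" "Z = z / l^n" "W = w / l^n"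
    note XYZW = this
    define M where "M = mat2 X Y Z W"
    define M' where "M' = mat2 X (t * Y) (Z / t) W"
    have M: "M = mat2 (l^n) 0 0 (1/l^n) ** mat2 x y z w" "M' = mat2 (l^n) 0 0 (1/l^n) ** mat2 x (t * y) (z / t) w"
      by (simp_all add: M_def M'_def XYZW mult_ac)
    have MG: "M \<in> G" unfolding M by (intro mult_mem diag_power_mem l u)
    have dM: "X * W - Y * Z = 1" using det_1[OF MG] by (simp add: M_def)
    have Y0: "Y \<noteq> 0" using nz l0 by (simp add: XYZW)
    obtain E where E: "X + W = E + 1/E" "E \<noteq> 0" "cmod E \<ge> 1" by (rule trace_eigenvalue)
    have E1: "cmod E > 1"
    proof (rule ccontr)
      assume "\<not> cmod E > 1"
      then have "cmod E = 1" using E by simp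
      then have "cmod (E + 1/E) \<le> 2" using norm_triangle_ineq[of E "1/E"] by (simp add: norm_divide)
      moreover have L: "cmod l^N3 \<le> cmod l^n" "1 \<le> cmod l^n" using n l(1) by (auto intro: power_increasing)
      have "cmod W \<le> cmod w"
        using L(2) l0 by (simp add: XYZW norm_divide norm_power divide_le_eq mult_le_cancel_left1)
      moreover have "cmod X > cmod w + 2"
      proof -
        have "cmod w + 2 < cmod x * cmod l^N3" using N3 nz by (simp add: field_simps)
        also have "\<dots> \<le> cmod X" using L(1) by (simp add: XYZW norm_mult norm_power mult_left_mono)
        finally show ?thesis .
      qed
      ultimately show False using norm_triangle_ineq2[of X "-W"] E(1) by simp
    qed
    \<comment> \<open>The eigenvalue of \<open>D\<inverse> g\<close> on the eigenvector \<open>(Y, E - X)\<close> of \<open>M\<close>, read off from the first row\<close>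
    define mu where "mu g = g$1$1 / d + g$1$2 / d * ((E - X) / Y)" for g :: "complex^2^2"
    define S where "S = {g \<in> G. g ** M = M' ** g}"
    have EE: "E * E = (X + W) * E - 1" using E(1,2) by (simp add: field_simps)
    have mu_M: "mu (g ** M) = E * mu g" for g
    proof -
      obtain p q r s where g: "g = mat2 p q r s" by (rule mat2_cases)
      have "(p * X + q * Z) * Y + (p * Y + q * W) * (E - X) = E * (p * Y + q * (E - X))"
        using EE dM by algebra
      moreover have "mu g' = (g'$1$1 * Y + g'$1$2 * (E - X)) / (d * Y)" for g'
        using Y0 d0 by (simp add: mu_def field_simps)
      ultimately show ?thesis unfolding g M_def by simp
    qed
    have mu_M': "mu (g ** adj2 M) = mu g / E" for g
    proof -
      have "g ** adj2 M ** M = g" using det_1[OF MG] by (simp add: adj2_inverse flip: matrix_mul_assoc)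
      then show ?thesis using mu_M[of "g ** adj2 M"] E(2) by simp
    qed
    have M2: "adj2 M ** M = M ** adj2 M" using det_1[OF MG] by (simp add: adj2_inverse)
    \<comment> \<open>\<open>D\<inverse> h\<close> commutes with \<open>M\<close>, so it is \<open>a + b M\<close>; its determinant is the product of its two
      eigenvalues \<open>a + b E\<close> and \<open>a + b / E\<close>.\<close>
    have struct: "\<exists>a b. h = mat2 (d * (a + b * X)) (d * (b * Y)) (b * Z / d) ((a + b * W) / d)
        \<and> mu h = a + b * E \<and> (a + b * E) * (a + b / E) = 1" if h: "h \<in> S" for h
    proof -
      obtain p q r s where pq: "h = mat2 p q r s" by (rule mat2_cases)
      have "h \<in> G" using h by (simp add: S_def)
      then have "p * s - q * r = 1" using det_1[of h] pq by simp
      have c: "p * X + q * Z = X * p + t * Y * r" "p * Y + q * W = X * q + t * Y * s"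
        using h unfolding S_def pq M_def M'_def by auto
      define b where "b = q / (d * Y)"
      define a where "a = p / d - b * X"
      have p: "p = d * (a + b * X)" using d0 by (simp add: a_def)
      have q: "q = d * (b * Y)" using d0 Y0 by (simp add: b_def)
      have "q * Z = d * d * Y * r" using c(1) dd by simp
      then have "d * (b * Z) * (d * Y) = d * d * r * (d * Y)" unfolding q by algebra
      then have r: "r = b * Z / d" using d0 Y0 by (simp add: field_simps)
      have "d * d * Y * s = p * Y + q * W - X * q" using c(2) dd by simp
      then have "d * s * (d * Y) = (a + b * W) * (d * Y)" unfolding p q by algebra
      then have "d * s = a + b * W" using d0 Y0 by simp
      then have s: "s = (a + b * W) / d" using d0 by (simp add: field_simps)
      have mu: "mu h = a + b * E"
        using d0 Y0 by (simp add: mu_def pq p q field_simps)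
      have "(a + b * X) * (a + b * W) - b * Y * (b * Z) = 1"
        using \<open>p * s - q * r = 1\<close> d0 unfolding p q r s by (simp add: mult.assoc)
      then have "a * a + a * b * (X + W) + b * b = 1" using dM by algebra
      then have "(a + b * E) * (a + b / E) = 1"
        unfolding E(1) using E(2) by (simp add: field_simps)
      then show ?thesis using pq p q r s mu by blast
    qed
    have gS: "g \<in> S" using gG eq unfolding S_def M by simp
    obtain a0 b0 where "mu g = a0 + b0 * E" "(a0 + b0 * E) * (a0 + b0 / E) = 1" using struct[OF gS] by blast
    then have "mu g \<noteq> 0" by auto
    then have mug: "cmod (mu g) > 0" by simp
    obtain h where h: "h \<in> S" "1 / cmod E \<le> (cmod (mu h))\<^sup>2" "(cmod (mu h))\<^sup>2 \<le> cmod E"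
    proof (rule normalise_by_scaling[of "cmod E" g S "\<lambda>g. cmod (mu g)" "\<lambda>g. g ** M" "\<lambda>g. g ** adj2 M"])
      fix g assume g: "g \<in> S"
      show "g ** M \<in> S \<and> cmod (mu (g ** M)) = cmod E * cmod (mu g)"
      proof -
        have gm: "g ** M = M' ** g" and gG: "g \<in> G" using g by (auto simp: S_def)
        have "(g ** M) ** M = M' ** (g ** M)" using gm by (metis matrix_mul_assoc)
        then have "g ** M \<in> S" unfolding S_def using mult_mem[OF gG MG] by blast
        then show ?thesis using mu_M[of g] by (simp add: norm_mult)
      qed
      have "(g ** adj2 M) ** M = (g ** M) ** adj2 M" by (simp add: M2 flip: matrix_mul_assoc)
      also have "\<dots> = M' ** (g ** adj2 M)" using g by (simp add: S_def matrix_mul_assoc)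
      finally show "g ** adj2 M \<in> S \<and> cmod (mu (g ** adj2 M)) = cmod (mu g) / cmod E"
        using g MG by (simp add: S_def mult_mem adj2_mem mu_M' norm_divide)
    qed (use E1 gS mug in simp_all)
    obtain a b where ab: "h = mat2 (d * (a + b * X)) (d * (b * Y)) (b * Z / d) ((a + b * W) / d)"
        "mu h = a + b * E" "(a + b * E) * (a + b / E) = 1" using struct[OF h(1)] by blast
    have hG: "h \<in> G" using h(1) by (simp add: S_def)
    define m where "m = a + b * E"
    have m0: "m \<noteq> 0" using ab(3) by (auto simp: m_def)
    have "m * (a + b / E) = 1" using ab(3) by (simp only: m_def)
    then have m1: "1 / m = a + b / E" using m0 by (metis nonzero_mult_div_cancel_left)
    show False
    proof (cases "cmod m \<ge> 1")
      case True
      have "\<exists>e. e\<^sup>2 = d\<^sup>2 \<and> mat2 e 0 0 (1/e) \<in> G"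
        using N1[of n E m a b] n E1 E(1) m1 True h(3) hG ab(1,2) by (simp add: m_def XYZW)
      then show False using no' by blast
    next
      case False
      define a' where "a' = a + b * (X + W)"
      have "1 / m = a' + (- b) * E" "1 / (1/m) = a' + (- b) / E"
        unfolding a'_def E(1) m1 by (simp add: algebra_simps) (simp add: m_def algebra_simps flip: m1)
      moreover have "1 \<le> cmod (1/m)" using False m0 by (simp add: norm_divide)
      moreover have "(cmod (1/m))\<^sup>2 \<le> cmod E"
      proof -
        have "cmod E > 0" "(cmod m)\<^sup>2 > 0" using E1 m0 by auto
        then show ?thesis using h(2) unfolding ab(2) m_def[symmetric] by (simp add: norm_divide power_divide field_simps)
      qed
      moreover have "adj2 h = mat2 (1/d * (a' + (-b) * (x * l^n))) (1/d * ((-b) * (t * y * l^n)))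
          ((-b) * (z / t / l^n) / (1/d)) ((a' + (-b) * (w / l^n)) / (1/d))"
        unfolding ab(1) a'_def XYZW using d0 l0 by (simp add: field_simps flip: dd)
      ultimately have "\<exists>e. e\<^sup>2 = (1/d)\<^sup>2 \<and> mat2 e 0 0 (1/e) \<in> G"
        using N2[of n E "1/m" a' "-b"] n E1 E(1) adj2_mem[OF hG] by (simp add: XYZW)
      then show False using no'' by blast
    qed
  qed
qed

end


section \<open>Many words with equal diagonal entries\<close>

text \<open>The quotient by \<open>y\<close> of the upper right entry of \<open>u diag(r, 1/r) u diag(s, 1/s) u\<close>; exchanging \<open>r\<close> and \<open>s\<close>
  gives the quotient by \<open>z\<close> of the lower left entry.\<close>
definition word_factor :: "complex \<Rightarrow> complex \<Rightarrow> complex \<Rightarrow> complex \<Rightarrow> complex \<Rightarrow> complex \<Rightarrow> complex" where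
  "word_factor x y z w r s = x\<^sup>2 * (r * s) + x * w * (r / s) + y * z * (s / r) + w\<^sup>2 / (r * s)"

text \<open>The diagonal entries are symmetric in \<open>r\<close> and \<open>s\<close>, whereas the off-diagonal entries exchange their factors,
  so the reversed word differs by a multiplier. The parameter \<open>t\<close> passes from \<open>u\<close> to the word unchanged.\<close>
lemma word_entries:
  assumes "r \<noteq> 0" "s \<noteq> 0" "t \<noteq> 0"
  shows "mat2 x (t * y) (z / t) w ** mat2 r 0 0 (1/r) ** mat2 x (t * y) (z / t) w ** mat2 s 0 0 (1/s) ** mat2 x (t * y) (z / t) w
    = mat2 (x^3 * (r * s) + x * y * z * (r / s + s / r) + y * z * w / (r * s))
        (t * (y * word_factor x y z w r s)) (z * word_factor x y z w s r / t)
        (w^3 / (r * s) + y * z * w * (r / s + s / r) + x * y * z * (r * s))"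
  using assms by (simp add: word_factor_def field_simps power2_eq_square power3_eq_cube)

text \<open>Both factors are dominated by \<open>x\<^sup>2 r s\<close>, so their quotient tends to 1. Their difference is
  \<open>(x w - y z) (s/r - r/s) = l - 1/l\<close>, so the quotient is never 1.\<close>
lemma eventually_good_word:
  fixes x y z w l :: complex
  assumes l: "cmod l > 1" and x: "x \<noteq> 0" and dt: "x * w - y * z = 1"
  defines "\<alpha> \<equiv> \<lambda>n. word_factor x y z w (l^n) (l^Suc n)" and "\<beta> \<equiv> \<lambda>n. word_factor x y z w (l^Suc n) (l^n)"
  shows "\<forall>\<^sub>F n in sequentially. \<alpha> n \<noteq> 0 \<and> \<beta> n \<noteq> 0 \<and> \<beta> n / \<alpha> n \<noteq> 1"
    and "(\<lambda>n. \<beta> n / \<alpha> n) \<longlonglongrightarrow> 1"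
    and "\<forall>\<^sub>F n in sequentially. x^3 * (l^n * l^Suc n) + x * y * z * (l^n / l^Suc n + l^Suc n / l^n) + y * z * w / (l^n * l^Suc n) \<noteq> 0"
proof -
  have l0: "l \<noteq> 0" using l by auto
  define v where "v n = 1 / (l^n * l^Suc n)" for n
  have v0: "v n \<noteq> 0" for n using l0 by (simp add: v_def)
  have v: "v \<longlonglongrightarrow> 0"
  proof -
    have "cmod (1/l) < 1" using l by (simp add: norm_divide divide_less_eq)
    then have p: "(\<lambda>n. (1/l)^n) \<longlonglongrightarrow> 0" by (rule LIMSEQ_power_zero)
    have "(\<lambda>n. (1/l)^n * (1/l)^n * (1/l)) \<longlonglongrightarrow> 0 * 0 * (1/l)"
      by (intro tendsto_mult p tendsto_const)
    then show ?thesis by (simp add: v_def[abs_def] power_one_over field_simps)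
  qed
  have q: "l^n / l^Suc n = 1/l" "l^Suc n / l^n = l" for n using l0 by simp_all
  have av: "\<alpha> n * v n = x\<^sup>2 + (x * w * (1/l) + y * z * l) * v n + w\<^sup>2 * (v n)\<^sup>2" for n
    using l0 unfolding \<alpha>_def word_factor_def q v_def by (simp add: field_simps power2_eq_square)
  have bv: "\<beta> n * v n = x\<^sup>2 + (x * w * l + y * z * (1/l)) * v n + w\<^sup>2 * (v n)\<^sup>2" for n
    using l0 unfolding \<beta>_def word_factor_def q v_def by (simp add: field_simps power2_eq_square)
  have "(\<lambda>n. \<alpha> n * v n) \<longlonglongrightarrow> x\<^sup>2 + (x * w * (1/l) + y * z * l) * 0 + w\<^sup>2 * 0\<^sup>2"
    unfolding av by (intro tendsto_intros v)
  then have la: "(\<lambda>n. \<alpha> n * v n) \<longlonglongrightarrow> x\<^sup>2" by simp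
  have "(\<lambda>n. \<beta> n * v n) \<longlonglongrightarrow> x\<^sup>2 + (x * w * l + y * z * (1/l)) * 0 + w\<^sup>2 * 0\<^sup>2"
    unfolding bv by (intro tendsto_intros v)
  then have lb: "(\<lambda>n. \<beta> n * v n) \<longlonglongrightarrow> x\<^sup>2" by simp
  have x2: "x\<^sup>2 \<noteq> 0" using x by simp
  have ea: "\<forall>\<^sub>F n in sequentially. \<alpha> n \<noteq> 0"
    using tendsto_imp_eventually_ne[OF la x2] by (rule eventually_mono) auto
  have eb: "\<forall>\<^sub>F n in sequentially. \<beta> n \<noteq> 0"
    using tendsto_imp_eventually_ne[OF lb x2] by (rule eventually_mono) auto
  have "\<beta> n - \<alpha> n = (x * w - y * z) * (l - 1/l)" for n
    unfolding \<alpha>_def \<beta>_def word_factor_def q by (simp add: algebra_simps)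
  then have ba: "\<beta> n - \<alpha> n = l - 1/l" for n using dt by simp
  have "l - 1/l \<noteq> 0"
  proof
    assume "l - 1/l = 0"
    then have "l * l = 1" using l0 by (simp add: field_simps)
    then have "cmod l * cmod l = 1" by (metis norm_mult norm_one)
    then show False using l by (simp add: less_1_mult order_less_imp_not_eq2)
  qed
  then have "\<beta> n \<noteq> \<alpha> n" for n using ba[of n] by auto
  then show "\<forall>\<^sub>F n in sequentially. \<alpha> n \<noteq> 0 \<and> \<beta> n \<noteq> 0 \<and> \<beta> n / \<alpha> n \<noteq> 1"
    using ea eb by (auto elim: eventually_elim2)
  have "(\<lambda>n. (\<beta> n * v n) / (\<alpha> n * v n)) \<longlonglongrightarrow> x\<^sup>2 / x\<^sup>2" by (intro tendsto_divide la lb x2)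
  then show "(\<lambda>n. \<beta> n / \<alpha> n) \<longlonglongrightarrow> 1" using v0 x2 by simp
  define X where "X n = x^3 * (l^n * l^Suc n) + x * y * z * (l^n / l^Suc n + l^Suc n / l^n) + y * z * w / (l^n * l^Suc n)" for n
  have Xv: "X n * v n = x^3 + x * y * z * (1/l + l) * v n + y * z * w * (v n)\<^sup>2" for n
    using l0 unfolding X_def q v_def by (simp add: field_simps power2_eq_square)
  have "(\<lambda>n. X n * v n) \<longlonglongrightarrow> x^3 + x * y * z * (1/l + l) * 0 + y * z * w * 0\<^sup>2"
    unfolding Xv by (intro tendsto_intros v)
  then have lX: "(\<lambda>n. X n * v n) \<longlonglongrightarrow> x^3" by simp
  have "x^3 \<noteq> 0" using x by simp
  from tendsto_imp_eventually_ne[OF lX this]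
  have "\<forall>\<^sub>F n in sequentially. X n \<noteq> 0" by (rule eventually_mono) auto
  then show "\<forall>\<^sub>F n in sequentially. x^3 * (l^n * l^Suc n) + x * y * z * (l^n / l^Suc n + l^Suc n / l^n) + y * z * w / (l^n * l^Suc n) \<noteq> 0"
    by (simp add: X_def)
qed

context discrete_SL2
begin

text \<open>For large \<open>n\<close> the new multiplier \<open>\<tau>\<close> is so close to 1, without being 1, that \<open>\<tau> P\<close> remains near 1 and is
  disjoint from the finite set \<open>P\<close>.\<close>
lemma multiplier_family_step:
  assumes l: "cmod l > 1" "mat2 l 0 0 (1/l) \<in> G"
    and nz: "x \<noteq> 0" "y \<noteq> 0" "z \<noteq> 0" and u: "mat2 x y z w \<in> G"
    and P: "finite P" "0 \<notin> P" "\<forall>t\<in>P. cmod (t - 1) < \<rho> \<and> mat2 x (t * y) (z / t) w \<in> G"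
  obtains x' y' z' w' P' where "x' \<noteq> 0" "y' \<noteq> 0" "z' \<noteq> 0" "mat2 x' y' z' w' \<in> G"
    "finite P'" "0 \<notin> P'" "card P' = 2 * card P"
    "\<forall>t\<in>P'. cmod (t - 1) < \<rho> \<and> mat2 x' (t * y') (z' / t) w' \<in> G"
proof -
  have l0: "l \<noteq> 0" using l by auto
  have dt: "x * w - y * z = 1" using det_1[OF u] by simp
  define \<alpha> where "\<alpha> n = word_factor x y z w (l^n) (l^Suc n)" for n
  define \<beta> where "\<beta> n = word_factor x y z w (l^Suc n) (l^n)" for n
  define X where "X n = x^3 * (l^n * l^Suc n) + x * y * z * (l^n / l^Suc n + l^Suc n / l^n) + y * z * w / (l^n * l^Suc n)" for n
  define W where "W n = w^3 / (l^n * l^Suc n) + y * z * w * (l^n / l^Suc n + l^Suc n / l^n) + x * y * z * (l^n * l^Suc n)" for n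
  note good = eventually_good_word[OF l(1) nz(1) dt, folded \<alpha>_def \<beta>_def X_def]
  have near: "\<forall>\<^sub>F n in sequentially. cmod (\<beta> n / \<alpha> n * t - 1) < \<rho>" if "t \<in> P" for t
  proof -
    have "(\<lambda>n. cmod (\<beta> n / \<alpha> n * t - 1)) \<longlonglongrightarrow> cmod (1 * t - 1)"
      by (intro tendsto_intros good(2))
    then show ?thesis using P(3) that by (intro order_tendstoD(2)) auto
  qed
  have apart: "\<forall>\<^sub>F n in sequentially. \<beta> n / \<alpha> n * t \<noteq> s" if ts: "t \<in> P" "s \<in> P" for t s
  proof (cases "s = t")
    case True
    show ?thesis using good(1)
    proof (rule eventually_mono)
      fix n assume n: "\<alpha> n \<noteq> 0 \<and> \<beta> n \<noteq> 0 \<and> \<beta> n / \<alpha> n \<noteq> 1"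
      have "t \<noteq> 0" using ts P(2) by auto
      then show "\<beta> n / \<alpha> n * t \<noteq> s" using n True by (metis mult_cancel_right1)
    qed
  next
    case False
    have "(\<lambda>n. \<beta> n / \<alpha> n * t) \<longlonglongrightarrow> 1 * t" by (intro tendsto_intros good(2))
    then show ?thesis by (rule tendsto_imp_eventually_ne) (use False in auto)
  qed
  have "\<forall>\<^sub>F n in sequentially. \<forall>t\<in>P. cmod (\<beta> n / \<alpha> n * t - 1) < \<rho> \<and> (\<forall>s\<in>P. \<beta> n / \<alpha> n * t \<noteq> s)"
    using P(1) near apart by (intro eventually_ball_finite ballI eventually_conj) auto
  from eventually_conj[OF this eventually_conj[OF good(1,3)]]
  obtain n where n: "\<And>t. t \<in> P \<Longrightarrow> cmod (\<beta> n / \<alpha> n * t - 1) < \<rho>" "\<And>t s. t \<in> P \<Longrightarrow> s \<in> P \<Longrightarrow> \<beta> n / \<alpha> n * t \<noteq> s"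
      "\<alpha> n \<noteq> 0" "\<beta> n \<noteq> 0" "X n \<noteq> 0"
    by (auto simp: eventually_sequentially)
  define \<tau> where "\<tau> = \<beta> n / \<alpha> n"
  have \<tau>0: "\<tau> \<noteq> 0" using n by (simp add: \<tau>_def)
  have B: "mat2 (l^k) 0 0 (1/l^k) \<in> G" for k by (rule diag_power_mem[OF l(2)])
  have ln: "l^n \<noteq> 0" "l^Suc n \<noteq> 0" using l0 by auto
  have word: "mat2 (X n) (t * (y * \<alpha> n)) (z * \<beta> n / t) (W n) \<in> G"
    and word': "mat2 (X n) (t * (y * \<beta> n)) (z * \<alpha> n / t) (W n) \<in> G"
    if "t \<noteq> 0" "mat2 x (t * y) (z / t) w \<in> G" for t
  proof -
    let ?u = "mat2 x (t * y) (z / t) w"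
    have "?u ** mat2 (l^n) 0 0 (1/l^n) ** ?u ** mat2 (l^Suc n) 0 0 (1/l^Suc n) ** ?u \<in> G"
      "?u ** mat2 (l^Suc n) 0 0 (1/l^Suc n) ** ?u ** mat2 (l^n) 0 0 (1/l^n) ** ?u \<in> G"
      by (intro mult_mem that B)+
    then show "mat2 (X n) (t * (y * \<alpha> n)) (z * \<beta> n / t) (W n) \<in> G" "mat2 (X n) (t * (y * \<beta> n)) (z * \<alpha> n / t) (W n) \<in> G"
      unfolding word_entries[OF ln that(1)] word_entries[OF ln(2,1) that(1)] X_def W_def \<alpha>_def \<beta>_def
      by (simp_all only: mult.commute[of "l^n" "l^Suc n"] add.commute[of "l^n / l^Suc n"])
  qed
  \<comment> \<open>\<open>P\<close> acts on the word as it did on \<open>u\<close>, and \<open>\<tau> P\<close> leads to the reversed words.\<close>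
  define P' where "P' = P \<union> (\<lambda>t. \<tau> * t) ` P"
  show ?thesis
  proof (rule that[of "X n" "y * \<alpha> n" "z * \<beta> n" "W n" P'])
    show "X n \<noteq> 0" "y * \<alpha> n \<noteq> 0" "z * \<beta> n \<noteq> 0" using n nz by auto
    show "mat2 (X n) (y * \<alpha> n) (z * \<beta> n) (W n) \<in> G" using word[of 1] u by simp
    show "finite P'" "0 \<notin> P'" using P \<tau>0 by (auto simp: P'_def)
    have "inj_on (\<lambda>t. \<tau> * t) P" using \<tau>0 by (auto simp: inj_on_def)
    moreover have "P \<inter> (\<lambda>t. \<tau> * t) ` P = {}" using n(2) by (auto simp: \<tau>_def)
    ultimately show "card P' = 2 * card P" unfolding P'_def using P(1) by (simp add: card_Un_disjoint card_image)
    show "\<forall>t\<in>P'. cmod (t - 1) < \<rho> \<and> mat2 (X n) (t * (y * \<alpha> n)) (z * \<beta> n / t) (W n) \<in> G"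
    proof
      fix t assume "t \<in> P'"
      then consider "t \<in> P" | s where "s \<in> P" "t = \<tau> * s" by (auto simp: P'_def)
      then show "cmod (t - 1) < \<rho> \<and> mat2 (X n) (t * (y * \<alpha> n)) (z * \<beta> n / t) (W n) \<in> G"
      proof cases
        case 1
        then show ?thesis using P word[of t] by auto
      next
        case 2
        have "s \<noteq> 0" using 2 P by auto
        then have "mat2 (X n) (s * (y * \<beta> n)) (z * \<alpha> n / s) (W n) \<in> G" using word'[of s] 2 P by auto
        moreover have "t * (y * \<alpha> n) = s * (y * \<beta> n)" "z * \<beta> n / t = z * \<alpha> n / s"
          using n(3,4) \<open>s \<noteq> 0\<close> unfolding 2 \<tau>_def by simp_all
        ultimately show ?thesis using n(1)[OF 2(1)] 2 by (simp add: \<tau>_def)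
      qed
    qed
  qed
qed

lemma multiplier_family:
  assumes l: "cmod l > 1" "mat2 l 0 0 (1/l) \<in> G"
    and nz: "x \<noteq> 0" "y \<noteq> 0" "z \<noteq> 0" and u: "mat2 x y z w \<in> G" and \<rho>: "\<rho> > 0"
  shows "\<exists>x y z w P. x \<noteq> 0 \<and> y \<noteq> 0 \<and> z \<noteq> 0 \<and> mat2 x y z w \<in> G \<and> finite P \<and> 0 \<notin> P \<and> card P = 2^k \<and>
    (\<forall>t\<in>P. cmod (t - 1) < \<rho> \<and> mat2 x (t * y) (z / t) w \<in> G)"
proof (induction k)
  case 0
  show ?case using nz u \<rho> by (intro exI[of _ x] exI[of _ y] exI[of _ z] exI[of _ w] exI[of _ "{1}"]) simp
next
  case (Suc k)
  then obtain x y z w P where *: "x \<noteq> 0" "y \<noteq> 0" "z \<noteq> 0" "mat2 x y z w \<in> G" "finite P" "0 \<notin> P" "card P = 2^k"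
    "\<forall>t\<in>P. cmod (t - 1) < \<rho> \<and> mat2 x (t * y) (z / t) w \<in> G" by blast
  from multiplier_family_step[OF l *(1-6) *(8)]
  show ?case unfolding *(7) by (metis power_Suc)
qed

lemma diagonal_near_one:
  obtains \<eta> where "\<eta> > 0" "\<And>d. mat2 d 0 0 (1/d) \<in> G \<Longrightarrow> d \<noteq> 0 \<Longrightarrow> cmod (d\<^sup>2 - 1) < \<eta> \<Longrightarrow> d\<^sup>2 = 1"
proof -
  define S where "S = insert (1/2) ((\<lambda>A. cmod ((A$1$1)\<^sup>2 - 1)) ` {A \<in> G. \<forall>i j. cmod (A$i$j) \<le> 2} - {0})"
  have S: "finite S" "S \<noteq> {}" unfolding S_def using finite_bounded by auto
  have "0 < s" if "s \<in> S" for s using that by (auto simp: S_def)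
  then have pos: "Min S > 0" using S Min_in by blast
  have half: "Min S \<le> 1/2" using S(1) by (rule Min_le) (simp add: S_def)
  have "d\<^sup>2 = 1" if d: "mat2 d 0 0 (1/d) \<in> G" "d \<noteq> 0" "cmod (d\<^sup>2 - 1) < Min S" for d
  proof (rule ccontr)
    assume ne: "d\<^sup>2 \<noteq> 1"
    have c: "cmod (d\<^sup>2 - 1) < 1/2" using d(3) half by linarith
    have "cmod (d\<^sup>2) \<le> 4" "cmod (d\<^sup>2) \<ge> 1/4"
      using c norm_triangle_ineq2[of "d\<^sup>2" 1] norm_triangle_ineq2[of 1 "1 - d\<^sup>2"] norm_minus_commute[of "d\<^sup>2" 1] by auto
    then have "(cmod d)\<^sup>2 \<le> 2\<^sup>2" "(1/2)\<^sup>2 \<le> (cmod d)\<^sup>2" by (simp_all add: norm_power power2_eq_square norm_mult)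
    then have "cmod d \<le> 2" "1/2 \<le> cmod d" by (meson norm_ge_zero power2_le_imp_le zero_le_numeral, meson norm_ge_zero power2_le_imp_le)
    then have "cmod (mat2 d 0 0 (1/d) $ i $ j) \<le> 2" for i j
      using exhaust_2[of i] exhaust_2[of j] d(2) by (auto simp: norm_divide divide_le_eq)
    then have "cmod (d\<^sup>2 - 1) \<in> S" using d(1) ne unfolding S_def by force
    then show False using Min_le[OF S(1)] d(3) by fastforce
  qed
  then show ?thesis using pos that by blast
qed

text \<open>If two multipliers \<open>s\<close> and \<open>t\<close> gave conjugate words for arbitrarily large \<open>n\<close>, then \<open>t / s\<close> would be \<open>e\<^sup>2\<close> for
  some \<open>diag(e, 1/e)\<close> in \<open>G\<close>; being close to 1 it would equal 1. As there are finitely many pairs, one \<open>n\<close>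
  serves all of them.\<close>
lemma many_nonconjugate_equal_trace:
  assumes l: "cmod l > 1" "mat2 l 0 0 (1/l) \<in> G"
    and nz: "x \<noteq> 0" "y \<noteq> 0" "z \<noteq> 0" and u: "mat2 x y z w \<in> G"
  obtains S tr where "S \<subseteq> G" "finite S" "card S = 2^k" "\<And>A. A \<in> S \<Longrightarrow> trace A = tr" "cmod tr > 2"
    "\<And>A B g. A \<in> S \<Longrightarrow> B \<in> S \<Longrightarrow> A \<noteq> B \<Longrightarrow> g \<in> G \<Longrightarrow> g ** A \<noteq> B ** g"
proof -
  have l0: "l \<noteq> 0" using l by auto
  obtain \<eta> where \<eta>: "\<eta> > 0" "\<And>d. mat2 d 0 0 (1/d) \<in> G \<Longrightarrow> d \<noteq> 0 \<Longrightarrow> cmod (d\<^sup>2 - 1) < \<eta> \<Longrightarrow> d\<^sup>2 = 1"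
    using diagonal_near_one by blast
  \<comment> \<open>Two numbers within \<open>\<rho>\<close> of 1 have a quotient within \<open>\<eta>\<close> of 1.\<close>
  define \<rho> where "\<rho> = min (1/2) (\<eta> / 4)"
  have \<rho>: "\<rho> > 0" using \<eta> by (simp add: \<rho>_def)
  obtain x y z w P where xyz: "x \<noteq> 0" "y \<noteq> 0" "z \<noteq> 0" and u: "mat2 x y z w \<in> G" and P: "finite P" "0 \<notin> P" "card P = 2^k"
    "\<And>t. t \<in> P \<Longrightarrow> cmod (t - 1) < \<rho>" "\<And>t. t \<in> P \<Longrightarrow> mat2 x (t * y) (z / t) w \<in> G"
    using multiplier_family[OF l nz u \<rho>, of k] by blast
  have ex: "\<exists>N. \<forall>n\<ge>N. \<forall>g\<in>G. g ** (mat2 (l^n) 0 0 (1/l^n) ** mat2 x (s * y) (z / s) w)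
      \<noteq> mat2 (l^n) 0 0 (1/l^n) ** mat2 x (t * y) (z / t) w ** g" if st: "s \<in> P" "t \<in> P" "s \<noteq> t" for s t
  proof -
    have s0: "s \<noteq> 0" "t \<noteq> 0" using st P by auto
    have "1/2 \<le> cmod s" using P(4)[OF st(1)] norm_triangle_ineq2[of 1 "1 - s"] norm_minus_commute[of s 1] by (simp add: \<rho>_def)
    have no: "\<not> (\<exists>e. e\<^sup>2 = t / s \<and> mat2 e 0 0 (1/e) \<in> G)"
    proof
      assume "\<exists>e. e\<^sup>2 = t / s \<and> mat2 e 0 0 (1/e) \<in> G"
      then obtain e where e: "e\<^sup>2 = t / s" "mat2 e 0 0 (1/e) \<in> G" by blast
      have e0: "e \<noteq> 0" using e(1) s0 by auto
      have "cmod (t - s) \<le> cmod (t - 1) + cmod (s - 1)" using norm_triangle_ineq4[of "t - 1" "s - 1"] by simp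
      also have "\<dots> < \<eta> / 2" using P(4)[OF st(1)] P(4)[OF st(2)] by (simp add: \<rho>_def)
      also have "\<dots> \<le> \<eta> * cmod s" using \<open>1/2 \<le> cmod s\<close> \<eta>(1) by simp
      finally have "cmod (t - s) / cmod s < \<eta>" using s0 by (simp add: divide_less_eq)
      moreover have "e\<^sup>2 - 1 = (t - s) / s" unfolding e(1) using s0 by (simp add: field_simps)
      ultimately have "cmod (e\<^sup>2 - 1) < \<eta>" by (simp add: norm_divide)
      then have "t / s = 1" using \<eta>(2)[OF e(2) e0] e(1) by simp
      then show False using st s0 by simp
    qed
    have sy: "s * y \<noteq> 0" "t / s \<noteq> 0" using s0 xyz by auto
    have eq: "t / s * (s * y) = t * y" "z / s / (t / s) = z / t" using s0 by simp_all
    obtain N where "\<And>n g. n \<ge> N \<Longrightarrow> g \<in> G \<Longrightarrow> g ** (mat2 (l^n) 0 0 (1/l^n) ** mat2 x (s * y) (z / s) w)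
       \<noteq> mat2 (l^n) 0 0 (1/l^n) ** mat2 x (t / s * (s * y)) (z / s / (t / s)) w ** g"
      using long_words_not_conjugate[OF l xyz(1) sy P(5)[OF st(1)] _ no] P(5)[OF st(2)] unfolding eq by blast
    then show ?thesis unfolding eq by blast
  qed
  have fin: "finite {(s, t). s \<in> P \<and> t \<in> P \<and> s \<noteq> t}"
    by (rule finite_subset[of _ "P \<times> P"]) (use P(1) in auto)
  have ev: "\<forall>\<^sub>F n in sequentially. \<forall>p\<in>{(s, t). s \<in> P \<and> t \<in> P \<and> s \<noteq> t}. \<forall>g\<in>G.
      g ** (mat2 (l^n) 0 0 (1/l^n) ** mat2 x (fst p * y) (z / fst p) w)
      \<noteq> mat2 (l^n) 0 0 (1/l^n) ** mat2 x (snd p * y) (z / snd p) w ** g"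
    by (rule eventually_ball_finite[OF fin]) (use ex in \<open>auto simp: eventually_sequentially\<close>)
  have "\<forall>\<^sub>F n in sequentially. cmod (x * l^n + w / l^n) > 2"
  proof -
    obtain N where N: "(cmod w + 2) / cmod x < cmod l^N" using real_arch_pow[OF l(1)] by blast
    have "cmod (x * l^n + w / l^n) > 2" if n: "n \<ge> N" for n
    proof -
      have L: "cmod l^N \<le> cmod l^n" "1 \<le> cmod l^n" using n l(1) by (auto intro: power_increasing)
      have "cmod (w / l^n) \<le> cmod w"
        using L(2) l0 by (simp add: norm_divide norm_power divide_le_eq mult_le_cancel_left1)
      moreover have "cmod w + 2 < cmod x * cmod l^N" using N xyz by (simp add: field_simps)
      then have "cmod w + 2 < cmod (x * l^n)"
        using mult_left_mono[OF L(1), of "cmod x"] by (simp add: norm_mult norm_power)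
      ultimately show ?thesis using norm_triangle_ineq2[of "x * l^n" "- (w / l^n)"] by simp
    qed
    then show ?thesis by (auto simp: eventually_sequentially)
  qed
  from eventually_conj[OF this ev] obtain n where
    n: "cmod (x * l^n + w / l^n) > 2" and nc: "\<And>s t g. s \<in> P \<Longrightarrow> t \<in> P \<Longrightarrow> s \<noteq> t \<Longrightarrow> g \<in> G \<Longrightarrow>
      g ** (mat2 (l^n) 0 0 (1/l^n) ** mat2 x (s * y) (z / s) w)
      \<noteq> mat2 (l^n) 0 0 (1/l^n) ** mat2 x (t * y) (z / t) w ** g"
    by (auto simp: eventually_sequentially)
  define f where "f t = mat2 (l^n) 0 0 (1/l^n) ** mat2 x (t * y) (z / t) w" for t
  have inj: "inj_on f P"
    using l0 xyz by (auto simp: inj_on_def f_def)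
  show ?thesis
  proof (rule that[of "f ` P" "x * l^n + w / l^n"])
    show "f ` P \<subseteq> G" unfolding f_def using P(5) diag_power_mem[OF l(2)] by (auto intro: mult_mem simp del: mat2_mult)
    show "finite (f ` P)" "card (f ` P) = 2^k" using P inj by (auto simp: card_image)
    show "trace A = x * l^n + w / l^n" if "A \<in> f ` P" for A
      using that by (auto simp: f_def mult.commute)
    show "g ** A \<noteq> B ** g" if AB: "A \<in> f ` P" "B \<in> f ` P" "A \<noteq> B" and g: "g \<in> G" for A B g
    proof -
      obtain s t where st: "s \<in> P" "t \<in> P" "A = f s" "B = f t" using AB by blast
      then have "s \<noteq> t" using AB by blast
      then show ?thesis using nc[OF st(1,2) _ g] unfolding st f_def by blast
    qed
  qed (rule n)
qed

end


section \<open>The matrix group of a Kleinian group\<close>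

definition matrix_group :: "(complex^2^2) set set \<Rightarrow> (complex^2^2) set" where
  "matrix_group \<Gamma> = {A. det A = 1 \<and> pm A \<in> \<Gamma>}"

lemma pm_matrix_group:
  assumes "Kleinian_group \<Gamma>" "\<gamma> \<in> \<Gamma>"
  obtains A where "A \<in> matrix_group \<Gamma>" "\<gamma> = pm A"
proof -
  have "\<Gamma> \<subseteq> carrier PSL2C"
    using assms unfolding Kleinian_group_def by (auto dest: subgroup.subset)
  then obtain A where "det A = 1" "\<gamma> = pm A" using assms(2) by (auto simp: carrier_PSL2C)
  then show ?thesis using that[of A] assms(2) by (simp add: matrix_group_def)
qed

lemma tendsto_mat2:
  assumes "(a \<longlongrightarrow> a') F" "(b \<longlongrightarrow> b') F" "(c \<longlongrightarrow> c') F" "(d \<longlongrightarrow> d') F"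
  shows "((\<lambda>n. mat2 (a n) (b n) (c n) (d n)) \<longlongrightarrow> mat2 a' b' c' d') F"
proof (rule vec_tendstoI, rule vec_tendstoI)
  fix i j :: 2
  show "((\<lambda>n. mat2 (a n) (b n) (c n) (d n) $ i $ j) \<longlongrightarrow> mat2 a' b' c' d' $ i $ j) F"
    using assms exhaust_2[of i] exhaust_2[of j] by auto
qed

lemma adj2_mult_mat2:
  "adj2 A ** B = mat2 (A$2$2 * B$1$1 - A$1$2 * B$2$1) (A$2$2 * B$1$2 - A$1$2 * B$2$2)
     (A$1$1 * B$2$1 - A$2$1 * B$1$1) (A$1$1 * B$2$2 - A$2$1 * B$1$2)"
  by (cases A rule: mat2_cases; cases B rule: mat2_cases) simp

lemma norm_matrix_le:
  fixes A :: "complex^2^2"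
  assumes "\<And>i j. cmod (A$i$j) \<le> R" shows "norm A \<le> 4 * R"
proof -
  have "norm A \<le> (\<Sum>i\<in>UNIV. norm (A$i))" unfolding norm_vec_def by (rule L2_set_le_sum) simp
  also have "\<dots> \<le> (\<Sum>i\<in>(UNIV::2 set). 2 * R)"
  proof (rule sum_mono)
    fix i :: 2
    have "norm (A$i) \<le> (\<Sum>j\<in>UNIV. norm (A$i$j))" unfolding norm_vec_def[of "A$i"] by (rule L2_set_le_sum) simp
    also have "\<dots> \<le> (\<Sum>j\<in>(UNIV::2 set). R)" using assms by (intro sum_mono) auto
    finally show "norm (A$i) \<le> 2 * R" by simp
  qed
  finally show ?thesis by simp
qed

lemma Kleinian_isolated:
  assumes "Kleinian_group \<Gamma>"
  obtains e where "e > 0" "\<And>A. A \<in> matrix_group \<Gamma> \<Longrightarrow> dist A (mat 1) < e \<Longrightarrow> A = mat 1 \<or> A = - mat 1"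
proof -
  have sub: "subgroup \<Gamma> PSL2C" and disc: "subtopology PSL2C_topology \<Gamma> = discrete_topology \<Gamma>"
    using assms by (auto simp: Kleinian_group_def)
  have "pm (mat 1) \<in> \<Gamma>" using subgroup.one_closed[OF sub] by (simp add: one_PSL2C)
  then have "openin (subtopology PSL2C_topology \<Gamma>) {pm (mat 1)}" unfolding disc by simp
  then obtain U where U: "openin PSL2C_topology U" "{pm (mat 1)} = U \<inter> \<Gamma>"
    by (auto simp: openin_subtopology)
  have Uc: "U \<subseteq> carrier PSL2C" and op: "openin (top_of_set (carrier SL2C)) (\<Union>U)"
    using U(1) by (auto simp: openin_PSL2C_topology)
  have "mat 1 \<in> \<Union>U" using U(2) by blast
  then obtain e where e: "e > 0" "ball (mat 1) e \<inter> carrier SL2C \<subseteq> \<Union>U"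
    using op by (simp only: openin_contains_ball) metis
  have "A = mat 1 \<or> A = - mat 1" if A: "A \<in> matrix_group \<Gamma>" "dist A (mat 1) < e" for A
  proof -
    have "A \<in> \<Union>U" using A e(2) by (auto simp: matrix_group_def SL2C_def dist_commute)
    then obtain X where X: "X \<in> U" "A \<in> X" by blast
    then obtain B where "X = pm B" using Uc by (auto simp: carrier_PSL2C)
    then have "X = pm A" using X by auto
    then have "pm A \<in> {pm (mat 1)}" unfolding U(2) using A X by (simp add: matrix_group_def)
    then have "pm A = pm (mat 1)" by (rule singletonD)
    then show ?thesis by (simp add: pm_eq_iff)
  qed
  then show ?thesis using that e(1) by blast
qed

text \<open>A sequence of distinct matrices in a bounded part of the group has a convergent subsequence \<open>g\<close>. The
  quotients of consecutive terms tend to 1, so they are \<open>\<plusminus>1\<close> from some index on. They are not 1, and two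
  successive changes of sign lead back to the same matrix.\<close>
lemma discrete_matrix_group:
  assumes K: "Kleinian_group \<Gamma>"
  shows "discrete_SL2 (matrix_group \<Gamma>)"
proof
  let ?G = "matrix_group \<Gamma>"
  have sub: "subgroup \<Gamma> PSL2C" using K by (simp add: Kleinian_group_def)
  show "det A = 1" if "A \<in> ?G" for A using that by (simp add: matrix_group_def)
  show "mat 1 \<in> ?G" using subgroup.one_closed[OF sub] by (simp add: one_PSL2C matrix_group_def)
  show mult: "A ** B \<in> ?G" if "A \<in> ?G" "B \<in> ?G" for A B
    using that subgroup.m_closed[OF sub, of "pm A" "pm B"] by (simp add: matrix_group_def pm_mult det_mul)
  show adj: "adj2 A \<in> ?G" if "A \<in> ?G" for A
    using that subgroup.m_inv_closed[OF sub, of "pm A"] by (simp add: matrix_group_def inv_pm)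
  show "- A \<in> ?G" if "A \<in> ?G" for A
    using that by (simp add: matrix_group_def det_uminus_2 insert_commute)
  fix R
  obtain e where e: "e > 0" "\<And>A. A \<in> ?G \<Longrightarrow> dist A (mat 1) < e \<Longrightarrow> A = mat 1 \<or> A = - mat 1"
    using Kleinian_isolated[OF K] by blast
  define S where "S = {A \<in> ?G. \<forall>i j. cmod (A$i$j) \<le> R}"
  show "finite {A \<in> ?G. \<forall>i j. cmod (A$i$j) \<le> R}"
  proof (rule ccontr)
    assume "infinite {A \<in> ?G. \<forall>i j. cmod (A$i$j) \<le> R}"
    then obtain f :: "nat \<Rightarrow> complex^2^2" where f: "inj f" "range f \<subseteq> S"
      unfolding S_def using infinite_countable_subset by blast
    have "bounded (range f)" unfolding bounded_iff
      by (rule exI[of _ "4 * R"]) (use f(2) norm_matrix_le in \<open>force simp: S_def\<close>)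
    then obtain L r where r: "strict_mono r" "(f \<circ> r) \<longlonglongrightarrow> L"
      using bounded_imp_convergent_subsequence by blast
    define g where "g = f \<circ> r"
    have gL: "g \<longlonglongrightarrow> L" using r by (simp add: g_def)
    have gS: "g n \<in> ?G" for n using f(2) by (auto simp: g_def S_def)
    have ginj: "inj g" unfolding g_def using f(1) r(1) by (intro inj_compose) (simp_all add: strict_mono_imp_inj_on)
    have nth: "(\<lambda>n. g n $ i $ j) \<longlonglongrightarrow> L $ i $ j" for i j
      by (intro tendsto_vec_nth gL)
    have nth_Suc: "(\<lambda>n. g (Suc n) $ i $ j) \<longlonglongrightarrow> L $ i $ j" for i j
      using nth by (rule LIMSEQ_Suc)
    have "(\<lambda>n. g n$1$1 * g n$2$2 - g n$1$2 * g n$2$1) \<longlonglongrightarrow> L$1$1 * L$2$2 - L$1$2 * L$2$1"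
      by (intro tendsto_intros nth)
    moreover have "g n$1$1 * g n$2$2 - g n$1$2 * g n$2$1 = 1" for n
      using gS[of n] by (simp add: matrix_group_def det_2)
    ultimately have dL: "det L = 1" by (simp add: det_2 LIMSEQ_const_iff)
    have "(\<lambda>n. adj2 (g n) ** g (Suc n)) \<longlonglongrightarrow> adj2 L ** L"
      unfolding adj2_mult_mat2 by (intro tendsto_mat2 tendsto_diff tendsto_mult nth nth_Suc)
    then have "(\<lambda>n. adj2 (g n) ** g (Suc n)) \<longlonglongrightarrow> mat 1" using dL by (simp add: adj2_inverse)
    then have "\<forall>\<^sub>F n in sequentially. dist (adj2 (g n) ** g (Suc n)) (mat 1) < e"
      using e(1) by (rule tendstoD)
    then obtain N where N: "\<And>n. n \<ge> N \<Longrightarrow> dist (adj2 (g n) ** g (Suc n)) (mat 1) < e"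
      by (auto simp: eventually_sequentially)
    have step: "g (Suc n) = - g n" if "n \<ge> N" for n
    proof -
      have "adj2 (g n) ** g (Suc n) = mat 1 \<or> adj2 (g n) ** g (Suc n) = - mat 1"
        using e(2)[OF mult[OF adj[OF gS] gS] N[OF that]] .
      then have "g n ** (adj2 (g n) ** g (Suc n)) = g n \<or> g n ** (adj2 (g n) ** g (Suc n)) = - g n"
        by (auto simp: matrix_mul_uminus)
      moreover have "g n ** (adj2 (g n) ** g (Suc n)) = g (Suc n)"
        using gS[of n] by (simp add: matrix_mul_assoc adj2_inverse matrix_group_def)
      moreover have "g (Suc n) \<noteq> g n" using injD[OF ginj, of "Suc n" n] by auto
      ultimately show ?thesis by auto
    qed
    have "g (Suc (Suc N)) = g N" using step[of N] step[of "Suc N"] by simp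
    then show False using injD[OF ginj, of "Suc (Suc N)" N] by simp
  qed
qed

lemma matrix_mult_entry_bound:
  fixes A B :: "complex^2^2"
  assumes "\<And>i j. cmod (A$i$j) \<le> a" "\<And>i j. cmod (B$i$j) \<le> b"
  shows "cmod ((A ** B)$i$j) \<le> 2 * (a * b)"
proof -
  have "a \<ge> 0" using assms(1) norm_ge_zero order_trans by blast
  then have "cmod (A$i$k * B$k$j) \<le> a * b" for k
    unfolding norm_mult using assms by (intro mult_mono) auto
  from add_mono[OF this[of 1] this[of 2]] show ?thesis
    unfolding matrix_matrix_mult_def by (simp add: sum_2) (meson norm_triangle_ineq order_trans)
qed

text \<open>Used only for \<open>P\<close> of determinant 1, where it is \<open>P\<inverse> G P\<close>.\<close>
definition conj_group :: "complex^2^2 \<Rightarrow> (complex^2^2) set \<Rightarrow> (complex^2^2) set" where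
  "conj_group P G = (\<lambda>A. adj2 P ** A ** P) ` G"

lemma mem_conj_group:
  assumes "det P = 1"
  shows "B \<in> conj_group P G \<longleftrightarrow> P ** B ** adj2 P \<in> G"
  unfolding conj_group_def using conj_eq_iff[OF assms] by (metis (no_types, lifting) image_iff)

lemma conj_mult:
  assumes "det P = 1"
  shows "P ** (A ** B) ** adj2 P = (P ** A ** adj2 P) ** (P ** B ** adj2 P)"
proof -
  have "(P ** A ** adj2 P) ** (P ** B ** adj2 P) = P ** A ** (adj2 P ** P) ** B ** adj2 P"
    by (simp only: matrix_mul_assoc)
  then show ?thesis using assms by (simp add: adj2_inverse matrix_mul_assoc)
qed

lemma discrete_conj_group:
  assumes "discrete_SL2 G" and P: "det P = 1"
  shows "discrete_SL2 (conj_group P G)"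
proof -
  interpret discrete_SL2 G by fact
  note mem = mem_conj_group[OF P]
  show ?thesis
  proof
    fix A assume A: "A \<in> conj_group P G"
    show "det A = 1" using det_1[of "P ** A ** adj2 P"] A P unfolding mem by (simp add: det_mul)
    show "A ** B \<in> conj_group P G" if "B \<in> conj_group P G" for B
      using A that unfolding mem conj_mult[OF P] by (rule mult_mem)
    have "adj2 (P ** A ** adj2 P) = P ** adj2 A ** adj2 P" by (simp add: adj2_mult matrix_mul_assoc)
    then show "adj2 A \<in> conj_group P G" using A adj2_mem unfolding mem by metis
    show "- A \<in> conj_group P G" using A uminus_mem unfolding mem by (auto simp: matrix_mul_uminus)
  next
    show "mat 1 \<in> conj_group P G" unfolding mem using P one_mem by (simp add: adj2_inverse)
  next
    fix R :: real
    define M where "M = norm P + norm (adj2 P)"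
    have M: "cmod (P$i$j) \<le> M" "cmod (adj2 P$i$j) \<le> M" for i j
      using order_trans[OF Finite_Cartesian_Product.norm_nth_le[of "P$i" j] Finite_Cartesian_Product.norm_nth_le[of P i]]
        order_trans[OF Finite_Cartesian_Product.norm_nth_le[of "adj2 P$i" j] Finite_Cartesian_Product.norm_nth_le[of "adj2 P" i]]
        norm_ge_zero[of P] norm_ge_zero[of "adj2 P"] unfolding M_def by linarith+
    have "{A \<in> conj_group P G. \<forall>i j. cmod (A$i$j) \<le> R}
        \<subseteq> (\<lambda>A. adj2 P ** A ** P) ` {A \<in> G. \<forall>i j. cmod (A$i$j) \<le> 2 * (2 * (M * R) * M)}"
    proof
      fix A assume "A \<in> {A \<in> conj_group P G. \<forall>i j. cmod (A$i$j) \<le> R}"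
      then have A: "P ** A ** adj2 P \<in> G" "\<And>i j. cmod (A$i$j) \<le> R" by (auto simp: mem)
      have "cmod ((P ** A ** adj2 P)$i$j) \<le> 2 * (2 * (M * R) * M)" for i j
        by (intro matrix_mult_entry_bound M A)
      then show "A \<in> (\<lambda>A. adj2 P ** A ** P) ` {A \<in> G. \<forall>i j. cmod (A$i$j) \<le> 2 * (2 * (M * R) * M)}"
        using A(1) conj_eq_iff[OF P, of "P ** A ** adj2 P" A] by (intro image_eqI[of _ _ "P ** A ** adj2 P"]) auto
    qed
    then show "finite {A \<in> conj_group P G. \<forall>i j. cmod (A$i$j) \<le> R}"
      using finite_bounded finite_subset by blast
  qed
qed

section \<open>Elliptic elements\<close>

text \<open>If \<open>c \<noteq> 0\<close>, the fixed point lies over the midpoint of the two fixed points of the Moebius transformation,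
  at the height that makes the denominator of the Poincare extension equal to 1. If \<open>c = 0\<close>, the diagonal
  entries have absolute value 1 and the rotation axis is vertical.\<close>
lemma elliptic_fixed_point:
  assumes A: "det A = 1" "trace A = complex_of_real \<tau>" and \<tau>: "\<tau>\<^sup>2 < 4"
  obtains p where "p \<in> H3" "SL2C_act A p = p"
proof -
  obtain a b c d where A': "A = mat2 a b c d" by (rule mat2_cases)
  have dt: "a * d - b * c = 1" and tr: "a + d = complex_of_real \<tau>" using A by (auto simp: A')
  show ?thesis
  proof (cases "c = 0")
    case False
    define z where "z = (a - d) / (2 * c)"
    define t where "t = sqrt (4 - \<tau>\<^sup>2) / (2 * cmod c)"
    have t: "t > 0" using \<tau> False by (simp add: t_def)
    have cz: "c * z + d = complex_of_real (\<tau> / 2)"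
    proof -
      have "c * z + d = (a + d) / 2" using False by (simp add: z_def field_simps)
      then show ?thesis using tr by simp
    qed
    have ct: "(cmod c)\<^sup>2 * t\<^sup>2 = 1 - \<tau>\<^sup>2 / 4"
      using False \<tau> by (simp add: t_def power_divide power_mult_distrib field_simps)
    have r: "(cmod (c * z + d))\<^sup>2 + (cmod c)\<^sup>2 * t\<^sup>2 = 1"
      unfolding cz ct norm_of_real by (simp add: power_divide)
    have cc: "c * (cnj c * complex_of_real (t\<^sup>2)) = 1 - complex_of_real \<tau> * complex_of_real \<tau> / 4"
    proof -
      have "c * (cnj c * complex_of_real (t\<^sup>2)) = complex_of_real ((cmod c)\<^sup>2 * t\<^sup>2)"
        unfolding of_real_mult complex_norm_square by (simp add: mult.assoc)
      then show ?thesis unfolding ct by (simp add: power2_eq_square)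
    qed
    have "c * ((a * z + b) * cnj (c * z + d) + a * cnj c * complex_of_real (t\<^sup>2))
       = (a * (c * z + d) - 1) * complex_of_real (\<tau> / 2) + a * (c * (cnj c * complex_of_real (t\<^sup>2)))"
    proof -
      have e1: "c * (a * z + b) = a * (c * z + d) - 1" using dt by algebra
      have e2: "c * ((a * z + b) * h + a * cnj c * s) = (c * (a * z + b)) * h + a * (c * (cnj c * s))" for h s
        by (simp add: algebra_simps)
      show ?thesis unfolding cz complex_cnj_complex_of_real e2 e1 ..
    qed
    also have "\<dots> = a - complex_of_real \<tau> / 2" unfolding cz cc by (simp add: algebra_simps)
    also have "\<dots> = c * z" using False by (simp add: z_def field_simps flip: tr)
    finally have "(a * z + b) * cnj (c * z + d) + a * cnj c * complex_of_real (t\<^sup>2) = z"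
      using False by simp
    then have "SL2C_act A (z, t) = (z, t)" unfolding A' SL2C_act_mat2 Let_def r by simp
    then show ?thesis using that[of "(z, t)"] t by (simp add: H3_def)
  next
    case True
    have ad: "a * d = 1" using dt True by simp
    then have a0: "a \<noteq> 0" "d \<noteq> 0" by auto
    have d: "d = 1 / a" using ad a0 by (simp add: field_simps)
    have "Im (a + 1/a) = 0" "Re (a + 1/a) = \<tau>" using tr d by simp_all
    have ca: "cmod a = 1"
    proof (rule ccontr)
      assume n1: "cmod a \<noteq> 1"
      define q where "q = (cmod a)\<^sup>2"
      have q: "q > 0" "q \<noteq> 1" using a0 n1 by (simp_all add: q_def abs_square_eq_1)
      have inv: "1 / a = cnj a / of_real q" unfolding q_def using a0 unfolding complex_norm_square by simp
      have "Im a * (1 - 1 / q) = 0" using \<open>Im (a + 1/a) = 0\<close> unfolding inv by (simp add: field_simps)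
      then have "Im a = 0" using q by simp
      then have "q = (Re a)\<^sup>2" by (simp add: q_def cmod_power2)
      have "\<tau> = Re a + Re a / q" using \<open>Re (a + 1/a) = \<tau>\<close> unfolding inv by simp
      then have "\<tau>\<^sup>2 = q + 2 + 1 / q"
      proof -
        have "\<tau> = Re a * (1 + 1 / q)" using \<open>\<tau> = Re a + Re a / q\<close> by (simp add: algebra_simps)
        then have "\<tau>\<^sup>2 = q * (1 + 1 / q)\<^sup>2" using \<open>q = (Re a)\<^sup>2\<close> by (simp add: power_mult_distrib)
        moreover have "q * (1 + 1 / q)\<^sup>2 = q + 2 + 1 / q" using q(1) by (simp add: field_simps power2_eq_square)
        ultimately show ?thesis by simp
      qed
      moreover have "(q - 1)\<^sup>2 / q \<ge> 0" using q by simp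
      then have "q + 1 / q \<ge> 2" using q by (simp add: field_simps power2_eq_square)
      ultimately show False using \<tau> by simp
    qed
    have ne: "a \<noteq> d"
    proof
      assume "a = d"
      then have "a * a = 1" using ad by simp
      then have "(complex_of_real \<tau>)\<^sup>2 = 4" using tr \<open>a = d\<close> by (simp add: power2_eq_square flip: tr)
      then have "\<tau>\<^sup>2 = 4" by (metis of_real_eq_iff of_real_numeral of_real_power)
      then show False using \<tau> by simp
    qed
    define z where "z = b / (d - a)"
    have "a * z + b = d * z" using ne by (simp add: z_def field_simps)
    then have "(a * z + b) * cnj d = z * (d * cnj d)" by simp
    moreover have "cmod d = 1" using ca by (simp add: d norm_divide)
    then have "d * cnj d = 1" by (metis complex_norm_square of_real_1 power_one)
    ultimately have "SL2C_act A (z, 1) = (z, 1)" unfolding A' SL2C_act_mat2 Let_def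
      using True \<open>cmod d = 1\<close> by simp
    then show ?thesis using that[of "(z, 1)"] by (simp add: H3_def)
  qed
qed


section \<open>Hyperbolic volume\<close>

text \<open>The change of variables formula is applied in \<open>real^3\<close>.\<close>
definition to_real3 :: "complex \<times> real \<Rightarrow> real^3" where
  "to_real3 p = vector [Re (fst p), Im (fst p), snd p]"

definition of_real3 :: "real^3 \<Rightarrow> complex \<times> real" where
  "of_real3 v = (Complex (v$1) (v$2), v$3)"

lemma to_of_real3 [simp]: "to_real3 (of_real3 v) = v" "of_real3 (to_real3 p) = p"
  by (simp_all add: to_real3_def of_real3_def vec_eq_iff forall_3 prod_eq_iff complex_eq_iff)

lemma of_real3_measurable [measurable]: "of_real3 \<in> borel_measurable borel"
proof -
  have "continuous_on UNIV of_real3"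
    unfolding of_real3_def[abs_def] Complex_eq by (intro continuous_intros)
  then show ?thesis by (rule borel_measurable_continuous_onI)
qed

lemma prod_Basis_real3:
  "(\<Prod>b\<in>(Basis :: (real^3) set). f b) = f (Finite_Cartesian_Product.axis 1 1) * f (Finite_Cartesian_Product.axis 2 1) * f (Finite_Cartesian_Product.axis 3 (1::real))"
proof -
  have B: "(Basis :: (real^3) set) = {Finite_Cartesian_Product.axis 1 1, Finite_Cartesian_Product.axis 2 1, Finite_Cartesian_Product.axis 3 1}"
    by (auto simp: Basis_vec_def UNIV_3)
  moreover have "Finite_Cartesian_Product.axis 1 1 \<noteq> (Finite_Cartesian_Product.axis 2 1 :: real^3)" "Finite_Cartesian_Product.axis 1 1 \<noteq> (Finite_Cartesian_Product.axis 3 1 :: real^3)" "Finite_Cartesian_Product.axis 2 1 \<noteq> (Finite_Cartesian_Product.axis 3 1 :: real^3)"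
    by (simp_all add: axis_eq_axis)
  ultimately show ?thesis unfolding B by (simp add: mult.assoc)
qed

lemma lborel_of_real3: "lborel = distr lborel borel of_real3"
proof (rule lborel_eqI)
  fix l u :: "complex \<times> real"
  assume lu: "\<And>b. b \<in> Basis \<Longrightarrow> l \<bullet> b \<le> u \<bullet> b"
  have B: "(1, 0) \<in> (Basis :: (complex \<times> real) set)" "(\<i>, 0) \<in> (Basis :: (complex \<times> real) set)"
    "(0, 1) \<in> (Basis :: (complex \<times> real) set)"
    by (auto simp: Basis_prod_def Basis_complex_def)
  have le: "Re (fst l) \<le> Re (fst u)" "Im (fst l) \<le> Im (fst u)" "snd l \<le> snd u"
    using lu[OF B(1)] lu[OF B(2)] lu[OF B(3)] by (simp_all add: inner_prod_def inner_complex_def)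
  have "of_real3 -` box l u = box (to_real3 l) (to_real3 u)"
    by (cases l; cases u) (auto simp: box_def of_real3_def to_real3_def Basis_prod_def Basis_complex_def
        inner_complex_def Basis_vec_def inner_axis UNIV_3)
  then have "emeasure (distr lborel borel of_real3) (box l u) = emeasure lborel (box (to_real3 l) (to_real3 u))"
    by (simp add: emeasure_distr)
  also have "\<dots> = (\<Prod>b\<in>Basis. (to_real3 u - to_real3 l) \<bullet> b)"
    by (rule emeasure_lborel_box) (use le in \<open>auto simp: Basis_vec_def inner_axis UNIV_3 to_real3_def\<close>)
  also have "(\<Prod>b\<in>Basis. (to_real3 u - to_real3 l) \<bullet> b)
      = (Re (fst u) - Re (fst l)) * (Im (fst u) - Im (fst l)) * (snd u - snd l)"
    by (simp add: prod_Basis_real3 inner_axis to_real3_def)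
  also have "\<dots> = (\<Prod>b\<in>Basis. (u - l) \<bullet> b)"
  proof -
    have B: "(Basis :: (complex \<times> real) set) = {(1, 0), (\<i>, 0), (0, 1)}"
      by (auto simp: Basis_prod_def Basis_complex_def)
    show ?thesis unfolding B by (simp add: inner_prod_def inner_complex_def)
  qed
  finally show "emeasure (distr lborel borel of_real3) (box l u) = (\<Prod>b\<in>Basis. (u - l) \<bullet> b)" .
qed simp

lemma H3_open: "H3 \<in> sets borel"
proof -
  have "open H3" unfolding H3_def case_prod_beta by (intro open_Collect_less continuous_intros)
  then show ?thesis by simp
qed

lemma density_measurable: "(\<lambda>p::complex \<times> real. ennreal (1 / snd p ^ 3)) \<in> borel_measurable borel"
proof -
  have "(snd :: complex \<times> real \<Rightarrow> real) \<in> borel_measurable borel"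
    by (intro borel_measurable_continuous_onI continuous_intros)
  moreover have "(\<lambda>x::real. ennreal (1 / x ^ 3)) \<in> borel_measurable borel" by measurable
  ultimately show ?thesis by (rule measurable_compose)
qed

lemma sets_hvolume: "E \<in> sets hvolume \<longleftrightarrow> E \<in> sets borel \<and> E \<subseteq> H3"
  using H3_open by (auto simp: hvolume_def sets_restrict_space_iff)

lemma emeasure_hvolume:
  assumes "E \<in> sets borel" "E \<subseteq> H3"
  shows "emeasure hvolume E = (\<integral>\<^sup>+p. ennreal (1 / snd p ^ 3) * indicator E p \<partial>lborel)"
proof -
  have "emeasure hvolume E = (\<integral>\<^sup>+p. ennreal (1 / snd p ^ 3) * indicator E p \<partial>restrict_space lborel H3)"
    unfolding hvolume_def using assms H3_open density_measurable
    by (intro emeasure_density measurable_restrict_space1) (auto simp: sets_restrict_space_iff)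
  also have "\<dots> = (\<integral>\<^sup>+p. ennreal (1 / snd p ^ 3) * indicator E p * indicator H3 p \<partial>lborel)"
    using H3_open by (subst nn_integral_restrict_space) auto
  also have "\<dots> = (\<integral>\<^sup>+p. ennreal (1 / snd p ^ 3) * indicator E p \<partial>lborel)"
    using assms by (intro nn_integral_cong) (auto simp: indicator_def)
  finally show ?thesis .
qed

lemma emeasure_hvolume_real3:
  assumes "E \<in> sets borel" "E \<subseteq> H3"
  shows "emeasure hvolume E = (\<integral>\<^sup>+v. ennreal (1 / v$3 ^ 3 * indicator (of_real3 -` E) v) \<partial>lborel)"
proof -
  have "emeasure hvolume E = (\<integral>\<^sup>+p. ennreal (1 / snd p ^ 3) * indicator E p \<partial>distr lborel borel of_real3)"
    unfolding emeasure_hvolume[OF assms] lborel_of_real3[symmetric] ..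
  also have "\<dots> = (\<integral>\<^sup>+v. ennreal (1 / snd (of_real3 v) ^ 3) * indicator E (of_real3 v) \<partial>lborel)"
    using assms density_measurable by (intro nn_integral_distr) auto
  also have "\<dots> = (\<integral>\<^sup>+v. ennreal (1 / v$3 ^ 3 * indicator (of_real3 -` E) v) \<partial>lborel)"
    by (intro nn_integral_cong) (auto simp: of_real3_def indicator_def)
  finally show ?thesis .
qed

text \<open>The formula for vector-valued functions, in dimension one.\<close>
lemma change_of_variables_real_valued:
  fixes f :: "real^'m::{finite,wellorder} \<Rightarrow> real" and g :: "real^'m::_ \<Rightarrow> real^'m::_"
  assumes "S \<in> sets lebesgue" "\<And>x. x \<in> S \<Longrightarrow> (g has_derivative g' x) (at x within S)" "inj_on g S"
  shows "(\<lambda>x. \<bar>det (matrix (g' x))\<bar> * f (g x)) absolutely_integrable_on S \<and>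
           integral S (\<lambda>x. \<bar>det (matrix (g' x))\<bar> * f (g x)) = b
     \<longleftrightarrow> f absolutely_integrable_on (g ` S) \<and> integral (g ` S) f = b"
  using has_absolute_integral_change_of_variables[OF assms, of "\<lambda>x. vec (f x) :: real^1" "vec b"]
  unfolding absolutely_integrable_on_1_iff integral_on_1_eq by (simp add: vec_eq_iff)

text \<open>A hyperbolic isometry scales Euclidean lengths by the quotient of the heights of \<open>g v\<close> and \<open>v\<close>, and hence
  Euclidean volume by its third power, which the density \<open>1 / t\<^sup>3\<close> compensates.\<close>
lemma volume_conformal_map:
  fixes g :: "real^3 \<Rightarrow> real^3"
  assumes E: "E \<in> sets borel" "E \<subseteq> H3" and E': "E' \<in> sets borel" "E' \<subseteq> H3"
    and fin: "emeasure hvolume E < \<infinity>"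
    and im: "g ` (of_real3 -` E) = of_real3 -` E'"
    and der: "\<And>v. v$3 > 0 \<Longrightarrow> (g has_derivative g' v) (at v)"
    and inj: "inj_on g (of_real3 -` E)"
    and conf: "\<And>v. v$3 > 0 \<Longrightarrow> \<bar>det (matrix (g' v))\<bar> = (g v $ 3 / v $ 3) ^ 3" "\<And>v. v$3 > 0 \<Longrightarrow> g v $ 3 > 0"
  shows "emeasure hvolume E' = emeasure hvolume E"
proof -
  define S where "S = of_real3 -` E"
  define T where "T = of_real3 -` E'"
  have ST: "S \<in> sets borel" "T \<in> sets borel"
    unfolding S_def T_def using measurable_sets[OF of_real3_measurable] E E' by auto
  have pos: "v$3 > 0" if "v \<in> S \<or> v \<in> T" for v
    using that E(2) E'(2) by (auto simp: S_def T_def of_real3_def H3_def)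
  let ?h = "\<lambda>v::real^3. 1 / v$3 ^ 3"
  have nth: "(\<lambda>v::real^3. v$3) \<in> borel_measurable borel"
    by (intro borel_measurable_continuous_onI continuous_intros)
  then have hm: "?h \<in> borel_measurable borel" by measurable
  have hS: "(\<lambda>v. ?h v * indicator U v) \<in> borel_measurable lborel" if "U \<in> sets borel" for U
    using hm that by simp
  have nonneg: "0 \<le> ?h v * indicator U v" if "U = S \<or> U = T" for U v
    using pos[of v] that by (auto simp: indicator_def)
  have to_int: "set_integrable lebesgue U ?h \<longleftrightarrow> (\<integral>\<^sup>+v. ennreal (?h v * indicator U v) \<partial>lborel) < \<infinity>"
    "set_integrable lebesgue U ?h \<Longrightarrow> (\<integral>\<^sup>+v. ennreal (?h v * indicator U v) \<partial>lborel) = ennreal (integral U ?h)"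
    if U: "U = S \<or> U = T" for U
  proof -
    have Ub: "U \<in> sets borel" using U ST by auto
    have si: "set_integrable lebesgue U ?h \<longleftrightarrow> integrable lborel (\<lambda>v. ?h v * indicator U v)"
      unfolding set_integrable_def using hS[OF Ub] by (simp add: integrable_completion mult.commute)
    show "set_integrable lebesgue U ?h \<longleftrightarrow> (\<integral>\<^sup>+v. ennreal (?h v * indicator U v) \<partial>lborel) < \<infinity>"
      unfolding si integrable_iff_bounded real_norm_def abs_of_nonneg[OF nonneg[OF U]] using hS[OF Ub] by blast
    assume i: "set_integrable lebesgue U ?h"
    have "(\<integral>\<^sup>+v. ennreal (?h v * indicator U v) \<partial>lborel) = ennreal (integral\<^sup>L lborel (\<lambda>v. ?h v * indicator U v))"
      using i nonneg[OF U] unfolding si by (intro nn_integral_eq_integral) auto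
    also have "integral\<^sup>L lborel (\<lambda>v. ?h v * indicator U v) = (LINT v:U|lebesgue. ?h v)"
      unfolding set_lebesgue_integral_def using hS[OF Ub] by (simp add: integral_completion mult.commute)
    also have "\<dots> = integral U ?h" using set_lebesgue_integral_eq_integral(2)[OF i] .
    finally show "(\<integral>\<^sup>+v. ennreal (?h v * indicator U v) \<partial>lborel) = ennreal (integral U ?h)" .
  qed
  have gS: "g ` S = T" using im by (simp add: S_def T_def)
  have "(\<integral>\<^sup>+v. ennreal (?h v * indicator S v) \<partial>lborel) < \<infinity>"
    using fin emeasure_hvolume_real3[OF E] by (simp add: S_def)
  then have intS: "set_integrable lebesgue S ?h" using to_int(1) by blast
  have eq: "\<bar>det (matrix (g' v))\<bar> * ?h (g v) = ?h v" if "v \<in> S" for v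
    using conf[of v] pos[of v] that by (simp add: field_simps)
  have "(\<lambda>v. \<bar>det (matrix (g' v))\<bar> * ?h (g v)) absolutely_integrable_on S \<and>
           integral S (\<lambda>v. \<bar>det (matrix (g' v))\<bar> * ?h (g v)) = integral S ?h
     \<longleftrightarrow> ?h absolutely_integrable_on (g ` S) \<and> integral (g ` S) ?h = integral S ?h"
  proof (rule change_of_variables_real_valued)
    show "S \<in> sets lebesgue" using ST by simp
    show "(g has_derivative g' v) (at v within S)" if "v \<in> S" for v
      using der[of v] pos[of v] that by (auto intro: has_derivative_at_withinI)
    show "inj_on g S" using inj by (simp add: S_def)
  qed
  moreover have "(\<lambda>v. \<bar>det (matrix (g' v))\<bar> * ?h (g v)) absolutely_integrable_on S"
    using intS set_integrable_cong[OF refl refl, of S "\<lambda>v. \<bar>det (matrix (g' v))\<bar> * ?h (g v)" ?h lebesgue] eq by simp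
  moreover have "integral S (\<lambda>v. \<bar>det (matrix (g' v))\<bar> * ?h (g v)) = integral S ?h"
    by (rule integral_cong) (rule eq)
  ultimately have T: "?h absolutely_integrable_on T" "integral T ?h = integral S ?h" unfolding gS by blast+
  show ?thesis
    unfolding emeasure_hvolume_real3[OF E] emeasure_hvolume_real3[OF E']
    using to_int(2)[of S] to_int(2)[of T] intS T by (simp add: S_def T_def)
qed

lemma SL2C_act_measurable: "SL2C_act A \<in> borel_measurable borel"
proof -
  define N where "N p = (A$1$1 * fst p + A$1$2) * cnj (A$2$1 * fst p + A$2$2)
    + A$1$1 * cnj (A$2$1) * complex_of_real ((snd p)\<^sup>2)" for p :: "complex \<times> real"
  define r where "r p = (cmod (A$2$1 * fst p + A$2$2))\<^sup>2 + (cmod (A$2$1))\<^sup>2 * (snd p)\<^sup>2" for p :: "complex \<times> real"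
  have N: "N \<in> borel_measurable borel"
    unfolding N_def[abs_def] by (intro borel_measurable_continuous_onI continuous_intros)
  have r: "r \<in> borel_measurable borel" "(\<lambda>p. complex_of_real (r p)) \<in> borel_measurable borel"
    unfolding r_def[abs_def] by (intro borel_measurable_continuous_onI continuous_intros)+
  have s: "(snd :: complex \<times> real \<Rightarrow> real) \<in> borel_measurable borel"
    by (intro borel_measurable_continuous_onI continuous_intros)
  have "SL2C_act A = (\<lambda>p. (N p / complex_of_real (r p), snd p / r p))"
    by (simp add: fun_eq_iff SL2C_act_def Let_def N_def r_def)
  then show ?thesis using N r s by (simp add: borel_measurable_Pair borel_measurable_divide)
qed

lemma SL2C_act_image_sets:
  assumes "det A = 1" "E \<in> sets borel" "E \<subseteq> H3"
  shows "SL2C_act A ` E \<in> sets borel" "SL2C_act A ` E \<subseteq> H3"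
proof -
  show H: "SL2C_act A ` E \<subseteq> H3" using assms SL2C_act_H3 by blast
  have "SL2C_act A ` E = SL2C_act (adj2 A) -` E \<inter> H3"
  proof (intro equalityI subsetI)
    fix p assume "p \<in> SL2C_act A ` E"
    then obtain q where q: "q \<in> E" "p = SL2C_act A q" by blast
    then have "q \<in> H3" using assms(3) by blast
    then show "p \<in> SL2C_act (adj2 A) -` E \<inter> H3" using q assms(1) by (simp add: SL2C_act_adj2 SL2C_act_H3)
  next
    fix p assume p: "p \<in> SL2C_act (adj2 A) -` E \<inter> H3"
    then show "p \<in> SL2C_act A ` E"
      using SL2C_act_adj2(1)[OF assms(1), of p] by (intro image_eqI[of _ _ "SL2C_act (adj2 A) p"]) auto
  qed
  then show "SL2C_act A ` E \<in> sets borel"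
    using measurable_sets[OF SL2C_act_measurable assms(2)] H3_open by auto
qed

lemma SL2C_act_inj_on: "det A = 1 \<Longrightarrow> inj_on (SL2C_act A) H3"
  by (rule inj_on_inverseI[of _ "SL2C_act (adj2 A)"]) (simp add: SL2C_act_adj2)

lemma volume_act_via_real3:
  fixes g :: "real^3 \<Rightarrow> real^3"
  assumes A: "det A = 1" and E: "E \<in> sets borel" "E \<subseteq> H3" "emeasure hvolume E < \<infinity>"
    and g: "\<And>v. v$3 > 0 \<Longrightarrow> of_real3 (g v) = SL2C_act A (of_real3 v)"
    and der: "\<And>v. v$3 > 0 \<Longrightarrow> (g has_derivative g' v) (at v)"
    and conf: "\<And>v. v$3 > 0 \<Longrightarrow> \<bar>det (matrix (g' v))\<bar> = (g v $ 3 / v $ 3) ^ 3"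
  shows "emeasure hvolume (SL2C_act A ` E) = emeasure hvolume E"
proof (rule volume_conformal_map[where g = g and g' = g'])
  note im = SL2C_act_image_sets[OF A E(1,2)]
  show "SL2C_act A ` E \<in> sets borel" "SL2C_act A ` E \<subseteq> H3" by (rule im)+
  have pos: "v$3 > 0" if "of_real3 v \<in> E" for v using that E(2) by (auto simp: of_real3_def H3_def)
  show "g ` (of_real3 -` E) = of_real3 -` (SL2C_act A ` E)"
  proof (intro equalityI subsetI)
    fix v assume "v \<in> g ` (of_real3 -` E)"
    then show "v \<in> of_real3 -` (SL2C_act A ` E)" using g pos by auto
  next
    fix v assume "v \<in> of_real3 -` (SL2C_act A ` E)"
    then obtain p where p: "p \<in> E" "of_real3 v = SL2C_act A p" by auto
    define u where "u = to_real3 p"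
    have u: "of_real3 u \<in> E" using p by (simp add: u_def)
    then have "of_real3 (g u) = of_real3 v" using g pos p by (simp add: u_def)
    then have "g u = v" by (metis to_of_real3(1))
    then show "v \<in> g ` (of_real3 -` E)" using u by auto
  qed
  show "inj_on g (of_real3 -` E)"
  proof (rule inj_onI)
    fix u v assume uv: "u \<in> of_real3 -` E" "v \<in> of_real3 -` E" "g u = g v"
    then have "SL2C_act A (of_real3 u) = SL2C_act A (of_real3 v)" using g pos by (metis vimageD)
    then have "of_real3 u = of_real3 v" using SL2C_act_inj_on[OF A] uv E(2) by (auto dest: inj_onD)
    then show "u = v" by (metis to_of_real3(1))
  qed
  show "g v $ 3 > 0" if "v$3 > 0" for v
  proof -
    have "of_real3 v \<in> H3" using that by (simp add: of_real3_def H3_def)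
    then have "of_real3 (g v) \<in> H3" using SL2C_act_H3[OF A] g[OF that] by simp
    then show ?thesis by (simp add: of_real3_def H3_def)
  qed
qed (use E der conf in auto)

lemma volume_act_upper:
  assumes a: "a \<noteq> 0" and E: "E \<in> sets borel" "E \<subseteq> H3" "emeasure hvolume E < \<infinity>"
  shows "emeasure hvolume (SL2C_act (mat2 a b 0 (1/a)) ` E) = emeasure hvolume E"
proof -
  define p q k where "p = Re (a\<^sup>2)" "q = Im (a\<^sup>2)" "k = (cmod a)\<^sup>2"
  note pqk = this
  have k: "k > 0" using a by (simp add: pqk)
  have kk: "p * p + q * q = k * k"
  proof -
    have "p * p + q * q = (cmod (a\<^sup>2))\<^sup>2" unfolding pqk cmod_power2 by (simp add: power2_eq_square)
    then show ?thesis by (simp add: pqk norm_power norm_mult power2_eq_square)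
  qed
  define M :: "real^3^3" where "M = vector [vector [p, - q, 0], vector [q, p, 0], vector [0, 0, k]]"
  define c :: "real^3" where "c = vector [Re (a * b), Im (a * b), 0]"
  show ?thesis
  proof (rule volume_act_via_real3[where g = "\<lambda>v. M *v v + c" and g' = "\<lambda>v h. M *v h"])
    show "det (mat2 a b 0 (1/a)) = 1" using a by simp
    fix v :: "real^3"
    show "((\<lambda>v. M *v v + c) has_derivative (\<lambda>h. M *v h)) (at v)"
      by (auto intro!: derivative_eq_intros bounded_linear_imp_has_derivative matrix_vector_mul_bounded_linear)
    have comp: "(M *v v + c)$1 = p * v$1 - q * v$2 + Re (a * b)" "(M *v v + c)$2 = q * v$1 + p * v$2 + Im (a * b)"
       "(M *v v + c)$3 = k * v$3"
      by (simp_all add: M_def c_def matrix_vector_mult_def sum_3)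
    show "of_real3 (M *v v + c) = SL2C_act (mat2 a b 0 (1/a)) (of_real3 v)"
      unfolding of_real3_def act_upper[OF a] comp by (simp add: complex_eq_iff pqk)
    assume v: "v$3 > 0"
    have "det M = k * (p * p + q * q)" by (simp add: M_def det_3 algebra_simps)
    then have "det M = k ^ 3" unfolding kk by (simp add: power3_eq_cube)
    then show "\<bar>det (matrix ((*v) M))\<bar> = ((M *v v + c) $ 3 / v $ 3) ^ 3"
      unfolding comp using v k by simp
  qed (rule E)+
qed

text \<open>The map is \<open>v \<mapsto> R v / \<bar>v\<bar>\<^sup>2\<close> with a reflection \<open>R\<close>. Its derivative is \<open>1 / \<bar>v\<bar>\<^sup>2\<close> times an orthogonal
  matrix, and heights are divided by \<open>\<bar>v\<bar>\<^sup>2\<close> as well.\<close>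
lemma volume_act_inversion:
  assumes E: "E \<in> sets borel" "E \<subseteq> H3" "emeasure hvolume E < \<infinity>"
  shows "emeasure hvolume (SL2C_act (mat2 0 (-1) 1 0) ` E) = emeasure hvolume E"
proof -
  define R :: "real^3^3" where "R = vector [vector [-1, 0, 0], vector [0, 1, 0], vector [0, 0, 1]]"
  define g where "g v = (1 / (v \<bullet> v)) *\<^sub>R (R *v v)" for v :: "real^3"
  define g' where "g' v h = (1 / (v \<bullet> v)) *\<^sub>R (R *v h) + (- (2 * (v \<bullet> h)) / (v \<bullet> v)\<^sup>2) *\<^sub>R (R *v v)" for v h :: "real^3"
  have Rc: "(R *v v)$1 = - v$1" "(R *v v)$2 = v$2" "(R *v v)$3 = v$3" for v
    by (simp_all add: R_def matrix_vector_mult_def sum_3)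
  have vv: "v \<bullet> v = v$1 * v$1 + v$2 * v$2 + v$3 * v$3" for v :: "real^3"
    by (simp add: inner_vec_def sum_3)
  show ?thesis
  proof (rule volume_act_via_real3[where g = g and g' = g'])
    fix v :: "real^3"
    assume v: "v$3 > 0"
    then have v0: "v \<bullet> v \<noteq> 0" by (auto simp: inner_eq_zero_iff)
    have "((\<lambda>v. R *v v) has_derivative (\<lambda>h. R *v h)) (at v)"
      by (rule bounded_linear_imp_has_derivative[OF matrix_vector_mul_bounded_linear])
    then show "(g has_derivative g' v) (at v)"
      unfolding g_def[abs_def] g'_def[abs_def] using v0
      by (auto intro!: derivative_eq_intros simp: fun_eq_iff inner_commute power2_eq_square field_simps)
    have n: "(cmod (Complex (v$1) (v$2)))\<^sup>2 + (v$3)\<^sup>2 = v \<bullet> v"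
      unfolding cmod_power2 vv by (simp add: power2_eq_square)
    show "of_real3 (g v) = SL2C_act (mat2 0 (-1) 1 0) (of_real3 v)"
      unfolding of_real3_def SL2C_act_mat2 Let_def using n by (simp add: g_def Rc complex_eq_iff)
    define k where "k = 1 / (v \<bullet> v)"
    have kn: "k * (v$1 * v$1 + v$2 * v$2 + v$3 * v$3) = 1" using v0 by (simp add: k_def flip: vv)
    have ent: "matrix (g' v) $ i $ j = k * (R *v Finite_Cartesian_Product.axis j 1) $ i - 2 * k\<^sup>2 * v$j * (R *v v)$i" for i j
      by (simp add: matrix_def g'_def k_def inner_axis power2_eq_square)
    have "det (matrix (g' v)) = k ^ 3"
      unfolding det_3 ent using kn
      by (simp add: Rc Finite_Cartesian_Product.axis_def) algebra
    moreover have "g v $ 3 / v $ 3 = k" using v by (simp add: g_def Rc k_def)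
    moreover have "k > 0" using v0 by (simp add: k_def inner_gt_zero_iff)
    ultimately show "\<bar>det (matrix (g' v))\<bar> = (g v $ 3 / v $ 3) ^ 3" by simp
  qed (use E in simp_all)
qed

lemma volume_act_mult:
  assumes AB: "det A = 1" "det B = 1"
    and pA: "\<And>E. E \<in> sets borel \<Longrightarrow> E \<subseteq> H3 \<Longrightarrow> emeasure hvolume E < \<infinity> \<Longrightarrow> emeasure hvolume (SL2C_act A ` E) = emeasure hvolume E"
    and pB: "\<And>E. E \<in> sets borel \<Longrightarrow> E \<subseteq> H3 \<Longrightarrow> emeasure hvolume E < \<infinity> \<Longrightarrow> emeasure hvolume (SL2C_act B ` E) = emeasure hvolume E"
    and E: "E \<in> sets borel" "E \<subseteq> H3" "emeasure hvolume E < \<infinity>"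
  shows "emeasure hvolume (SL2C_act (A ** B) ` E) = emeasure hvolume E"
proof -
  have "SL2C_act (A ** B) ` E = SL2C_act A ` SL2C_act B ` E"
    unfolding image_image using E(2) AB by (intro image_cong) (auto simp: SL2C_act_mult)
  then show ?thesis using pA[OF SL2C_act_image_sets[OF AB(2) E(1,2)]] pB[OF E] E(3) by simp
qed

text \<open>The group is generated by the upper triangular matrices and one inversion.\<close>
lemma volume_act:
  assumes A: "det A = 1" and E: "E \<in> sets borel" "E \<subseteq> H3" "emeasure hvolume E < \<infinity>"
  shows "emeasure hvolume (SL2C_act A ` E) = emeasure hvolume E"
proof -
  obtain a b c d where A': "A = mat2 a b c d" by (rule mat2_cases)
  have dt: "a * d - b * c = 1" using A A' by simp
  show ?thesis
  proof (cases "c = 0")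
    case True
    then have "d * a = 1" using dt by (simp add: mult.commute)
    then have a0: "a \<noteq> 0" by auto
    then have "d = 1/a" using \<open>d * a = 1\<close> by (simp add: nonzero_eq_divide_eq)
    then show ?thesis unfolding A' True using volume_act_upper[OF a0 E] by simp
  next
    case False
    have "b = (a * d - 1) / c" using dt False by (simp add: field_simps)
    then have fac: "A = mat2 1 (a/c) 0 (1/1) ** (mat2 0 (-1) 1 0 ** mat2 c d 0 (1/c))"
      using False unfolding A' by (simp add: field_simps)
    show ?thesis unfolding fac
      using False E
      by (intro volume_act_mult volume_act_upper volume_act_inversion) simp_all
  qed
qed


section \<open>Finite covolume excludes elementary groups\<close>

lemma (in discrete_SL2) countable_group: "countable G"
proof -
  have "G = (\<Union>n::nat. {A \<in> G. \<forall>i j. cmod (A$i$j) \<le> real n})"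
  proof (intro equalityI subsetI)
    fix A assume A: "A \<in> G"
    obtain n where n: "norm A \<le> real n" using real_arch_simple by blast
    have "cmod (A$i$j) \<le> real n" for i j
      using order_trans[OF Finite_Cartesian_Product.norm_nth_le[of "A$i" j] Finite_Cartesian_Product.norm_nth_le[of A i]] n by simp
    then show "A \<in> (\<Union>n::nat. {A \<in> G. \<forall>i j. cmod (A$i$j) \<le> real n})" using A by blast
  qed auto
  moreover have "countable (\<Union>n::nat. {A \<in> G. \<forall>i j. cmod (A$i$j) \<le> real n})"
    by (rule countable_UN[OF countableI_type]) (rule countable_finite[OF finite_bounded])
  ultimately show ?thesis by simp
qed

text \<open>\<open>W\<close> is cut into the pieces that the elements of \<open>\<Gamma>\<close> move into \<open>F\<close>. The moved pieces have the same volumes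
  and are disjoint, because no two points of \<open>W\<close> are in the same orbit.\<close>
lemma embedded_volume_le:
  assumes K: "Kleinian_group \<Gamma>" and F: "fundamental_set \<Gamma> F"
    and W: "W \<in> sets borel" "W \<subseteq> H3" "emeasure hvolume W < \<infinity>"
    and emb: "\<And>A p. A \<in> matrix_group \<Gamma> \<Longrightarrow> p \<in> W \<Longrightarrow> SL2C_act A p \<in> W \<Longrightarrow> A = mat 1 \<or> A = - mat 1"
  shows "emeasure hvolume W \<le> emeasure hvolume F"
proof -
  interpret discrete_SL2 "matrix_group \<Gamma>" by (rule discrete_matrix_group[OF K])
  have FH: "F \<in> sets borel" "F \<subseteq> H3" using F unfolding fundamental_set_def sets_hvolume by auto
  define r where "r \<gamma> = (SOME A. A \<in> matrix_group \<Gamma> \<and> \<gamma> = pm A)" for \<gamma>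
  have r: "r \<gamma> \<in> matrix_group \<Gamma>" "\<gamma> = pm (r \<gamma>)" if "\<gamma> \<in> \<Gamma>" for \<gamma>
  proof -
    have "\<exists>A. A \<in> matrix_group \<Gamma> \<and> \<gamma> = pm A" using pm_matrix_group[OF K that] by metis
    from someI_ex[OF this] show "r \<gamma> \<in> matrix_group \<Gamma>" "\<gamma> = pm (r \<gamma>)" unfolding r_def by auto
  qed
  have d: "det (r \<gamma>) = 1" if "\<gamma> \<in> \<Gamma>" for \<gamma> using det_1 r that by blast
  have actr: "act \<gamma> p = SL2C_act (r \<gamma>) p" if "\<gamma> \<in> \<Gamma>" for \<gamma> p
    using r(2)[OF that] act_rcoset by metis
  have cnt: "countable \<Gamma>"
  proof (rule countable_subset)
    show "\<Gamma> \<subseteq> pm ` matrix_group \<Gamma>" using r by blast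
    show "countable (pm ` matrix_group \<Gamma>)" using countable_group by simp
  qed
  have same: "\<gamma> = \<delta>" if gd: "\<gamma> \<in> \<Gamma>" "\<delta> \<in> \<Gamma>" and pq: "p \<in> W" "q \<in> W" "SL2C_act (r \<gamma>) p = SL2C_act (r \<delta>) q" for \<gamma> \<delta> p q
  proof -
    have "p \<in> H3" "q \<in> H3" using pq W by auto
    have "SL2C_act (adj2 (r \<delta>) ** r \<gamma>) p = q"
      using pq(3) \<open>p \<in> H3\<close> \<open>q \<in> H3\<close> d[OF gd(1)] d[OF gd(2)] by (simp add: SL2C_act_mult SL2C_act_adj2)
    then have "adj2 (r \<delta>) ** r \<gamma> = mat 1 \<or> adj2 (r \<delta>) ** r \<gamma> = - mat 1"
      using emb[OF mult_mem[OF adj2_mem[OF r(1)[OF gd(2)]] r(1)[OF gd(1)]] pq(1)] pq(2) by simp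
    then have "r \<delta> ** (adj2 (r \<delta>) ** r \<gamma>) = r \<delta> \<or> r \<delta> ** (adj2 (r \<delta>) ** r \<gamma>) = - r \<delta>"
      by (auto simp: matrix_mul_uminus)
    then have "r \<gamma> = r \<delta> \<or> r \<gamma> = - r \<delta>"
      using d[OF gd(2)] by (simp add: matrix_mul_assoc adj2_inverse)
    then have "pm (r \<gamma>) = pm (r \<delta>)" by (simp only: pm_eq_iff)
    then show ?thesis using r(2)[OF gd(1)] r(2)[OF gd(2)] by simp
  qed
  define X where "X \<gamma> = W \<inter> SL2C_act (r \<gamma>) -` F" for \<gamma>
  define Y where "Y \<gamma> = SL2C_act (r \<gamma>) ` X \<gamma>" for \<gamma>
  have Xs: "X \<gamma> \<in> sets borel" "X \<gamma> \<subseteq> H3" for \<gamma>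
    using W measurable_sets[OF SL2C_act_measurable FH(1), of "r \<gamma>"] by (auto simp: X_def)
  have Xsub: "emeasure hvolume (X \<gamma>) < \<infinity>" for \<gamma>
  proof -
    have "emeasure hvolume (X \<gamma>) \<le> emeasure hvolume W"
      by (rule emeasure_mono) (use W sets_hvolume in \<open>auto simp: X_def\<close>)
    then show ?thesis using W(3) by (rule le_less_trans)
  qed
  have XY: "emeasure hvolume (Y \<gamma>) = emeasure hvolume (X \<gamma>)" if "\<gamma> \<in> \<Gamma>" for \<gamma>
    unfolding Y_def by (rule volume_act[OF d[OF that] Xs Xsub])
  have Ys: "Y \<gamma> \<in> sets hvolume" if "\<gamma> \<in> \<Gamma>" for \<gamma>
    using SL2C_act_image_sets[OF d[OF that] Xs] by (simp add: sets_hvolume Y_def)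
  have cover: "W = (\<Union>\<gamma>\<in>\<Gamma>. X \<gamma>)"
  proof (intro equalityI subsetI)
    fix p assume p: "p \<in> W"
    then have "p \<in> H3" using W by blast
    then obtain \<gamma> where "\<gamma> \<in> \<Gamma>" "act \<gamma> p \<in> F"
      using F unfolding fundamental_set_def by metis
    then show "p \<in> (\<Union>\<gamma>\<in>\<Gamma>. X \<gamma>)" using p actr by (auto simp: X_def)
  qed (auto simp: X_def)
  have Xdis: "disjoint_family_on X \<Gamma>"
    unfolding disjoint_family_on_def
  proof (intro ballI impI, rule ccontr)
    fix \<gamma> \<delta> assume gd: "\<gamma> \<in> \<Gamma>" "\<delta> \<in> \<Gamma>" "\<gamma> \<noteq> \<delta>" and "X \<gamma> \<inter> X \<delta> \<noteq> {}"
    then obtain p where "p \<in> X \<gamma>" "p \<in> X \<delta>" by blast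
    then have p: "p \<in> W" "SL2C_act (r \<gamma>) p \<in> F" "SL2C_act (r \<delta>) p \<in> F" by (simp_all add: X_def)
    have "p \<in> H3" using p W by blast
    then have "\<exists>!q. q \<in> F \<and> (\<exists>\<gamma>\<in>\<Gamma>. q = act \<gamma> p)" using F by (simp add: fundamental_set_def)
    then have "SL2C_act (r \<gamma>) p = SL2C_act (r \<delta>) p" using p(2,3) gd(1,2) actr by metis
    then show False using same[OF gd(1,2) p(1,1)] gd(3) by blast
  qed
  have Ydis: "disjoint_family_on Y \<Gamma>"
    unfolding disjoint_family_on_def
  proof (intro ballI impI, rule ccontr)
    fix \<gamma> \<delta> assume gd: "\<gamma> \<in> \<Gamma>" "\<delta> \<in> \<Gamma>" "\<gamma> \<noteq> \<delta>" and "Y \<gamma> \<inter> Y \<delta> \<noteq> {}"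
    then obtain s where "s \<in> Y \<gamma>" "s \<in> Y \<delta>" by blast
    then obtain p q where "p \<in> X \<gamma>" "q \<in> X \<delta>" "s = SL2C_act (r \<gamma>) p" "s = SL2C_act (r \<delta>) q"
      unfolding Y_def by blast
    then have "p \<in> W" "q \<in> W" "SL2C_act (r \<gamma>) p = SL2C_act (r \<delta>) q" by (simp_all add: X_def)
    then show False using same[OF gd(1,2)] gd(3) by blast
  qed
  have "emeasure hvolume W = (\<integral>\<^sup>+\<gamma>. emeasure hvolume (X \<gamma>) \<partial>count_space \<Gamma>)"
    unfolding cover by (rule emeasure_UN_countable[OF _ cnt Xdis]) (use Xs sets_hvolume in auto)
  also have "\<dots> = (\<integral>\<^sup>+\<gamma>. emeasure hvolume (Y \<gamma>) \<partial>count_space \<Gamma>)"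
    by (rule nn_integral_cong) (simp add: XY)
  also have "\<dots> = emeasure hvolume (\<Union>\<gamma>\<in>\<Gamma>. Y \<gamma>)"
    by (rule emeasure_UN_countable[symmetric, OF _ cnt Ydis]) (rule Ys)
  also have "\<dots> \<le> emeasure hvolume F"
    by (rule emeasure_mono) (use FH sets_hvolume in \<open>auto simp: X_def Y_def\<close>)
  finally show ?thesis .
qed

text \<open>The disc is centred at 1 because this boundary point is fixed neither by a nontrivial translation
  nor by a diagonal matrix other than \<open>\<plusminus>1\<close>.\<close>
definition cusp_box :: "real \<Rightarrow> real \<Rightarrow> (complex \<times> real) set" where
  "cusp_box e h = ball 1 e \<times> {h<..<1}"

lemma cusp_box_sets:
  assumes "h > 0" shows "cusp_box e h \<in> sets borel" "cusp_box e h \<subseteq> H3"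
  using assms by (auto simp: cusp_box_def H3_def intro!: borel_open open_Times)

lemma emeasure_ball_times_interval:
  fixes e :: real
  assumes "e > 0" "a \<le> b"
  shows "emeasure lborel (ball (1::complex) e \<times> {a<..<b::real}) = ennreal (measure lborel (ball (1::complex) e) * (b - a))"
proof -
  have "emeasure lborel (ball (1::complex) e \<times> {a<..<b::real}) = emeasure (lborel \<Otimes>\<^sub>M lborel) (ball (1::complex) e \<times> {a<..<b::real})"
    by (simp add: lborel_prod)
  also have "\<dots> = emeasure lborel (ball (1::complex) e) * emeasure lborel {a<..<b}"
    by (rule lborel.emeasure_pair_measure_Times) auto
  also have "emeasure lborel (ball (1::complex) e) = ennreal (measure lborel (ball (1::complex) e))"
    by (rule emeasure_eq_ennreal_measure) (use emeasure_lborel_ball_finite[of "1::complex" e] in \<open>simp add: less_top\<close>)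
  finally show ?thesis using assms by (simp add: ennreal_mult)
qed

lemma cusp_box_finite:
  assumes "e > 0" "h > 0" "h < 1"
  shows "emeasure hvolume (cusp_box e h) < \<infinity>"
proof -
  have "emeasure hvolume (cusp_box e h) = (\<integral>\<^sup>+p. ennreal (1 / snd p ^ 3) * indicator (cusp_box e h) p \<partial>lborel)"
    by (rule emeasure_hvolume[OF cusp_box_sets[OF assms(2)]])
  also have "\<dots> \<le> (\<integral>\<^sup>+p. ennreal (1 / h ^ 3) * indicator (cusp_box e h) p \<partial>lborel)"
  proof (rule nn_integral_mono)
    fix p :: "complex \<times> real"
    have "1 / snd p ^ 3 \<le> 1 / h ^ 3" if "p \<in> cusp_box e h"
      using that assms by (intro divide_left_mono power_mono mult_pos_pos zero_less_power) (auto simp: cusp_box_def)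
    then show "ennreal (1 / snd p ^ 3) * indicator (cusp_box e h) p \<le> ennreal (1 / h ^ 3) * indicator (cusp_box e h) p"
      by (auto simp: indicator_def intro: ennreal_leI)
  qed
  also have "\<dots> = ennreal (1 / h ^ 3) * emeasure lborel (cusp_box e h)"
    using cusp_box_sets[OF assms(2)] by (intro nn_integral_cmult_indicator) auto
  also have "\<dots> < \<infinity>" unfolding cusp_box_def using assms by (subst emeasure_ball_times_interval) (auto simp: ennreal_mult_less_top)
  finally show ?thesis .
qed

text \<open>The part below height \<open>2 h\<close> has Euclidean volume proportional to \<open>h\<close> and density at least \<open>1 / (2 h)\<^sup>3\<close>.\<close>
lemma cusp_box_large:
  assumes "e > 0" "h > 0" "2 * h \<le> 1"
  shows "emeasure hvolume (cusp_box e h) \<ge> ennreal (measure lborel (ball (1::complex) e) / (8 * h\<^sup>2))"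
proof -
  let ?V = "ball (1::complex) e \<times> {h<..<2*h}"
  have V: "?V \<in> sets borel" by (intro borel_open open_Times) auto
  have "ennreal (measure lborel (ball (1::complex) e) / (8 * h\<^sup>2)) = ennreal (1 / (2 * h) ^ 3) * ennreal (measure lborel (ball (1::complex) e) * (2 * h - h))"
    using assms by (simp add: field_simps power2_eq_square power3_eq_cube flip: ennreal_mult)
  also have "\<dots> = ennreal (1 / (2 * h) ^ 3) * emeasure lborel ?V"
    using assms by (subst emeasure_ball_times_interval) auto
  also have "\<dots> = (\<integral>\<^sup>+p. ennreal (1 / (2 * h) ^ 3) * indicator ?V p \<partial>lborel)"
    using V by (intro nn_integral_cmult_indicator[symmetric]) auto
  also have "\<dots> \<le> (\<integral>\<^sup>+p. ennreal (1 / snd p ^ 3) * indicator (cusp_box e h) p \<partial>lborel)"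
  proof (rule nn_integral_mono)
    fix p :: "complex \<times> real"
    have "1 / (2 * h) ^ 3 \<le> 1 / snd p ^ 3 \<and> p \<in> cusp_box e h" if "p \<in> ?V"
      using that assms by (intro conjI divide_left_mono power_mono mult_pos_pos zero_less_power) (auto simp: cusp_box_def)
    then show "ennreal (1 / (2 * h) ^ 3) * indicator ?V p \<le> ennreal (1 / snd p ^ 3) * indicator (cusp_box e h) p"
      by (auto simp: indicator_def intro: ennreal_leI)
  qed
  also have "\<dots> = emeasure hvolume (cusp_box e h)"
    by (rule emeasure_hvolume[symmetric, OF cusp_box_sets[OF assms(2)]])
  finally show ?thesis .
qed

text \<open>A group element that moves some point of the box into the box is bounded, so only finitely many
  elements have to be considered. Each nontrivial one moves the boundary point 1 by a
  positive distance, and a sufficiently small disc around 1 is moved off itself.\<close>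
lemma elementary_cusp_box_embeds:
  assumes "discrete_SL2 G"
    and up: "\<And>A. A \<in> G \<Longrightarrow> A$2$1 = 0"
    and el: "(\<forall>A\<in>G. A$1$2 = 0) \<or> (\<forall>A\<in>G. (A$1$1)\<^sup>2 = 1)"
  obtains e where "e > 0" "\<And>h A p. h > 0 \<Longrightarrow> A \<in> G \<Longrightarrow> p \<in> cusp_box e h \<Longrightarrow> SL2C_act A p \<in> cusp_box e h \<Longrightarrow> A = mat 1 \<or> A = - mat 1"
proof -
  interpret discrete_SL2 G by fact
  \<comment> \<open>The distance by which \<open>A\<close> moves the boundary point 1\<close>
  define m where "m A = cmod ((A$1$1)\<^sup>2 + A$1$1 * A$1$2 - 1)" for A :: "complex^2^2"
  define S where "S = insert 2 (m ` {A \<in> G. \<forall>i j. cmod (A$i$j) \<le> 4} - {0})"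
  have S: "finite S" "S \<noteq> {}" unfolding S_def using finite_bounded by auto
  have "0 < s" if "s \<in> S" for s using that by (auto simp: S_def m_def)
  then have pos: "Min S > 0" using S Min_in by blast
  have S2: "Min S \<le> 2" using S(1) by (rule Min_le) (simp add: S_def)
  \<comment> \<open>Below, \<open>m A\<close> is at most \<open>e + \<bar>a\<^sup>2\<bar> e\<close> with \<open>\<bar>a\<^sup>2\<bar> \<le> 3\<close>, whence the factor 4.\<close>
  define e where "e = Min S / 4"
  have e: "e > 0" "e \<le> 1/2" using pos S2 by (auto simp: e_def)
  show ?thesis
  proof (rule that[OF e(1)])
    fix h A p
    assume h: "h > (0::real)" and A: "A \<in> G" and p: "p \<in> cusp_box e h" "SL2C_act A p \<in> cusp_box e h"
    obtain z t where zt: "p = (z, t)" by (cases p)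
    obtain a b c d where A': "A = mat2 a b c d" by (rule mat2_cases)
    have c: "c = 0" using up[OF A] A' by simp
    have ad: "a * d = 1" using det_1[OF A] A' c by simp
    then have a0: "a \<noteq> 0" by auto
    have d: "d = 1/a" using ad a0 by (simp add: field_simps)
    have A'': "A = mat2 a b 0 (1/a)" using A' c d by simp
    have z: "cmod (1 - z) < e" "cmod (1 - (a\<^sup>2 * z + a * b)) < e"
      using p unfolding zt A'' act_upper[OF a0] by (auto simp: cusp_box_def dist_norm)
    have bound: "cmod a \<le> 2 \<and> cmod (1/a) \<le> 2 \<and> cmod b \<le> 1 \<and> cmod (a\<^sup>2) \<le> 3 \<and> (a\<^sup>2 + a * b = 1 \<longrightarrow> a\<^sup>2 = 1 \<and> b = 0)"
      using el
    proof
      assume "\<forall>A\<in>G. A$1$2 = 0"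
      then have b: "b = 0" using A A'' by force
      have z1: "cmod z \<le> 3/2" "1/2 \<le> cmod z"
        using z(1) e(2) norm_triangle_ineq2[of z 1] norm_triangle_ineq2[of 1 z] norm_minus_commute[of 1 z] by auto
      have z2: "cmod (a\<^sup>2 * z) \<le> 3/2" "1/2 \<le> cmod (a\<^sup>2 * z)"
        using z(2) e(2) norm_triangle_ineq2[of "a\<^sup>2 * z" 1] norm_triangle_ineq2[of 1 "a\<^sup>2 * z"] norm_minus_commute[of 1 "a\<^sup>2 * z"]
        unfolding b by auto
      have "cmod (a\<^sup>2) * (1/2) \<le> cmod (a\<^sup>2) * cmod z" using z1 by (intro mult_left_mono) auto
      then have u: "cmod (a\<^sup>2) \<le> 3" using z2 by (simp add: norm_mult)
      have "cmod (a\<^sup>2) * cmod z \<le> cmod (a\<^sup>2) * (3/2)" using z1 by (intro mult_left_mono) auto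
      then have l: "1/3 \<le> cmod (a\<^sup>2)" using z2 by (simp add: norm_mult)
      have "(cmod a)\<^sup>2 \<le> 2\<^sup>2" "(1/2)\<^sup>2 \<le> (cmod a)\<^sup>2" using u l by (simp_all add: norm_power norm_mult power2_eq_square)
      then have "cmod a \<le> 2" "1/2 \<le> cmod a"
        by (meson norm_ge_zero power2_le_imp_le zero_le_numeral, meson norm_ge_zero power2_le_imp_le)
      then show ?thesis using u b a0 by (auto simp: norm_divide divide_le_eq)
    next
      assume "\<forall>A\<in>G. (A$1$1)\<^sup>2 = 1"
      then have a: "a\<^sup>2 = 1" using A A'' by force
      then have "cmod a ^ 2 = 1" by (metis norm_one norm_power)
      then have na: "cmod a = 1" by (simp add: abs_square_eq_1)
      have "cmod (a * b) \<le> cmod (1 - z) + cmod (1 - (z + a * b))"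
        using norm_triangle_ineq4[of "1 - z" "1 - (z + a * b)"] by simp
      then have "cmod (a * b) \<le> 1" using z e(2) a by simp
      then show ?thesis using a na a0 by (auto simp: norm_mult norm_divide)
    qed
    have "cmod (A$i$j) \<le> 4" for i j
      unfolding A'' using bound exhaust_2[of i] exhaust_2[of j] by auto
    then have mem: "A \<in> {A \<in> G. \<forall>i j. cmod (A$i$j) \<le> 4}" using A by blast
    have "(a\<^sup>2 + a * b - 1) = (a\<^sup>2 * (1 - z)) - (1 - (a\<^sup>2 * z + a * b))" by (simp add: algebra_simps)
    then have "m A \<le> cmod (a\<^sup>2 * (1 - z)) + cmod (1 - (a\<^sup>2 * z + a * b))"
      unfolding m_def A'' mat2_entries by (metis norm_triangle_ineq4)
    also have "cmod (a\<^sup>2 * (1 - z)) \<le> 3 * e"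
      unfolding norm_mult using bound z(1) by (intro mult_mono) auto
    finally have "m A < 4 * e" using z(2) by simp
    then have "m A < Min S" by (simp add: e_def)
    then have "m A \<notin> S" using Min_le[OF S(1)] by fastforce
    then have "m A = 0" using mem by (auto simp: S_def)
    then have "a\<^sup>2 + a * b = 1" unfolding m_def A'' by simp
    then have "a\<^sup>2 = 1" "b = 0" using bound by auto
    then have "a = 1 \<or> a = -1" by (simp add: power2_eq_1_iff)
    then show "A = mat 1 \<or> A = - mat 1" unfolding A'' mat2_one using \<open>b = 0\<close> by auto
  qed
qed

text \<open>The boxes embed into the quotient, and their volumes are unbounded as \<open>h\<close> tends to 0.\<close>
lemma elementary_infinite_covolume:
  assumes K: "Kleinian_group \<Gamma>" and P: "det P = 1"
    and up: "\<And>A. A \<in> conj_group P (matrix_group \<Gamma>) \<Longrightarrow> A$2$1 = 0"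
    and el: "(\<forall>A\<in>conj_group P (matrix_group \<Gamma>). A$1$2 = 0) \<or> (\<forall>A\<in>conj_group P (matrix_group \<Gamma>). (A$1$1)\<^sup>2 = 1)"
  shows "\<not> finite_covolume \<Gamma>"
proof
  assume "finite_covolume \<Gamma>"
  then obtain F where F: "fundamental_set \<Gamma> F" "emeasure hvolume F < \<infinity>" by (auto simp: finite_covolume_def)
  have disc: "discrete_SL2 (conj_group P (matrix_group \<Gamma>))"
    by (rule discrete_conj_group[OF discrete_matrix_group[OF K] P])
  obtain e where e: "e > 0" "\<And>h A p. h > 0 \<Longrightarrow> A \<in> conj_group P (matrix_group \<Gamma>) \<Longrightarrow> p \<in> cusp_box e h
      \<Longrightarrow> SL2C_act A p \<in> cusp_box e h \<Longrightarrow> A = mat 1 \<or> A = - mat 1"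
    using elementary_cusp_box_embeds[OF disc up el] by blast
  have le: "emeasure hvolume (cusp_box e h) \<le> emeasure hvolume F" if h: "h > 0" "h < 1" for h
  proof -
    note B = cusp_box_sets[OF h(1), of e] cusp_box_finite[OF e(1) h]
    have "emeasure hvolume (SL2C_act P ` cusp_box e h) \<le> emeasure hvolume F"
    proof (rule embedded_volume_le[OF K F(1) SL2C_act_image_sets[OF P B(1,2)]])
      show "emeasure hvolume (SL2C_act P ` cusp_box e h) < \<infinity>" using volume_act[OF P B] B(3) by simp
      fix A p assume A: "A \<in> matrix_group \<Gamma>" and p: "p \<in> SL2C_act P ` cusp_box e h" "SL2C_act A p \<in> SL2C_act P ` cusp_box e h"
      obtain u v where uv: "u \<in> cusp_box e h" "v \<in> cusp_box e h" "p = SL2C_act P u" "SL2C_act A p = SL2C_act P v"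
        using p by auto
      have H: "u \<in> H3" "v \<in> H3" using uv B by auto
      have dA: "det A = 1" using A by (simp add: matrix_group_def)
      have "SL2C_act (adj2 P ** A ** P) u = SL2C_act (adj2 P) (SL2C_act A (SL2C_act P u))"
        using P dA H by (simp add: SL2C_act_mult SL2C_act_H3 det_mul)
      also have "\<dots> = v" using uv P H by (simp add: SL2C_act_adj2)
      finally have "SL2C_act (adj2 P ** A ** P) u \<in> cusp_box e h" using uv by simp
      moreover have "adj2 P ** A ** P \<in> conj_group P (matrix_group \<Gamma>)" using A by (auto simp: conj_group_def)
      ultimately have "adj2 P ** A ** P = mat 1 \<or> adj2 P ** A ** P = - mat 1" using e(2)[OF h(1)] uv(1) by blast
      then show "A = mat 1 \<or> A = - mat 1"
        using P by (simp add: conj_eq_iff matrix_mul_uminus adj2_inverse)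
    qed
    then show ?thesis using volume_act[OF P B] by simp
  qed
  define \<mu> where "\<mu> = measure lborel (ball (1::complex) e)"
  have mu: "\<mu> > 0" unfolding \<mu>_def using content_ball_pos[OF e(1), of "1::complex"] by simp
  obtain V where V: "emeasure hvolume F = ennreal V" "V \<ge> 0" using F(2) by (cases "emeasure hvolume F") auto
  obtain n :: nat where n: "2 * V / \<mu> < real n" using reals_Archimedean2 by blast
  have n0: "n > 0" using n V mu by (cases n) (auto simp: divide_less_0_iff)
  define h where "h = 1 / (2 * real n)"
  have h: "h > 0" "2 * h \<le> 1" "h < 1" using n0 by (auto simp: h_def divide_less_eq)
  have "ennreal (\<mu> / (8 * h\<^sup>2)) \<le> ennreal V"
    using order_trans[OF cusp_box_large[OF e(1) h(1,2)] le[OF h(1,3)]] V unfolding \<mu>_def by simp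
  then have "\<mu> / (8 * h\<^sup>2) \<le> V" using V by simp
  moreover have "\<mu> / (8 * h\<^sup>2) = \<mu> * real n * real n / 2" using n0 by (simp add: h_def power2_eq_square field_simps)
  moreover have "\<mu> * real n * 1 \<le> \<mu> * real n * real n" using mu n0 by (intro mult_left_mono) auto
  moreover have "V < \<mu> * real n / 2" using n mu by (simp add: field_simps)
  ultimately show False by linarith
qed

section \<open>Hyperbolic elements in general position\<close>

lemma trace_elliptic_imp_trivial:
  assumes free: "acts_freely \<Gamma>" and A: "A \<in> matrix_group \<Gamma>"
    and tr: "trace A = complex_of_real \<tau>" "\<tau>\<^sup>2 < 4"
  shows False
proof -
  have dA: "det A = 1" "pm A \<in> \<Gamma>" using A by (auto simp: matrix_group_def)
  obtain p where p: "p \<in> H3" "SL2C_act A p = p" using elliptic_fixed_point[OF dA(1) tr] by blast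
  then have "pm A = \<one>\<^bsub>PSL2C\<^esub>" using free dA(2) act_rcoset[of A p] unfolding acts_freely_def by auto
  then have "A = mat 1 \<or> A = - mat 1" by (simp only: one_PSL2C pm_eq_iff)
  then have "trace A = 2 \<or> trace A = -2" by (auto simp: mat2_one)
  then have "complex_of_real \<tau> = complex_of_real 2 \<or> complex_of_real \<tau> = complex_of_real (-2)" using tr(1) by auto
  then have "\<tau> = 2 \<or> \<tau> = -2" by (simp only: of_real_eq_iff)
  then show False using tr(2) by auto
qed

text \<open>Otherwise all traces are \<open>\<plusminus>2\<close>, as elliptic elements have fixed points. If the group is not trivial,
  conjugate some nontrivial element to \<open>T = (1 u; 0 1)\<close>. If \<open>c\<close> is the lower left entry of \<open>B\<close>, the traces
  of \<open>B\<close>, \<open>T B\<close> and \<open>T\<^sup>2 B\<close> form an arithmetic progression with difference \<open>u c\<close> and all terms in \<open>{2, -2}\<close>.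
  So \<open>c = 0\<close>, and the whole group consists of translations.\<close>
lemma exists_loxodromic:
  assumes K: "Kleinian_group \<Gamma>" and free: "acts_freely \<Gamma>" and fin: "finite_covolume \<Gamma>"
  shows "\<exists>A\<in>matrix_group \<Gamma>. loxodromic (pm A)"
proof (rule ccontr)
  assume "\<not> ?thesis"
  then have nolox: "\<not> loxodromic (pm A)" if "A \<in> matrix_group \<Gamma>" for A using that by blast
  interpret discrete_SL2 "matrix_group \<Gamma>" by (rule discrete_matrix_group[OF K])
  have par: "(trace A)\<^sup>2 = 4" if A: "A \<in> matrix_group \<Gamma>" for A
  proof -
    have "(trace A)\<^sup>2 \<in> complex_of_real ` {0..4}"
      using nolox[OF A] A pm_in_PSL2C[of A] unfolding loxodromic_def tr_sq_rcoset by (simp add: matrix_group_def)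
    then obtain s where s: "0 \<le> s" "s \<le> 4" "(trace A)\<^sup>2 = complex_of_real s" by auto
    have "s = 4"
    proof (rule ccontr)
      assume "s \<noteq> 4"
      have "(trace A)\<^sup>2 = (complex_of_real (sqrt s))\<^sup>2" using s by (simp flip: of_real_power)
      then have "trace A = complex_of_real (sqrt s) \<or> trace A = complex_of_real (- sqrt s)"
        by (simp add: power2_eq_iff)
      moreover have "(sqrt s)\<^sup>2 < 4" "(- sqrt s)\<^sup>2 < 4" using s \<open>s \<noteq> 4\<close> by auto
      ultimately show False using trace_elliptic_imp_trivial[OF free A] by blast
    qed
    then show ?thesis using s by simp
  qed
  show False
  proof (cases "matrix_group \<Gamma> \<subseteq> {mat 1, - mat 1}")
    case True
    have "conj_group (mat 1) (matrix_group \<Gamma>) \<subseteq> {mat 1, - mat 1}"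
      using True by (auto simp: conj_group_def mat2_one adj2_mult_mat2)
    then have "\<not> finite_covolume \<Gamma>"
      by (intro elementary_infinite_covolume[OF K, of "mat 1"]) (auto simp: mat2_one)
    then show False using fin by blast
  next
    case False
    then obtain A1 where A1: "A1 \<in> matrix_group \<Gamma>" "A1 \<noteq> mat 1" "A1 \<noteq> - mat 1" by blast
    have "\<exists>A0. A0 \<in> matrix_group \<Gamma> \<and> A0 \<noteq> mat 1 \<and> trace A0 = 2"
    proof -
      have "(trace A1 - 2) * (trace A1 + 2) = 0" using par[OF A1(1)] by (simp add: power2_eq_square algebra_simps)
      then consider "trace A1 = 2" | "trace A1 = -2" by (auto simp: eq_neg_iff_add_eq_0)
      then show ?thesis
      proof cases
        case 2
        have "trace (- A1) = 2" using 2 by (simp add: trace_def sum_negf)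
        moreover have "- A1 \<noteq> mat 1" using A1(3) by (metis minus_minus)
        ultimately show ?thesis using uminus_mem[OF A1(1)] by blast
      qed (use A1 in blast)
    qed
    then obtain A0 where A0: "A0 \<in> matrix_group \<Gamma>" "A0 \<noteq> mat 1" "trace A0 = 1 + 1 / 1" by auto
    obtain P u where P: "det P = 1" "A0 = P ** mat2 1 u 0 (1/1) ** adj2 P"
      using triangularize[OF det_1[OF A0(1)] A0(3)] by auto
    have u0: "u \<noteq> 0"
    proof
      assume "u = 0"
      then have "A0 = P ** mat 1 ** adj2 P" using P(2) by (simp add: mat2_one)
      then show False using A0(2) P(1) by (simp add: adj2_inverse)
    qed
    define H where "H = conj_group P (matrix_group \<Gamma>)"
    interpret H: discrete_SL2 H unfolding H_def by (rule discrete_conj_group[OF discrete_matrix_group[OF K] P(1)])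
    have T: "mat2 1 u 0 1 \<in> H" unfolding H_def mem_conj_group[OF P(1)] using A0(1) P(2) by simp
    have parH: "(trace B)\<^sup>2 = 4" if "B \<in> H" for B
      using that par[of "P ** B ** adj2 P"] trace_conj[OF P(1)] unfolding H_def mem_conj_group[OF P(1)] by simp
    have form: "B$2$1 = 0 \<and> (B$1$1)\<^sup>2 = 1" if B: "B \<in> H" for B
    proof -
      obtain a b c d where B': "B = mat2 a b c d" by (rule mat2_cases)
      have B2: "mat2 1 u 0 1 ** B \<in> H" "mat2 1 u 0 1 ** (mat2 1 u 0 1 ** B) \<in> H"
        using H.mult_mem[OF T] B by blast+
      have "(a + d)\<^sup>2 = 4" "(a + u * c + d)\<^sup>2 = 4" "(a + u * c + u * c + d)\<^sup>2 = 4"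
        using parH[OF B] parH[OF B2(1)] parH[OF B2(2)] by (simp_all add: B')
      moreover have "2 * (u * c)\<^sup>2 = (a + u * c + u * c + d)\<^sup>2 - 2 * (a + u * c + d)\<^sup>2 + (a + d)\<^sup>2"
        by (simp add: power2_eq_square algebra_simps)
      ultimately have "(u * c)\<^sup>2 = 0" by simp
      then have c: "c = 0" using u0 by simp
      have "a * d = 1" using H.det_1[OF B] c by (simp add: B')
      then have "(a - d)\<^sup>2 = 0" using \<open>(a + d)\<^sup>2 = 4\<close> by algebra
      then have "a = d" by simp
      then show ?thesis using \<open>a * d = 1\<close> c by (simp add: B' power2_eq_square)
    qed
    have "\<not> finite_covolume \<Gamma>"
      by (rule elementary_infinite_covolume[OF K P(1)]) (use form in \<open>auto simp: H_def\<close>)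
    then show False using fin by blast
  qed
qed

text \<open>Since the group is not diagonal, some element has a nonzero off-diagonal entry, and then both are
  nonzero because triangular elements are diagonal. The trace is nonzero, as an element of order two would
  have a fixed point; passing to the inverse if necessary, the upper left entry is nonzero.\<close>
lemma loxodromic_and_generic_element:
  assumes K: "Kleinian_group \<Gamma>" and free: "acts_freely \<Gamma>" and fin: "finite_covolume \<Gamma>"
  obtains P l x y z w where "det P = 1" "cmod l > 1" "mat2 l 0 0 (1/l) \<in> conj_group P (matrix_group \<Gamma>)"
    "x \<noteq> 0" "y \<noteq> 0" "z \<noteq> 0" "mat2 x y z w \<in> conj_group P (matrix_group \<Gamma>)"
proof -
  interpret discrete_SL2 "matrix_group \<Gamma>" by (rule discrete_matrix_group[OF K])
  obtain A where A: "A \<in> matrix_group \<Gamma>" "loxodromic (pm A)" using exists_loxodromic[OF assms] by blast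
  obtain l where l: "cmod l > 1" "trace A = l + 1/l" using loxodromic_eigenvalue[OF A(2)] by blast
  have l0: "l \<noteq> 0" using l by auto
  have "cmod (l * l) \<noteq> 1" using l by (simp add: norm_mult less_1_mult order_less_imp_not_eq2)
  then have "l * l \<noteq> 1" by auto
  then obtain P where P: "det P = 1" "A = P ** mat2 l 0 0 (1/l) ** adj2 P"
    using diagonalize[OF det_1[OF A(1)] l(2) l0] by blast
  define H where "H = conj_group P (matrix_group \<Gamma>)"
  note memH = mem_conj_group[OF P(1), of _ "matrix_group \<Gamma>", folded H_def]
  interpret H: discrete_SL2 H unfolding H_def by (rule discrete_conj_group[OF discrete_matrix_group[OF K] P(1)])
  have b: "mat2 l 0 0 (1/l) \<in> H" unfolding memH using A(1) P(2) by simp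
  have "\<exists>B\<in>H. B$1$2 \<noteq> 0 \<or> B$2$1 \<noteq> 0"
  proof (rule ccontr)
    assume "\<not> ?thesis"
    then have "\<not> finite_covolume \<Gamma>"
      by (intro elementary_infinite_covolume[OF K P(1)]) (auto simp: H_def)
    then show False using fin by blast
  qed
  then obtain p q r s where B: "mat2 p q r s \<in> H" "q \<noteq> 0 \<or> r \<noteq> 0" by (metis mat2_cases mat2_entries)
  have qr: "q \<noteq> 0" "r \<noteq> 0"
    using B H.triangular_imp_diagonal[OF l(1) b] by auto
  have "p + s \<noteq> 0"
  proof
    assume "p + s = 0"
    then have t0: "trace (P ** mat2 p q r s ** adj2 P) = complex_of_real 0" using trace_conj[OF P(1)] by simp
    show False using trace_elliptic_imp_trivial[OF free _ t0] B(1) unfolding memH by simp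
  qed
  then consider "p \<noteq> 0" | "s \<noteq> 0" by (cases "p = 0") auto
  then show ?thesis
  proof cases
    case 1
    then show ?thesis using that[OF P(1) l(1) b[unfolded H_def] 1 qr] B(1) by (simp add: H_def)
  next
    case 2
    have "mat2 s (- q) (- r) p \<in> H" using H.adj2_mem[OF B(1)] by simp
    then show ?thesis using that[OF P(1) l(1) b[unfolded H_def] 2, of "-q" "-r" p] qr by (simp add: H_def)
  qed
qed


section \<open>Closed geodesics of equal length\<close>

lemma card_le_twice_card_image:
  assumes "finite S"
    and "\<And>a b c. a \<in> S \<Longrightarrow> b \<in> S \<Longrightarrow> c \<in> S \<Longrightarrow> f a = f b \<Longrightarrow> f a = f c \<Longrightarrow> a = b \<or> a = c \<or> b = c"
  shows "card S \<le> 2 * card (f ` S)"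
proof -
  have "card {x \<in> S. f x = y} \<le> 2" for y
  proof (rule ccontr)
    assume "\<not> ?thesis"
    then have "3 \<le> card {x \<in> S. f x = y}" by simp
    then obtain T where T: "T \<subseteq> {x \<in> S. f x = y}" "card T = 3" by (metis obtain_subset_with_card_n)
    obtain a b c where "T = {a, b, c}" "a \<noteq> b" "a \<noteq> c" "b \<noteq> c" using T(2) unfolding card_3_iff by blast
    then show False using assms(2)[of a b c] T(1) by auto
  qed
  then have "(\<Sum>y\<in>f ` S. card {x \<in> S. f x = y}) \<le> (\<Sum>y\<in>f ` S. 2)" by (intro sum_mono) simp
  moreover have "card S = (\<Sum>y\<in>f ` S. card {x \<in> S. f x = y})"
    using sum.image_gen[OF assms(1), of "\<lambda>_. 1::nat" f] by simp
  ultimately show ?thesis by simp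
qed

lemma conj_pm:
  assumes "det H = 1"
  shows "pm H \<otimes>\<^bsub>PSL2C\<^esub> pm A \<otimes>\<^bsub>PSL2C\<^esub> inv\<^bsub>PSL2C\<^esub> (pm H) = pm (H ** A ** adj2 H)"
  by (simp only: inv_pm[OF assms] pm_mult)

lemma geodesic_rel_cases:
  assumes K: "Kleinian_group \<Gamma>" and AB: "A \<in> matrix_group \<Gamma>" "B \<in> matrix_group \<Gamma>"
    and rel: "(pm A, pm B) \<in> geodesic_rel \<Gamma>"
  obtains H where "H \<in> matrix_group \<Gamma>" "B = H ** A ** adj2 H \<or> B = - (H ** A ** adj2 H) \<or>
     B = H ** adj2 A ** adj2 H \<or> B = - (H ** adj2 A ** adj2 H)"
proof -
  obtain h where h: "h \<in> \<Gamma>" "pm B = h \<otimes>\<^bsub>PSL2C\<^esub> pm A \<otimes>\<^bsub>PSL2C\<^esub> inv\<^bsub>PSL2C\<^esub> h \<or>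
             pm B = h \<otimes>\<^bsub>PSL2C\<^esub> inv\<^bsub>PSL2C\<^esub> (pm A) \<otimes>\<^bsub>PSL2C\<^esub> inv\<^bsub>PSL2C\<^esub> h"
    using rel unfolding geodesic_rel_def by blast
  obtain H where H: "H \<in> matrix_group \<Gamma>" "h = pm H" using pm_matrix_group[OF K h(1)] by blast
  have d: "det A = 1" "det H = 1" using AB H by (auto simp: matrix_group_def)
  have "pm B = pm (H ** A ** adj2 H) \<or> pm B = pm (H ** adj2 A ** adj2 H)"
    using h(2) unfolding H(2) inv_pm[OF d(1)] conj_pm[OF d(2)] .
  then have "B = H ** A ** adj2 H \<or> B = - (H ** A ** adj2 H) \<or>
     B = H ** adj2 A ** adj2 H \<or> B = - (H ** adj2 A ** adj2 H)" unfolding pm_eq_iff by blast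
  then show ?thesis using that H(1) by blast
qed

lemma loxodromics_pm:
  assumes "A \<in> matrix_group \<Gamma>" "cmod (trace A) > 2"
  shows "pm A \<in> loxodromics \<Gamma>"
proof -
  have "(trace A)\<^sup>2 \<notin> complex_of_real ` {0..4}"
  proof
    assume "(trace A)\<^sup>2 \<in> complex_of_real ` {0..4}"
    then obtain s where s: "s \<in> {0..4}" "(trace A)\<^sup>2 = complex_of_real s" by blast
    have "(cmod (trace A))\<^sup>2 = cmod (complex_of_real s)" using s(2) by (metis norm_power)
    then have "(cmod (trace A))\<^sup>2 \<le> 4" using s(1) by simp
    moreover have "2\<^sup>2 < (cmod (trace A))\<^sup>2" using assms(2) by (intro power_strict_mono) auto
    ultimately show False by simp
  qed
  then show ?thesis
    using assms pm_in_PSL2C[of A] by (simp add: loxodromics_def loxodromic_def tr_sq_rcoset matrix_group_def)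
qed

lemma geodesic_rel_refl:
  assumes "A \<in> matrix_group \<Gamma>" "Kleinian_group \<Gamma>" "pm A \<in> loxodromics \<Gamma>"
  shows "(pm A, pm A) \<in> geodesic_rel \<Gamma>"
proof -
  interpret discrete_SL2 "matrix_group \<Gamma>" by (rule discrete_matrix_group[OF assms(2)])
  have id: "pm (mat 1) \<in> \<Gamma>" using one_mem by (simp add: matrix_group_def)
  have one: "adj2 (mat 1) = mat 1" by (simp add: mat2_one)
  have "pm A = pm (mat 1) \<otimes>\<^bsub>PSL2C\<^esub> pm A \<otimes>\<^bsub>PSL2C\<^esub> inv\<^bsub>PSL2C\<^esub> (pm (mat 1))"
    by (subst conj_pm) (simp_all add: one)
  then show ?thesis using assms(3) id unfolding geodesic_rel_def by blast
qed

lemma geodesic_length_class: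
  assumes K: "Kleinian_group \<Gamma>" and A: "A \<in> matrix_group \<Gamma>" "trace A = l + 1/l" "cmod l > 1"
    and lox: "pm A \<in> loxodromics \<Gamma>"
  shows "geodesic_length (geodesic_rel \<Gamma> `` {pm A}) = 2 * ln (cmod l)"
proof -
  have len: "translation_length \<delta> = 2 * ln (cmod l)" if "\<delta> \<in> geodesic_rel \<Gamma> `` {pm A}" for \<delta>
  proof -
    have rel: "(pm A, \<delta>) \<in> geodesic_rel \<Gamma>" using that by blast
    then have "\<delta> \<in> \<Gamma>" by (auto simp: geodesic_rel_def loxodromics_def)
    then obtain B where B: "B \<in> matrix_group \<Gamma>" "\<delta> = pm B" using pm_matrix_group[OF K] by blast
    obtain H where H: "H \<in> matrix_group \<Gamma>" "B = H ** A ** adj2 H \<or> B = - (H ** A ** adj2 H) \<or>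
        B = H ** adj2 A ** adj2 H \<or> B = - (H ** adj2 A ** adj2 H)"
      using geodesic_rel_cases[OF K A(1) B(1)] rel B(2) by blast
    define C where "C = (if trace B = l + 1/l then B else - B)"
    have dH: "det H = 1" using H(1) by (simp add: matrix_group_def)
    have neg: "trace (- X) = - trace X" for X :: "complex^2^2" by (simp add: trace_def sum_negf)
    have "trace B = l + 1/l \<or> trace B = - (l + 1/l)"
      using H(2) trace_conj[OF dH] A(2) by (auto simp: neg)
    then have "trace C = l + 1/l" by (auto simp: C_def neg)
    moreover have "det C = 1" using B(1) by (simp add: C_def matrix_group_def det_uminus_2)
    ultimately have "translation_length (pm C) = 2 * ln (cmod l)" using A(3) by (intro translation_length_eq)
    moreover have "pm C = pm B" by (auto simp: C_def)
    ultimately show ?thesis using B(2) by simp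
  qed
  have "pm A \<in> geodesic_rel \<Gamma> `` {pm A}" using geodesic_rel_refl[OF A(1) K lox] by blast
  then have "translation_length ` (geodesic_rel \<Gamma> `` {pm A}) = {2 * ln (cmod l)}" using len by auto
  then show ?thesis by (simp add: geodesic_length_def)
qed

text \<open>If neither \<open>B\<close> nor \<open>C\<close> is conjugate to \<open>A\<close>, both are conjugate to the inverse of \<open>A\<close>, hence to each other.
  Equality of the nonzero traces excludes the signs that come from passing to cosets.\<close>
lemma same_class_of_three:
  assumes K: "Kleinian_group \<Gamma>" and mem: "A \<in> matrix_group \<Gamma>" "B \<in> matrix_group \<Gamma>" "C \<in> matrix_group \<Gamma>"
    and tr: "trace A = \<tau>" "trace B = \<tau>" "trace C = \<tau>" "\<tau> \<noteq> 0"
    and rel: "(pm A, pm B) \<in> geodesic_rel \<Gamma>" "(pm A, pm C) \<in> geodesic_rel \<Gamma>"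
  obtains H where "H \<in> matrix_group \<Gamma>" "B = H ** A ** adj2 H \<or> C = H ** A ** adj2 H \<or> C = H ** B ** adj2 H"
proof -
  interpret discrete_SL2 "matrix_group \<Gamma>" by (rule discrete_matrix_group[OF K])
  have neg: "trace (- X) = - trace X" for X :: "complex^2^2" by (simp add: trace_def sum_negf)
  have tn: "\<tau> \<noteq> - \<tau>" using tr(4) by simp
  have step: "\<exists>H\<in>matrix_group \<Gamma>. D = H ** A ** adj2 H \<or> D = H ** adj2 A ** adj2 H"
    if D: "D \<in> matrix_group \<Gamma>" "trace D = \<tau>" "(pm A, pm D) \<in> geodesic_rel \<Gamma>" for D
  proof -
    obtain H where H: "H \<in> matrix_group \<Gamma>" "D = H ** A ** adj2 H \<or> D = - (H ** A ** adj2 H) \<or>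
        D = H ** adj2 A ** adj2 H \<or> D = - (H ** adj2 A ** adj2 H)"
      using geodesic_rel_cases[OF K mem(1) D(1,3)] by blast
    have "trace (- (H ** A ** adj2 H)) = - \<tau>" "trace (- (H ** adj2 A ** adj2 H)) = - \<tau>"
      using trace_conj[OF det_1[OF H(1)]] tr(1) by (simp_all add: neg)
    then have "D \<noteq> - (H ** A ** adj2 H)" "D \<noteq> - (H ** adj2 A ** adj2 H)" using D(2) tn by metis+
    then show ?thesis using H by blast
  qed
  obtain H where H: "H \<in> matrix_group \<Gamma>" "B = H ** A ** adj2 H \<or> B = H ** adj2 A ** adj2 H"
    using step[OF mem(2) tr(2) rel(1)] by blast
  obtain J where J: "J \<in> matrix_group \<Gamma>" "C = J ** A ** adj2 J \<or> C = J ** adj2 A ** adj2 J"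
    using step[OF mem(3) tr(3) rel(2)] by blast
  show ?thesis
  proof (cases "B = H ** A ** adj2 H \<or> C = J ** A ** adj2 J")
    case True
    then show ?thesis using that H(1) J(1) by blast
  next
    case False
    then have BC: "B = H ** adj2 A ** adj2 H" "C = J ** adj2 A ** adj2 J" using H J by auto
    have "adj2 A = adj2 H ** B ** H" using conj_eq_iff[OF det_1[OF H(1)], of B "adj2 A"] BC(1) by simp
    then have "C = J ** (adj2 H ** B ** H) ** adj2 J" using BC(2) by simp
    then have "C = (J ** adj2 H) ** B ** adj2 (J ** adj2 H)"
      by (simp add: adj2_mult matrix_mul_assoc)
    then show ?thesis using that mult_mem[OF J(1) adj2_mem[OF H(1)]] by blast
  qed
qed

theorem corollary1p4:
  fixes \<Gamma> :: "(complex^2^2) set set"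
  assumes "Kleinian_group \<Gamma>"
    and "acts_freely \<Gamma>"
    and "finite_covolume \<Gamma>"
  shows "\<forall>n::nat. n > 0 \<longrightarrow> (\<exists>l::real. l > 0 \<and>
    (\<exists>S. S \<subseteq> {C \<in> closed_geodesics \<Gamma>. geodesic_length C = l} \<and> finite S \<and> card S \<ge> n))"
proof (intro allI impI)
  fix n :: nat
  note K = assms(1)
  let ?G = "matrix_group \<Gamma>"
  interpret discrete_SL2 ?G by (rule discrete_matrix_group[OF K])
  obtain P l x y z w where P: "det P = 1" and l: "cmod l > 1" "mat2 l 0 0 (1/l) \<in> conj_group P ?G"
    and xyz: "x \<noteq> 0" "y \<noteq> 0" "z \<noteq> 0" "mat2 x y z w \<in> conj_group P ?G"
    using loxodromic_and_generic_element[OF assms] by blast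
  interpret H: discrete_SL2 "conj_group P ?G" by (rule discrete_conj_group[OF discrete_matrix_group[OF K] P])
  obtain S \<tau> where S: "S \<subseteq> conj_group P ?G" "finite S" "card S = 2^(2*n)" "\<And>A. A \<in> S \<Longrightarrow> trace A = \<tau>" "cmod \<tau> > 2"
    and nc: "\<And>A B g. A \<in> S \<Longrightarrow> B \<in> S \<Longrightarrow> A \<noteq> B \<Longrightarrow> g \<in> conj_group P ?G \<Longrightarrow> g ** A \<noteq> B ** g"
    using H.many_nonconjugate_equal_trace[OF l xyz, of "2*n"] by metis
  obtain L where L: "\<tau> = L + 1/L" "L \<noteq> 0" "cmod L \<ge> 1" by (rule trace_eigenvalue)
  have L1: "cmod L > 1"
  proof (rule ccontr)
    assume "\<not> cmod L > 1"
    then have "cmod L = 1" using L by simp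
    then have "cmod \<tau> \<le> 2" using norm_triangle_ineq[of L "1/L"] L(1) by (simp add: norm_divide)
    then show False using S(5) by simp
  qed
  define M where "M B = P ** B ** adj2 P" for B
  have M: "M B \<in> ?G" "trace (M B) = \<tau>" if "B \<in> S" for B
    using that S(1,4) mem_conj_group[OF P] trace_conj[OF P] by (auto simp: M_def)
  have \<tau>0: "\<tau> \<noteq> 0" using S(5) by auto
  have lox: "pm (M B) \<in> loxodromics \<Gamma>" if "B \<in> S" for B
    using loxodromics_pm[OF M(1)[OF that]] M(2)[OF that] S(5) by simp
  define cl where "cl B = geodesic_rel \<Gamma> `` {pm (M B)}" for B
  have cl: "cl B \<in> {C \<in> closed_geodesics \<Gamma>. geodesic_length C = 2 * ln (cmod L)}" if "B \<in> S" for B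
    using geodesic_length_class[OF K M(1)[OF that] _ L1 lox[OF that]] M(2)[OF that] L(1) lox[OF that]
    unfolding closed_geodesics_def cl_def by (simp add: quotientI)
  have nonconj: "A = B" if AB: "A \<in> S" "B \<in> S" and H: "H \<in> ?G" "M B = H ** M A ** adj2 H" for A B H
  proof (rule ccontr)
    assume "A \<noteq> B"
    define g where "g = adj2 P ** H ** P"
    have g: "g \<in> conj_group P ?G" using H(1) by (auto simp: g_def conj_group_def)
    have PgP: "P ** g ** adj2 P = H" using conj_eq_iff[OF P] g_def by metis
    have "M B ** H = H ** M A ** (adj2 H ** H)" unfolding H(2) by (simp add: matrix_mul_assoc)
    then have "M B ** H = H ** M A" using det_1[OF H(1)] by (simp add: adj2_inverse)
    then have "P ** (B ** g) ** adj2 P = P ** (g ** A) ** adj2 P"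
      unfolding conj_mult[OF P] PgP M_def by simp
    then have "B ** g = g ** A" using conj_eq_iff[OF P] by metis
    then show False using nc[OF AB \<open>A \<noteq> B\<close> g] by simp
  qed
  have "card S \<le> 2 * card (cl ` S)"
  proof (rule card_le_twice_card_image[OF S(2)])
    fix A B C assume ABC: "A \<in> S" "B \<in> S" "C \<in> S" and eq: "cl A = cl B" "cl A = cl C"
    have self: "pm (M D) \<in> cl D" if "D \<in> S" for D
      using geodesic_rel_refl[OF M(1)[OF that] K lox[OF that]] by (simp add: cl_def)
    have "(pm (M A), pm (M B)) \<in> geodesic_rel \<Gamma>" "(pm (M A), pm (M C)) \<in> geodesic_rel \<Gamma>"
      using self[OF ABC(2)] self[OF ABC(3)] unfolding eq[symmetric] by (simp_all add: cl_def)
    then obtain H where "H \<in> ?G" "M B = H ** M A ** adj2 H \<or> M C = H ** M A ** adj2 H \<or> M C = H ** M B ** adj2 H"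
      using same_class_of_three[OF K M(1)[OF ABC(1)] M(1)[OF ABC(2)] M(1)[OF ABC(3)]
          M(2)[OF ABC(1)] M(2)[OF ABC(2)] M(2)[OF ABC(3)] \<tau>0] by blast
    then show "A = B \<or> A = C \<or> B = C" using nonconj ABC by metis
  qed
  moreover have "2 * n < 2^(2*n)" by (rule less_exp)
  ultimately have "card (cl ` S) \<ge> n" using S(3) by linarith
  moreover have "2 * ln (cmod L) > 0" using ln_gt_zero[OF L1] by simp
  moreover have "finite (cl ` S)" using S(2) by simp
  moreover have "cl ` S \<subseteq> {C \<in> closed_geodesics \<Gamma>. geodesic_length C = 2 * ln (cmod L)}" using cl by blast
  ultimately show "\<exists>l::real. l > 0 \<and>
    (\<exists>S. S \<subseteq> {C \<in> closed_geodesics \<Gamma>. geodesic_length C = l} \<and> finite S \<and> card S \<ge> n)" by blast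
qed

end
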